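(* Let $\mathcal{R}=(r_i,\rho_i)_{i\ge1}$ be any sequence of matching pairs, $\beta\in(0,\frac13)$, and $\mu_\eta$ with $\eta\in(0,1]$. Then for all $n\in\mathbb{N}$ and all $w\in\mathcal{A}^n$ there exists an eigenfunction $u_w$ of $-\Delta_D^{\mu_\eta,\mathcal{R}}$ with $\operatorname{supp}(u_w)\subset K_w$, such that the corresponding eigenvalue has multiplicity at least $3^n$.
   Context: Stretched Sierpinski Gasket. Fix $\alpha\in(0,1)$. Let $p_1,p_2,p_3\in\mathbb{R}^2$ be the vertices of an equilateral triangle of side length 1, $\mathcal{A}=\{1,2,3\}$, $G_i(x)=\frac{1-\alpha}{2}(x-p_i)+p_i$, and for $\{i,j,k\}=\{1,2,3\}$ let $e_i=\{\lambda G_j(p_k)+(1-\lambda)G_k(p_j):\lambda\in(0,1)\}$ (open segment). $K$ is the unique nonempty compact set with $K=G_1(K)\cup G_2(K)\cup G_3(K)\cup e_1\cup e_2\cup e_3$. For $w=w_1\cdots w_m\in\mathcal{A}^m$, $m\in\mathbb{N}_0$, put $|w|=m$, $G_w=G_{w_1}\circ\cdots\circ G_{w_m}$ ($G_w=\mathrm{id}$ for the empty word), $K_w=G_w(K)$, $e_i^w=G_w(e_i)$; $V_0=\{p_1,p_2,p_3\}$. Energy. A matching pair is $(r,\rho)$ with $r,\rho>0$ and $\frac53 r+\rho=1$. For a sequence of matching pairs $\mathcal{R}=(r_i,\rho_i)_{i\ge1}$ put $\delta_m=r_1\cdots r_m$ ($\delta_0=1$), $\gamma_m=r_1\cdots r_{m-1}\rho_m$.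 For $u:K\to\mathbb{R}$ let $Q_0(u,u)=(u(p_1)-u(p_2))^2+(u(p_2)-u(p_3))^2+(u(p_3)-u(p_1))^2$, $Q_m(u,u)=\sum_{w\in\mathcal{A}^m}Q_0(u\circ G_w,u\circ G_w)$, and $\mathcal{D}^I_k(u,u)=\sum_{w\in\mathcal{A}^{k-1},\,i\in\mathcal{A}}\int_0^1\big(\frac{d(u\circ\xi_{e_i^w})}{dx}\big)^2dx$, where $\xi_{e}:(0,1)\to e$ is the affine parametrization of the segment $e$. Define $$\mathcal{E}_{\mathcal{R}}(u,u)=\lim_{m\to\infty}\frac1{\delta_m}Q_m(u,u)+\sum_{k=1}^\infty\frac1{\gamma_k}\mathcal{D}^I_k(u,u)$$ on $\mathcal{D}_{\mathcal{R}}=\{u\in C(K):\ u\circ\xi_{e_i^w}\in H^1(0,1)\text{ for all } i\in\mathcal{A},\,w\in\bigcup_m\mathcal{A}^m,\ \mathcal{E}_{\mathcal{R}}(u,u)<\infty\}$, extended to a bilinear form by polarization. Let $\mathcal{D}_{\mathcal{R}}^0=\{u\in\mathcal{D}_{\mathcal{R}}: u|_{V_0}\equiv0\}$. Measures. $\mu_f$ is the Borel probability measure on $K$ with $\mu_f(K_w)=3^{-|w|}$ for all words $w$. For $\beta\in(0,\frac13)$, $\mu_l$ is the Borel probability measure on $K$ carried by the union of all $e_i^w$ with $\mu_l|_{e_i^w}=a\beta^{|w|}\frac{\lambda^1}{\lambda^1(e_i^w)}$, where $\lambda^1$ is one-dimensional Lebesgue measure (length) and $a=\frac13-\beta$. For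 $\eta\in(0,1]$, $\mu_\eta=\eta\mu_l+(1-\eta)\mu_f$. Operators. It is known that $(\mathcal{E}_{\mathcal{R}},\mathcal{D}_{\mathcal{R}}^0)$ is a regular Dirichlet form on $L^2(K,\mu_\eta|_{K\setminus V_0})$ whose associated self-adjoint operator $-\Delta_D^{\mu_\eta,\mathcal{R}}$ has discrete nonnegative spectrum. *)

theory Defs
  imports "HOL-Analysis.Analysis"
begin

section \<open>The stretched Sierpinski gasket\<close>

text \<open>
  The alphabet is the three-element type \<open>3\<close>, with elements \<open>1, 2, 3\<close> and arithmetic modulo 3
  (so \<open>3 = 0\<close>); hence \<open>{i, i + 1, i + 2}\<close> is always the whole alphabet. Words are lists
  over it.
\<close>

definition equilateral :: "(3 \<Rightarrow> real^2) \<Rightarrow> bool" where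
  "equilateral p \<longleftrightarrow> (\<forall>i j. i \<noteq> j \<longrightarrow> dist (p i) (p j) = 1)"

definition G :: "real \<Rightarrow> (3 \<Rightarrow> real^2) \<Rightarrow> 3 \<Rightarrow> real^2 \<Rightarrow> real^2" where
  "G \<alpha> p i x = ((1 - \<alpha>) / 2) *\<^sub>R (x - p i) + p i"

primrec Gw :: "real \<Rightarrow> (3 \<Rightarrow> real^2) \<Rightarrow> 3 list \<Rightarrow> real^2 \<Rightarrow> real^2" where
  "Gw \<alpha> p [] = id"
| "Gw \<alpha> p (i # w) = G \<alpha> p i \<circ> Gw \<alpha> p w"

definition edge :: "real \<Rightarrow> (3 \<Rightarrow> real^2) \<Rightarrow> 3 \<Rightarrow> (real^2) set" where
  "edge \<alpha> p i = open_segment (G \<alpha> p (i + 1) (p (i + 2))) (G \<alpha> p (i + 2) (p (i + 1)))"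

definition edgew :: "real \<Rightarrow> (3 \<Rightarrow> real^2) \<Rightarrow> 3 list \<Rightarrow> 3 \<Rightarrow> (real^2) set" where
  "edgew \<alpha> p w i = Gw \<alpha> p w ` edge \<alpha> p i"

text \<open>
  The affine parametrization over \<open>(0,1)\<close> of the edge \<open>edgew \<alpha> p w i\<close>. The choice of orientation
  is irrelevant below.
\<close>

definition xi :: "real \<Rightarrow> (3 \<Rightarrow> real^2) \<Rightarrow> 3 list \<Rightarrow> 3 \<Rightarrow> real \<Rightarrow> real^2" where
  "xi \<alpha> p w i t =
     Gw \<alpha> p w ((1 - t) *\<^sub>R G \<alpha> p (i + 1) (p (i + 2)) + t *\<^sub>R G \<alpha> p (i + 2) (p (i + 1)))"

definition is_stretched_gasket :: "real \<Rightarrow> (3 \<Rightarrow> real^2) \<Rightarrow> (real^2) set \<Rightarrow> bool" where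
  "is_stretched_gasket \<alpha> p K \<longleftrightarrow>
     compact K \<and> K \<noteq> {} \<and> K = (\<Union>i. G \<alpha> p i ` K) \<union> (\<Union>i. edge \<alpha> p i)"


section \<open>The Sobolev space H1(0,1)\<close>

definition in_L2 :: "'a measure \<Rightarrow> ('a \<Rightarrow> real) \<Rightarrow> bool" where
  "in_L2 M f \<longleftrightarrow> f \<in> borel_measurable M \<and> integrable M (\<lambda>x. (f x)\<^sup>2)"

definition leb01 :: "real measure" where
  "leb01 = restrict_space lborel {0<..<1}"

text \<open>
  Weak derivatives are tested against continuously differentiable functions with compact support
  in \<open>(0,1)\<close>; here \<open>\<phi>'\<close> is the derivative of the test function \<open>\<phi>\<close>.
\<close>

definition test_function :: "(real \<Rightarrow> real) \<Rightarrow> (real \<Rightarrow> real) \<Rightarrow> bool" where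
  "test_function \<phi> \<phi>' \<longleftrightarrow>
     (\<forall>t. (\<phi> has_real_derivative \<phi>' t) (at t)) \<and> continuous_on UNIV \<phi>' \<and>
     (\<exists>c d. 0 < c \<and> d < 1 \<and> (\<forall>t. t \<notin> {c..d} \<longrightarrow> \<phi> t = 0))"

definition is_weak_deriv :: "(real \<Rightarrow> real) \<Rightarrow> (real \<Rightarrow> real) \<Rightarrow> bool" where
  "is_weak_deriv f g \<longleftrightarrow>
     (\<forall>\<phi> \<phi>'. test_function \<phi> \<phi>' \<longrightarrow>
        (\<integral>t. f t * \<phi>' t \<partial>leb01) = - (\<integral>t. g t * \<phi> t \<partial>leb01))"

definition in_H1 :: "(real \<Rightarrow> real) \<Rightarrow> bool" where
  "in_H1 f \<longleftrightarrow> in_L2 leb01 f \<and> (\<exists>g. in_L2 leb01 g \<and> is_weak_deriv f g)"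

text \<open>The weak derivative is unique up to null sets, so the choice is immaterial; it is meaningful
  only for \<open>f\<close> in H1.\<close>

definition weak_deriv :: "(real \<Rightarrow> real) \<Rightarrow> real \<Rightarrow> real" where
  "weak_deriv f = (SOME g. in_L2 leb01 g \<and> is_weak_deriv f g)"


section \<open>The resistance forms\<close>

definition matching_pairs :: "(nat \<Rightarrow> real) \<Rightarrow> (nat \<Rightarrow> real) \<Rightarrow> bool" where
  "matching_pairs r \<rho> \<longleftrightarrow> (\<forall>i\<ge>1. r i > 0 \<and> \<rho> i > 0 \<and> 5 / 3 * r i + \<rho> i = 1)"

definition delta :: "(nat \<Rightarrow> real) \<Rightarrow> nat \<Rightarrow> real" where
  "delta r m = (\<Prod>i=1..m. r i)"

definition gam :: "(nat \<Rightarrow> real) \<Rightarrow> (nat \<Rightarrow> real) \<Rightarrow> nat \<Rightarrow> real" where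
  "gam r \<rho> m = (\<Prod>i=1..m-1. r i) * \<rho> m"

text \<open>Functions on \<open>K\<close> are total functions on the plane; only their values on \<open>K\<close> matter.\<close>

definition Q0 :: "(3 \<Rightarrow> real^2) \<Rightarrow> (real^2 \<Rightarrow> real) \<Rightarrow> real" where
  "Q0 p u = (u (p 1) - u (p 2))\<^sup>2 + (u (p 2) - u (p 3))\<^sup>2 + (u (p 3) - u (p 1))\<^sup>2"

definition Q :: "real \<Rightarrow> (3 \<Rightarrow> real^2) \<Rightarrow> nat \<Rightarrow> (real^2 \<Rightarrow> real) \<Rightarrow> real" where
  "Q \<alpha> p m u = (\<Sum>w\<in>{w. length w = m}. Q0 p (u \<circ> Gw \<alpha> p w))"

definition DI :: "real \<Rightarrow> (3 \<Rightarrow> real^2) \<Rightarrow> nat \<Rightarrow> (real^2 \<Rightarrow> real) \<Rightarrow> ennreal" where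
  "DI \<alpha> p k u =
     (\<Sum>w\<in>{w. length w = k - 1}. \<Sum>i\<in>UNIV.
        \<integral>\<^sup>+t. ennreal ((weak_deriv (u \<circ> xi \<alpha> p w i) t)\<^sup>2) \<partial>leb01)"

text \<open>
  The series over \<open>k \<ge> 1\<close> is indexed from 0. If it converges, the limit below exists in
  \<open>[0,\<infinity>]\<close> since the \<open>m\<close>-th partial energies are nondecreasing in \<open>m\<close>; if it
  diverges, the sum is \<open>\<infinity>\<close> whatever the value of the first summand.
\<close>

definition energy ::
  "real \<Rightarrow> (3 \<Rightarrow> real^2) \<Rightarrow> (nat \<Rightarrow> real) \<Rightarrow> (nat \<Rightarrow> real) \<Rightarrow> (real^2 \<Rightarrow> real) \<Rightarrow> ennreal" where
  "energy \<alpha> p r \<rho> u =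
     lim (\<lambda>m. ennreal (1 / delta r m * Q \<alpha> p m u)) +
     (\<Sum>k. ennreal (1 / gam r \<rho> (Suc k)) * DI \<alpha> p (Suc k) u)"

definition dom_energy ::
  "real \<Rightarrow> (3 \<Rightarrow> real^2) \<Rightarrow> (real^2) set \<Rightarrow> (nat \<Rightarrow> real) \<Rightarrow> (nat \<Rightarrow> real) \<Rightarrow> (real^2 \<Rightarrow> real) set" where
  "dom_energy \<alpha> p K r \<rho> =
     {u. continuous_on K u \<and> (\<forall>w i. in_H1 (u \<circ> xi \<alpha> p w i)) \<and> energy \<alpha> p r \<rho> u < \<infinity>}"

definition dom_energy0 ::
  "real \<Rightarrow> (3 \<Rightarrow> real^2) \<Rightarrow> (real^2) set \<Rightarrow> (nat \<Rightarrow> real) \<Rightarrow> (nat \<Rightarrow> real) \<Rightarrow> (real^2 \<Rightarrow> real) set" where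
  "dom_energy0 \<alpha> p K r \<rho> = {u \<in> dom_energy \<alpha> p K r \<rho>. \<forall>x\<in>range p. u x = 0}"

text \<open>The bilinear form on the domain, by polarization.\<close>

definition energy_form ::
  "real \<Rightarrow> (3 \<Rightarrow> real^2) \<Rightarrow> (nat \<Rightarrow> real) \<Rightarrow> (nat \<Rightarrow> real) \<Rightarrow>
   (real^2 \<Rightarrow> real) \<Rightarrow> (real^2 \<Rightarrow> real) \<Rightarrow> real" where
  "energy_form \<alpha> p r \<rho> u v =
     (enn2real (energy \<alpha> p r \<rho> (\<lambda>x. u x + v x)) - enn2real (energy \<alpha> p r \<rho> (\<lambda>x. u x - v x))) / 4"


section \<open>The measures\<close>

definition borel_prob_on :: "(real^2) set \<Rightarrow> (real^2) measure \<Rightarrow> bool" where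
  "borel_prob_on K \<mu> \<longleftrightarrow> sets \<mu> = sets (restrict_space borel K) \<and> emeasure \<mu> K = 1"

definition is_mu_f ::
  "real \<Rightarrow> (3 \<Rightarrow> real^2) \<Rightarrow> (real^2) set \<Rightarrow> (real^2) measure \<Rightarrow> bool" where
  "is_mu_f \<alpha> p K \<mu> \<longleftrightarrow>
     borel_prob_on K \<mu> \<and> (\<forall>w. emeasure \<mu> (Gw \<alpha> p w ` K) = ennreal ((1 / 3) ^ length w))"

text \<open>One-dimensional Lebesgue measure (length) of the part of \<open>B\<close> on the edge
  \<open>edgew \<alpha> p w i\<close>.\<close>

definition edge_length ::
  "real \<Rightarrow> (3 \<Rightarrow> real^2) \<Rightarrow> 3 list \<Rightarrow> 3 \<Rightarrow> (real^2) set \<Rightarrow> real" where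
  "edge_length \<alpha> p w i B =
     dist (xi \<alpha> p w i 0) (xi \<alpha> p w i 1) * measure lborel {t\<in>{0<..<1}. xi \<alpha> p w i t \<in> B}"

definition is_mu_l ::
  "real \<Rightarrow> (3 \<Rightarrow> real^2) \<Rightarrow> (real^2) set \<Rightarrow> real \<Rightarrow> (real^2) measure \<Rightarrow> bool" where
  "is_mu_l \<alpha> p K \<beta> \<mu> \<longleftrightarrow>
     borel_prob_on K \<mu> \<and>
     emeasure \<mu> (\<Union>w i. edgew \<alpha> p w i) = 1 \<and>
     (\<forall>w i. \<forall>B\<in>sets borel. B \<subseteq> edgew \<alpha> p w i \<longrightarrow>
        emeasure \<mu> B =
          ennreal ((1 / 3 - \<beta>) * \<beta> ^ length w *
            (edge_length \<alpha> p w i B / edge_length \<alpha> p w i (edgew \<alpha> p w i))))"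

definition mu_eta ::
  "(real^2) set \<Rightarrow> real \<Rightarrow> (real^2) measure \<Rightarrow> (real^2) measure \<Rightarrow> (real^2) measure" where
  "mu_eta K \<eta> \<mu>l \<mu>f =
     measure_of K (sets (restrict_space borel K))
       (\<lambda>B. ennreal \<eta> * emeasure \<mu>l B + ennreal (1 - \<eta>) * emeasure \<mu>f B)"


section \<open>The Dirichlet operator and its eigenfunctions\<close>

definition interior_measure ::
  "(3 \<Rightarrow> real^2) \<Rightarrow> (real^2) set \<Rightarrow> (real^2) measure \<Rightarrow> (real^2) measure" where
  "interior_measure p K \<mu> = restrict_space \<mu> (K - range p)"

text \<open>
  The graph of the nonnegative self-adjoint operator associated with the form on
  \<open>dom_energy0\<close> and \<open>L\<^sup>2(K - V\<^sub>0, \<mu>)\<close>: \<open>neg_laplacian \<alpha> p K r \<rho> \<mu> u f\<close> says that \<open>u\<close>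
  is in its domain and is mapped to \<open>f\<close>. As the operator domain is contained in the form domain,
  each of its \<open>L\<^sup>2\<close> classes is represented by its element of \<open>dom_energy0\<close>, a continuous
  function on \<open>K\<close>.
\<close>

definition neg_laplacian ::
  "real \<Rightarrow> (3 \<Rightarrow> real^2) \<Rightarrow> (real^2) set \<Rightarrow> (nat \<Rightarrow> real) \<Rightarrow> (nat \<Rightarrow> real) \<Rightarrow> (real^2) measure \<Rightarrow>
   (real^2 \<Rightarrow> real) \<Rightarrow> (real^2 \<Rightarrow> real) \<Rightarrow> bool" where
  "neg_laplacian \<alpha> p K r \<rho> \<mu> u f \<longleftrightarrow>
     u \<in> dom_energy0 \<alpha> p K r \<rho> \<and> in_L2 (interior_measure p K \<mu>) f \<and>
     (\<forall>v\<in>dom_energy0 \<alpha> p K r \<rho>.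
        energy_form \<alpha> p r \<rho> u v = (\<integral>x. f x * v x \<partial>interior_measure p K \<mu>))"

definition eigenspace ::
  "real \<Rightarrow> (3 \<Rightarrow> real^2) \<Rightarrow> (real^2) set \<Rightarrow> (nat \<Rightarrow> real) \<Rightarrow> (nat \<Rightarrow> real) \<Rightarrow> (real^2) measure \<Rightarrow>
   real \<Rightarrow> (real^2 \<Rightarrow> real) set" where
  "eigenspace \<alpha> p K r \<rho> \<mu> ev = {u. neg_laplacian \<alpha> p K r \<rho> \<mu> u (\<lambda>x. ev * u x)}"

definition is_eigenfunction ::
  "real \<Rightarrow> (3 \<Rightarrow> real^2) \<Rightarrow> (real^2) set \<Rightarrow> (nat \<Rightarrow> real) \<Rightarrow> (nat \<Rightarrow> real) \<Rightarrow> (real^2) measure \<Rightarrow>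
   real \<Rightarrow> (real^2 \<Rightarrow> real) \<Rightarrow> bool" where
  "is_eigenfunction \<alpha> p K r \<rho> \<mu> ev u \<longleftrightarrow>
     u \<in> eigenspace \<alpha> p K r \<rho> \<mu> ev \<and> \<not> (AE x in interior_measure p K \<mu>. u x = 0)"

definition L2_independent :: "'a measure \<Rightarrow> ('a \<Rightarrow> real) set \<Rightarrow> bool" where
  "L2_independent M B \<longleftrightarrow>
     (\<forall>c. (AE x in M. (\<Sum>b\<in>B. c b * b x) = 0) \<longrightarrow> (\<forall>b\<in>B. c b = 0))"

text \<open>The dimension of the eigenspace as a subspace of \<open>L\<^sup>2\<close>, possibly \<open>\<infinity>\<close>.\<close>

definition eigen_multiplicity ::
  "real \<Rightarrow> (3 \<Rightarrow> real^2) \<Rightarrow> (real^2) set \<Rightarrow> (nat \<Rightarrow> real) \<Rightarrow> (nat \<Rightarrow> real) \<Rightarrow> (real^2) measure \<Rightarrow>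
   real \<Rightarrow> enat" where
  "eigen_multiplicity \<alpha> p K r \<rho> \<mu> ev =
     (SUP B\<in>{B. finite B \<and> B \<subseteq> eigenspace \<alpha> p K r \<rho> \<mu> ev \<and>
                L2_independent (interior_measure p K \<mu>) B}. enat (card B))"

definition supp_on :: "(real^2) set \<Rightarrow> (real^2 \<Rightarrow> real) \<Rightarrow> (real^2) set" where
  "supp_on K u = closure {x\<in>K. u x \<noteq> 0}"

end

theory Submission
  imports Defs "HOL-Complex_Analysis.Great_Picard" "HOL-Combinatorics.Permutations"
    "HOL-Real_Asymp.Real_Asymp"
begin

text \<open>
  A function \<open>u\<close> on \<open>K\<close> which changes sign under every reflection of the triangle vanishes at the
  vertices, and its normal derivatives there vanish as well, again by symmetry. Hence a minimizer \<open>u\<close> of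
  the Rayleigh quotient among the antisymmetric functions satisfies the weak eigenvalue equation against
  all functions of finite energy, without boundary conditions, and \<open>u \<circ> G\<^sub>w\<^sup>-\<^sup>1\<close>, extended by zero,
  is an eigenfunction on \<open>K\<close> supported in \<open>K\<^sub>w\<close>. The form and the measure rescale under \<open>G\<^sub>w\<close> by
  factors that depend only on \<open>|w| = n\<close> (the form becomes the one of the shifted matching pairs, the measure
  becomes \<open>\<eta> \<beta>\<^sup>n \<mu>\<^sub>l + (1 - \<eta>) 3\<^sup>-\<^sup>n \<mu>\<^sub>f\<close>), so all \<open>3\<^sup>n\<close> words of this length give the same
  eigenvalue. The minimizer exists because functions of bounded energy are equicontinuous and the energy,
  an increasing limit of quadratic forms in finitely many point values, is lower semicontinuous under
  pointwise convergence.
\<close>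

text \<open>The energy is given through weak derivatives, a limit and a series, none of which
  behaves well under pointwise limits. It is therefore rewritten as the supremum of
  finite-dimensional forms \<open>BN\<close>, increasing both in the level and in the fineness of a
  dyadic grid on the edges; this is why the one-dimensional analysis uses dyadic difference
  quotients. Growth in the level is where \<open>5 / 3 * r + \<rho> = 1\<close> enters: it says that
  refining a triangle into the network of the next level keeps its trace on the outer vertices. The
  same condition bounds \<open>r\<close> by 16/25, so the root of an energy bound shrinks by 4/5
  from a cell to its subcells; iterating this gives oscillation bounds and equicontinuity with
  constants valid for every sequence of pairs, as required when descending into a cell shifts the
  sequence. Minimizing needs a competitor of positive norm: \<open>u0\<close> is a Vandermonde
  product of barycentric coordinates, cut off on the three cells, so it lives on the connecting
  edges, and these are charged because \<eta> > 0. Symmetry and scaling of the measures are read off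
  from Riemann sums over cells and from integrals along edges.\<close>

lemma in_L2_mult:
  assumes "in_L2 M f" "in_L2 M g"
  shows "integrable M (\<lambda>x. f x * g x)"
proof (rule Bochner_Integration.integrable_bound)
  show "integrable M (\<lambda>x. (f x)\<^sup>2 + (g x)\<^sup>2)"
    using assms by (auto simp: in_L2_def)
  show "(\<lambda>x. f x * g x) \<in> borel_measurable M"
    using assms by (auto simp: in_L2_def)
  have "\<bar>a * b\<bar> \<le> a\<^sup>2 + b\<^sup>2" for a b :: real
  proof -
    have "0 \<le> (\<bar>a\<bar> - \<bar>b\<bar>)\<^sup>2 + \<bar>a * b\<bar>" by simp
    moreover have "0 \<le> a\<^sup>2 + b\<^sup>2" by simp
    ultimately show ?thesis by (simp add: power2_diff abs_mult)
  qed
  then show "AE x in M. norm (f x * g x) \<le> norm ((f x)\<^sup>2 + (g x)\<^sup>2)" by simp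
qed

lemma in_L2_add:
  assumes "in_L2 M f" "in_L2 M g"
  shows "in_L2 M (\<lambda>x. f x + g x)"
  using in_L2_mult[OF assms] assms unfolding in_L2_def power2_sum
  by (auto intro!: Bochner_Integration.integrable_add simp: mult.assoc)

lemma in_L2_cmult:
  assumes "in_L2 M f"
  shows "in_L2 M (\<lambda>x. c * f x)"
  using assms unfolding in_L2_def by (auto simp: power_mult_distrib)

lemma in_L2_diff:
  assumes "in_L2 M f" "in_L2 M g"
  shows "in_L2 M (\<lambda>x. f x - g x)"
  using in_L2_add[OF assms(1) in_L2_cmult[OF assms(2), of "-1"]] by simp

lemma in_L2_bounded:
  assumes "finite_measure M" "f \<in> borel_measurable M" "\<And>x. x \<in> space M \<Longrightarrow> \<bar>f x\<bar> \<le> C"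
  shows "in_L2 M f"
proof -
  interpret finite_measure M by fact
  have "norm ((f x)\<^sup>2) \<le> C\<^sup>2" if "x \<in> space M" for x
    using power_mono[OF assms(3)[OF that], of 2] by simp
  then show ?thesis
    unfolding in_L2_def using assms(2)
    by (auto intro!: integrable_const_bound[of _ "C\<^sup>2"] AE_I2)
qed

lemma in_L2_integrable:
  assumes "finite_measure M" "in_L2 M f"
  shows "integrable M f"
  using in_L2_mult[OF assms(2) in_L2_bounded[OF assms(1), of "\<lambda>_. 1" 1]] by simp

text \<open>The integral of the square of \<open>s * f x - t * g x\<close> is a nonnegative
  quadratic form in \<open>s\<close> and \<open>t\<close>; suitable pairs give the bound, with
  \<open>A = 0\<close> treated separately.\<close>

lemma Cauchy_Schwarz_integral:
  assumes "in_L2 M f" "in_L2 M g"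
  shows "(\<integral>x. f x * g x \<partial>M)\<^sup>2 \<le> (\<integral>x. (f x)\<^sup>2 \<partial>M) * (\<integral>x. (g x)\<^sup>2 \<partial>M)"
proof -
  define A B C where "A = (\<integral>x. (f x)\<^sup>2 \<partial>M)" and "B = (\<integral>x. f x * g x \<partial>M)"
    and "C = (\<integral>x. (g x)\<^sup>2 \<partial>M)"
  have int: "integrable M (\<lambda>x. (f x)\<^sup>2)" "integrable M (\<lambda>x. (g x)\<^sup>2)" "integrable M (\<lambda>x. f x * g x)"
    using assms in_L2_mult by (auto simp: in_L2_def)
  have *: "0 \<le> s\<^sup>2 * A - 2 * s * t * B + t\<^sup>2 * C" for s t :: real
  proof -
    have "0 \<le> (\<integral>x. (s * f x - t * g x)\<^sup>2 \<partial>M)" by simp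
    also have "(\<lambda>x. (s * f x - t * g x)\<^sup>2) = (\<lambda>x. s\<^sup>2 * (f x)\<^sup>2 - 2 * s * t * (f x * g x) + t\<^sup>2 * (g x)\<^sup>2)"
      by (auto simp: power2_eq_square algebra_simps)
    also have "(\<integral>x. s\<^sup>2 * (f x)\<^sup>2 - 2 * s * t * (f x * g x) + t\<^sup>2 * (g x)\<^sup>2 \<partial>M)
        = s\<^sup>2 * A - 2 * s * t * B + t\<^sup>2 * C"
      using int by (simp add: A_def B_def C_def)
    finally show ?thesis .
  qed
  have A0: "0 \<le> A" "0 \<le> C" by (auto simp: A_def C_def)
  show "B\<^sup>2 \<le> A * C"
  proof (cases "A = 0")
    case True
    have "B = 0"
    proof (rule ccontr)
      assume "B \<noteq> 0"
      \<comment> \<open>With \<open>A = 0\<close> and \<open>t = 1\<close> this turns the cross term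
        into \<open>- (C + 1)\<close>, which outweighs the remaining \<open>C\<close>.\<close>
      define s where "s = (C + 1) / (2 * B)"
      have "2 * s * 1 * B = C + 1" using \<open>B \<noteq> 0\<close> by (simp add: s_def)
      then have "0 \<le> s\<^sup>2 * A - (C + 1) + 1\<^sup>2 * C" using *[of s 1] by argo
      then show False using True by simp
    qed
    then show ?thesis using True by simp
  next
    case False
    \<comment> \<open>The pair \<open>s = B\<close>, \<open>t = A\<close> lets the form factor
      through \<open>A\<close>.\<close>
    have "0 \<le> A * (A * C - B\<^sup>2)"
      using *[of B A] by (simp add: power2_eq_square algebra_simps)
    then show ?thesis using False A0 by (simp add: zero_le_mult_iff)
  qed
qed

text \<open>Riesz-Fischer: along a subsequence with squared distances below \<open>(1/4)^i\<close>
  the increments are summable in the mean, so it converges almost everywhere, and Fatou's lemma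
  carries the Cauchy estimate over to the limit \<open>h\<close>.\<close>

lemma L2_complete:
  assumes fin: "finite_measure M" and g: "\<And>n::nat. in_L2 M (g n)"
    and Cauchy: "\<And>e. 0 < e \<Longrightarrow> \<exists>N. \<forall>m\<ge>N. \<forall>n\<ge>N. (\<integral>x. (g m x - g n x)\<^sup>2 \<partial>M) < e"
  obtains h where "in_L2 M h" "(\<lambda>n. \<integral>x. (g n x - h x)\<^sup>2 \<partial>M) \<longlonglongrightarrow> 0"
proof -
  interpret finite_measure M by fact
  have [measurable]: "g n \<in> borel_measurable M" for n using g by (auto simp: in_L2_def)
  have "\<exists>N. \<forall>m\<ge>N. \<forall>n\<ge>N. (\<integral>x. (g m x - g n x)\<^sup>2 \<partial>M) < (1/4)^i" for i :: nat
    by (rule Cauchy) simp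
  then obtain N where N: "\<And>i m n. m \<ge> N i \<Longrightarrow> n \<ge> N i \<Longrightarrow> (\<integral>x. (g m x - g n x)\<^sup>2 \<partial>M) < (1/4)^i"
    by metis
  \<comment> \<open>The recursion forces both \<open>k i \<ge> N i\<close> and strict growth, so
    consecutive terms satisfy the estimate of index \<open>i\<close>.\<close>
  define k where "k = rec_nat (N 0) (\<lambda>i k. max (N (Suc i)) (Suc k))"
  have k0: "k 0 = N 0" and kS: "k (Suc i) = max (N (Suc i)) (Suc (k i))" for i
    by (simp_all add: k_def)
  have smk: "strict_mono k" by (auto simp: strict_mono_Suc_iff kS less_max_iff_disj)
  have kN: "k i \<ge> N i" for i by (cases i) (auto simp: k0 kS)
  define d where "d i x = \<bar>g (k (Suc i)) x - g (k i) x\<bar>" for i x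
  have [measurable]: "d i \<in> borel_measurable M" for i unfolding d_def by measurable
  have L2d: "in_L2 M (\<lambda>x. g m x - g n x)" for m n by (rule in_L2_diff[OF g g])
  have intd: "integrable M (d i)" for i
    unfolding d_def using in_L2_integrable[OF fin L2d] by auto
  define C where "C = (1 + measure M (space M)) / 2"
  have dle: "(\<integral>x. d i x \<partial>M) \<le> C * (1/2)^i" for i
  proof -
    \<comment> \<open>Weighted arithmetic-geometric mean inequality; the weight \<open>2^i\<close>
      leaves a term of order \<open>(1/2)^i\<close> from either summand.\<close>
    have "d i x \<le> (2^i * (g (k (Suc i)) x - g (k i) x)\<^sup>2 + (1/2)^i) / 2" for x
    proof -
      have "0 \<le> 2^i * (d i x - (1/2)^i)\<^sup>2" by simp
      also have "\<dots> = 2^i * (d i x)\<^sup>2 + (1/2)^i - 2 * d i x"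
        by (simp add: power2_eq_square algebra_simps flip: power_mult_distrib)
      finally show ?thesis by (simp add: d_def)
    qed
    then have "(\<integral>x. d i x \<partial>M) \<le> (\<integral>x. (2^i * (g (k (Suc i)) x - g (k i) x)\<^sup>2 + (1/2)^i) / 2 \<partial>M)"
      using L2d by (intro integral_mono intd) (auto simp: in_L2_def)
    also have "\<dots> = (2^i * (\<integral>x. (g (k (Suc i)) x - g (k i) x)\<^sup>2 \<partial>M) + (1/2)^i * measure M (space M)) / 2"
      using L2d[of "k (Suc i)" "k i"] by (simp add: in_L2_def)
    also have "\<dots> \<le> (2^i * (1/4)^i + (1/2)^i * measure M (space M)) / 2"
      using N[of i "k (Suc i)" "k i"] kN smk
      by (auto intro!: divide_right_mono mult_left_mono less_imp_le order_trans[OF kN] simp: kS le_max_iff_disj)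
    also have "\<dots> = C * (1/2)^i"
      by (simp add: C_def algebra_simps flip: power_mult_distrib)
    finally show ?thesis .
  qed
  have "(\<integral>\<^sup>+x. (\<Sum>i. ennreal (d i x)) \<partial>M) = (\<Sum>i. \<integral>\<^sup>+x. ennreal (d i x) \<partial>M)"
    by (rule nn_integral_suminf) auto
  also have "\<dots> = (\<Sum>i. ennreal (\<integral>x. d i x \<partial>M))"
    by (intro suminf_cong nn_integral_eq_integral intd) (auto simp: d_def)
  also have "\<dots> \<le> (\<Sum>i. ennreal (C * (1/2)^i))"
    by (intro suminf_le ennreal_leI dle) auto
  also have "\<dots> = ennreal (\<Sum>i. C * (1/2)^i)"
    by (intro suminf_ennreal2) (auto simp: C_def intro!: summable_mult)
  finally have "(\<integral>\<^sup>+x. (\<Sum>i. ennreal (d i x)) \<partial>M) \<noteq> \<infinity>" by (auto simp: top_unique)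
  then have "AE x in M. (\<Sum>i. ennreal (d i x)) \<noteq> \<infinity>"
    by (intro nn_integral_PInf_AE) auto
  moreover have "convergent (\<lambda>i. g (k i) x)" if "(\<Sum>i. ennreal (d i x)) \<noteq> \<infinity>" for x
  proof -
    have "summable (\<lambda>i. d i x)"
      using that by (intro summable_suminf_not_top) (auto simp: d_def)
    then have "summable (\<lambda>i. g (k (Suc i)) x - g (k i) x)"
      unfolding d_def by (rule summable_rabs_cancel)
    then have "convergent (\<lambda>n. \<Sum>i<n. g (k (Suc i)) x - g (k i) x)"
      by (simp add: summable_iff_convergent)
    then have "convergent (\<lambda>n. g (k n) x - g (k 0) x)"
      by (simp add: sum_lessThan_telescope[of "\<lambda>n. g (k n) x"])
    then have "convergent (\<lambda>n. (g (k n) x - g (k 0) x) + g (k 0) x)"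
      by (intro convergent_add convergent_const)
    then show ?thesis by simp
  qed
  ultimately have conv: "AE x in M. convergent (\<lambda>i. g (k i) x)" by auto
  define h where "h x = lim (\<lambda>i. g (k i) x)" for x
  have [measurable]: "h \<in> borel_measurable M" unfolding h_def by measurable
  have lim: "AE x in M. (\<lambda>i. g (k i) x) \<longlonglongrightarrow> h x"
    using conv by (auto simp: h_def convergent_LIMSEQ_iff)
  have main: "(\<integral>\<^sup>+x. ennreal ((g n x - h x)\<^sup>2) \<partial>M) \<le> ennreal e"
    if "\<And>m. m \<ge> n0 \<Longrightarrow> (\<integral>x. (g n x - g m x)\<^sup>2 \<partial>M) < e" "e > 0" for n n0 e
  proof -
    have "(\<integral>\<^sup>+x. ennreal ((g n x - h x)\<^sup>2) \<partial>M)
        \<le> (\<integral>\<^sup>+x. liminf (\<lambda>i. ennreal ((g n x - g (k i) x)\<^sup>2)) \<partial>M)"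
    proof (rule nn_integral_mono_AE)
      show "AE x in M. ennreal ((g n x - h x)\<^sup>2) \<le> liminf (\<lambda>i. ennreal ((g n x - g (k i) x)\<^sup>2))"
        using lim
      proof eventually_elim
        case (elim x)
        then have "(\<lambda>i. ennreal ((g n x - g (k i) x)\<^sup>2)) \<longlonglongrightarrow> ennreal ((g n x - h x)\<^sup>2)"
          by (intro tendsto_ennrealI tendsto_intros)
        then show ?case using lim_imp_Liminf[OF trivial_limit_sequentially] by fastforce
      qed
    qed
    also have "\<dots> \<le> liminf (\<lambda>i. \<integral>\<^sup>+x. ennreal ((g n x - g (k i) x)\<^sup>2) \<partial>M)"
      by (rule nn_integral_liminf) auto
    also have "\<dots> \<le> ennreal e"
    proof (rule Liminf_le)
      have "eventually (\<lambda>i. k i \<ge> n0) sequentially"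
        using filterlim_subseq[OF smk] by (simp add: filterlim_at_top)
      then show "\<forall>\<^sub>F i in sequentially. (\<integral>\<^sup>+x. ennreal ((g n x - g (k i) x)\<^sup>2) \<partial>M) \<le> ennreal e"
      proof eventually_elim
        case (elim i)
        have "(\<integral>\<^sup>+x. ennreal ((g n x - g (k i) x)\<^sup>2) \<partial>M) = ennreal (\<integral>x. (g n x - g (k i) x)\<^sup>2 \<partial>M)"
          using L2d by (intro nn_integral_eq_integral) (auto simp: in_L2_def)
        then show ?case using that(1)[OF elim] by (auto intro!: ennreal_leI)
      qed
    qed simp
    finally show ?thesis .
  qed
  have Cn: "\<exists>n0. \<forall>n\<ge>n0. (\<integral>\<^sup>+x. ennreal ((g n x - h x)\<^sup>2) \<partial>M) \<le> ennreal e" if "e > 0" for e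
    using Cauchy[OF that] main that by meson
  have L2: "in_L2 M h"
  proof -
    obtain n where "(\<integral>\<^sup>+x. ennreal ((g n x - h x)\<^sup>2) \<partial>M) \<le> ennreal 1" using Cn[of 1] by auto
    then have "in_L2 M (\<lambda>x. g n x - h x)"
      unfolding in_L2_def
      by (auto simp: integrable_iff_bounded intro: le_less_trans)
    from in_L2_diff[OF g[of n] this] show ?thesis by simp
  qed
  have "(\<lambda>n. \<integral>x. (g n x - h x)\<^sup>2 \<partial>M) \<longlonglongrightarrow> 0"
  proof (rule LIMSEQ_I)
    fix e :: real assume e: "0 < e"
    obtain n0 where n0: "\<forall>n\<ge>n0. (\<integral>\<^sup>+x. ennreal ((g n x - h x)\<^sup>2) \<partial>M) \<le> ennreal (e/2)"
      using Cn[of "e/2"] e by auto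
    have "norm ((\<integral>x. (g n x - h x)\<^sup>2 \<partial>M) - 0) < e" if "n \<ge> n0" for n
    proof -
      have "(\<integral>\<^sup>+x. ennreal ((g n x - h x)\<^sup>2) \<partial>M) = ennreal (\<integral>x. (g n x - h x)\<^sup>2 \<partial>M)"
        using in_L2_diff[OF g[of n] L2] by (intro nn_integral_eq_integral) (auto simp: in_L2_def)
      then have "(\<integral>x. (g n x - h x)\<^sup>2 \<partial>M) \<le> e/2" using n0 that e by auto
      then show ?thesis using e by simp
    qed
    then show "\<exists>n0. \<forall>n\<ge>n0. norm ((\<integral>x. (g n x - h x)\<^sup>2 \<partial>M) - 0) < e" by blast
  qed
  with L2 show thesis by (rule that)
qed

subsection \<open>Dyadic difference quotients and the space H1\<close>

lemma space_leb01 [simp]: "space leb01 = {0<..<1}"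
  by (simp add: leb01_def space_restrict_space)

interpretation leb01: finite_measure leb01
  by (rule finite_measureI) (simp add: leb01_def emeasure_restrict_space space_restrict_space)

lemma borel_measurable_leb01 [measurable (raw)]:
  "f \<in> borel_measurable borel \<Longrightarrow> f \<in> borel_measurable leb01"
  unfolding leb01_def by (auto intro: measurable_restrict_space1)

lemma borel_measurable_leb01_continuous:
  fixes f :: "real \<Rightarrow> real"
  assumes "continuous_on {0<..<1} f"
  shows "f \<in> borel_measurable leb01"
proof -
  have "f \<in> borel_measurable (restrict_space borel {0<..<1})"
    by (rule borel_measurable_continuous_on_restrict[OF assms])
  moreover have "sets leb01 = sets (restrict_space borel {0<..<1})"
    unfolding leb01_def by (rule sets_restrict_space_cong) simp
  ultimately show ?thesis
    using measurable_cong_sets by blast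
qed

lemma integral_leb01:
  fixes f :: "real \<Rightarrow> real"
  shows "(\<integral>t. f t \<partial>leb01) = (\<integral>t. indicator {0<..<1} t * f t \<partial>lborel)"
  unfolding leb01_def by (subst integral_restrict_space) auto

lemma integral_leb01_FTC:
  fixes F :: "real \<Rightarrow> real"
  assumes "\<And>t. (F has_real_derivative F' t) (at t)" "continuous_on UNIV F'"
  shows "(\<integral>t. F' t \<partial>leb01) = F 1 - F 0"
proof -
  have c: "continuous_on {0..1} F'" using assms(2) continuous_on_subset by blast
  have F'[measurable]: "F' \<in> borel_measurable borel"
    using assms(2) borel_measurable_continuous_onI by blast
  have "(\<integral>t. F' t \<partial>leb01) = (\<integral>t. F' t * indicator {0..1} t \<partial>lborel)"
    unfolding integral_leb01
    by (rule integral_cong_AE)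
      (use AE_lborel_singleton[of 0] AE_lborel_singleton[of 1] in
        \<open>auto split: split_indicator elim!: eventually_elim2\<close>)
  also have "\<dots> = F 1 - F 0"
    by (rule integral_FTC_Icc_real)
      (use assms in \<open>simp_all add: continuous_on_eq_continuous_at\<close>)
  finally show ?thesis .
qed

definition dinc :: "nat \<Rightarrow> (real \<Rightarrow> real) \<Rightarrow> nat \<Rightarrow> real" where
  "dinc N f i = f (real (Suc i) / 2 ^ N) - f (real i / 2 ^ N)"

text \<open>Dirichlet form of the piecewise linear interpolants of \<open>f\<close> and
  \<open>g\<close> on the dyadic grid: products of increments divided by the cell length
  \<open>1 / 2 ^ N\<close>.\<close>

definition SB :: "nat \<Rightarrow> (real \<Rightarrow> real) \<Rightarrow> (real \<Rightarrow> real) \<Rightarrow> real" where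
  "SB N f g = (\<Sum>i<2 ^ N. 2 ^ N * (dinc N f i * dinc N g i))"

definition ix :: "nat \<Rightarrow> real \<Rightarrow> nat" where
  "ix N t = nat \<lfloor>2 ^ N * t\<rfloor>"

lemma ix_bounds:
  assumes "0 < t" "t < 1"
  shows "real (ix N t) / 2 ^ N \<le> t" "t < real (Suc (ix N t)) / 2 ^ N" "ix N t < 2 ^ N"
proof -
  have "0 \<le> \<lfloor>2 ^ N * t\<rfloor>" using assms by simp
  then have *: "real (ix N t) = of_int \<lfloor>2 ^ N * t\<rfloor>" by (simp add: ix_def)
  show 1: "real (ix N t) / 2 ^ N \<le> t"
    unfolding * using of_int_floor_le[of "2 ^ N * t"] by (simp add: field_simps)
  show "t < real (Suc (ix N t)) / 2 ^ N"
    using floor_correct[of "2 ^ N * t"] * by (simp add: field_simps)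
  have "real (ix N t) / 2 ^ N < 1" using 1 assms by linarith
  then have "real (ix N t) < 2 ^ N" by simp
  then show "ix N t < 2 ^ N" by (metis of_nat_less_iff of_nat_numeral of_nat_power)
qed

text \<open>Refining the grid appends binary digits to the index; integer division by
  \<open>2 ^ k\<close> forgets them again.\<close>

lemma ix_div:
  assumes "0 < t"
  shows "ix N t = ix (N + k) t div 2 ^ k"
proof -
  have "\<lfloor>2 ^ N * t\<rfloor> = \<lfloor>(2 ^ (N + k) * t) / real_of_int (2 ^ k)\<rfloor>"
    by (simp add: power_add)
  also have "\<dots> = \<lfloor>2 ^ (N + k) * t\<rfloor> div 2 ^ k"
    by (rule floor_divide_real_eq_div) simp
  finally show ?thesis
    by (simp add: ix_def nat_div_distrib' nat_power_eq)
qed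

lemma ix_eq_iff:
  assumes "0 < t"
  shows "ix N t = i \<longleftrightarrow> real i / 2 ^ N \<le> t \<and> t < real (Suc i) / 2 ^ N"
proof -
  have "ix N t = i \<longleftrightarrow> \<lfloor>2 ^ N * t\<rfloor> = int i"
    using assms by (auto simp: ix_def nat_eq_iff2)
  also have "\<dots> \<longleftrightarrow> real i / 2 ^ N \<le> t \<and> t < real (Suc i) / 2 ^ N"
    by (auto simp: floor_eq_iff field_simps)
  finally show ?thesis .
qed

lemma has_integral_step:
  fixes F :: "nat \<Rightarrow> real"
  shows "(\<lambda>t. F (ix N t)) \<in> borel_measurable leb01"
    and "(\<integral>t. F (ix N t) \<partial>leb01) = (\<Sum>i<2 ^ N. F i) / 2 ^ N"
proof -
  define S where "S i = {real i / 2 ^ N..<real (Suc i) / 2 ^ N}" for i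
  have [measurable]: "S i \<in> sets borel" for i by (simp add: S_def)
  have eq: "F (ix N t) = (\<Sum>i<2 ^ N. F i * indicator (S i) t)" if "t \<in> space leb01" for t
  proof -
    have t: "0 < t" "t < 1" using that by auto
    have "(\<Sum>i<2 ^ N. F i * indicator (S i) t) = (\<Sum>i<2 ^ N. if i = ix N t then F i else 0)"
    proof (intro sum.cong refl)
      fix i
      have "i = ix N t \<longleftrightarrow> t \<in> S i" using ix_eq_iff[OF t(1), of N i] by (auto simp: S_def)
      then show "F i * indicator (S i) t = (if i = ix N t then F i else 0)" by simp
    qed
    also have "\<dots> = F (ix N t)" using ix_bounds(3)[OF t] by simp
    finally show ?thesis by simp
  qed
  have m: "(\<lambda>t. \<Sum>i<2 ^ N. F i * indicator (S i) t) \<in> borel_measurable leb01"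
    by measurable
  show "(\<lambda>t. F (ix N t)) \<in> borel_measurable leb01"
    using measurable_cong[of leb01 "\<lambda>t. F (ix N t)" "\<lambda>t. \<Sum>i<2 ^ N. F i * indicator (S i) t", OF eq] m
    by simp
  have meas: "(\<integral>t. indicator (S i) t \<partial>leb01) = (1 / 2 ^ N :: real)" if "i < 2 ^ N" for i
  proof -
    have "real (Suc i) \<le> 2 ^ N" using that
      by (metis Suc_leI of_nat_le_iff of_nat_numeral of_nat_power)
    then have le: "real (Suc i) / 2 ^ N \<le> 1" by (simp add: field_simps)
    have "(\<integral>t. indicator (S i) t \<partial>leb01) = (\<integral>t. (indicator (S i) t :: real) \<partial>lborel)"
      unfolding integral_leb01[of "indicator (S i)"]
    proof (rule integral_cong_AE)
      show "AE t in lborel. indicator {0<..<1} t * indicator (S i) t = (indicator (S i) t :: real)"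
        using AE_lborel_singleton[of 0]
      proof eventually_elim
        case (elim t)
        have "t > 0" "t < 1" if "t \<in> S i"
        proof -
          have "0 \<le> real i / 2 ^ N" "real i / 2 ^ N \<le> t" "t < real (Suc i) / 2 ^ N"
            using that by (auto simp: S_def)
          then show "t > 0" "t < 1" using elim le by linarith+
        qed
        then show ?case by (auto split: split_indicator)
      qed
    qed auto
    also have "\<dots> = real (Suc i) / 2 ^ N - real i / 2 ^ N"
      by (simp add: S_def divide_right_mono)
    also have "\<dots> = 1 / 2 ^ N" by (simp add: field_simps)
    finally show ?thesis .
  qed
  have "(\<integral>t. F (ix N t) \<partial>leb01) = (\<integral>t. (\<Sum>i<2 ^ N. F i * indicator (S i) t) \<partial>leb01)"
    by (rule Bochner_Integration.integral_cong[OF refl eq])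
  also have "\<dots> = (\<Sum>i<2 ^ N. F i * (\<integral>t. indicator (S i) t \<partial>leb01))"
  proof (subst Bochner_Integration.integral_sum)
    show "integrable leb01 (\<lambda>t. F i * indicator (S i) t)" for i
      by (rule leb01.integrable_const_bound[of _ "\<bar>F i\<bar>"]) (auto split: split_indicator)
  qed simp
  also have "\<dots> = (\<Sum>i<2 ^ N. F i) / 2 ^ N"
    using meas by (simp add: sum_divide_distrib)
  finally show "(\<integral>t. F (ix N t) \<partial>leb01) = (\<Sum>i<2 ^ N. F i) / 2 ^ N" .
qed

text \<open>Right-hand derivative of the dyadic piecewise linear interpolant of \<open>f\<close>, a
  step function.\<close>

definition dquot :: "nat \<Rightarrow> (real \<Rightarrow> real) \<Rightarrow> real \<Rightarrow> real" where
  "dquot N f t = 2 ^ N * dinc N f (ix N t)"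

lemma in_L2_step: "in_L2 leb01 (\<lambda>t. F (ix N t))"
proof (rule in_L2_bounded)
  show "finite_measure leb01" by unfold_locales
  show "(\<lambda>t. F (ix N t)) \<in> borel_measurable leb01" by (rule has_integral_step)
  fix t assume "t \<in> space leb01"
  then have "ix N t < 2 ^ N" using ix_bounds(3)[of t N] by auto
  then show "\<bar>F (ix N t)\<bar> \<le> (\<Sum>i<2 ^ N. \<bar>F i\<bar>)"
    by (intro member_le_sum) auto
qed

lemma in_L2_dquot: "in_L2 leb01 (dquot N f)"
  using in_L2_step[of "\<lambda>i. 2 ^ N * dinc N f i" N] by (simp add: dquot_def[abs_def])

lemma integral_dquot_sq: "(\<integral>t. (dquot N f t)\<^sup>2 \<partial>leb01) = SB N f f"
  unfolding dquot_def
  by (subst has_integral_step(2)[of "\<lambda>i. (2 ^ N * dinc N f i)\<^sup>2"])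
    (simp add: SB_def power2_eq_square sum_divide_distrib mult_ac)

lemma dinc_refine: "(\<Sum>j\<in>{i * 2 ^ k..<i * 2 ^ k + 2 ^ k}. dinc (N + k) f j) = dinc N f i"
proof -
  have "(\<Sum>j\<in>{i * 2 ^ k..<i * 2 ^ k + 2 ^ k}. dinc (N + k) f j)
     = f (real (i * 2 ^ k + 2 ^ k) / 2 ^ (N + k)) - f (real (i * 2 ^ k) / 2 ^ (N + k))"
    unfolding dinc_def by (rule sum_Suc_diff') simp
  also have "real (i * 2 ^ k + 2 ^ k) / 2 ^ (N + k) = real (Suc i) / 2 ^ N"
    by (simp add: power_add field_simps)
  also have "real (i * 2 ^ k) / 2 ^ (N + k) = real i / 2 ^ N"
    by (simp add: power_add)
  finally show ?thesis by (simp add: dinc_def)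
qed

text \<open>The fine increments inside a coarse cell add up to the coarse increment, so pairing with
  the coarse quotient, constant there, replaces the fine quotient by its mean.\<close>

lemma integral_dquot_mult: "(\<integral>t. dquot (N + k) f t * dquot N f t \<partial>leb01) = SB N f f"
proof -
  have "(\<integral>t. dquot (N + k) f t * dquot N f t \<partial>leb01) =
    (\<integral>t. (\<lambda>j. 2 ^ (N + k) * dinc (N + k) f j * (2 ^ N * dinc N f (j div 2 ^ k))) (ix (N + k) t) \<partial>leb01)"
    by (intro Bochner_Integration.integral_cong) (auto simp: dquot_def ix_div[of _ N k])
  also have "\<dots> = (\<Sum>j<2 ^ (N + k). 2 ^ (N + k) * dinc (N + k) f j * (2 ^ N * dinc N f (j div 2 ^ k))) / 2 ^ (N + k)"
    by (rule has_integral_step)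
  also have "\<dots> = (\<Sum>j<2 ^ N * 2 ^ k. 2 ^ N * dinc N f (j div 2 ^ k) * dinc (N + k) f j)"
    by (simp add: sum_divide_distrib power_add mult_ac)
  \<comment> \<open>Groups the fine indices by the coarse cell that contains them.\<close>
  also have "\<dots> = (\<Sum>i<2 ^ N. \<Sum>j\<in>{i * 2 ^ k..<i * 2 ^ k + 2 ^ k}. 2 ^ N * dinc N f (j div 2 ^ k) * dinc (N + k) f j)"
    by (rule sum.nat_group[symmetric])
  also have "\<dots> = (\<Sum>i<2 ^ N. \<Sum>j\<in>{i * 2 ^ k..<i * 2 ^ k + 2 ^ k}. 2 ^ N * dinc N f i * dinc (N + k) f j)"
  proof (intro sum.cong refl)
    fix i j :: nat assume "j \<in> {i * 2 ^ k..<i * 2 ^ k + 2 ^ k}"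
    then have "j div 2 ^ k = i" by (intro div_nat_eqI) (auto simp: algebra_simps)
    then show "2 ^ N * dinc N f (j div 2 ^ k) * dinc (N + k) f j = 2 ^ N * dinc N f i * dinc (N + k) f j"
      by simp
  qed
  also have "\<dots> = SB N f f"
    by (simp add: dinc_refine SB_def mult.assoc flip: sum_distrib_left)
  finally show ?thesis .
qed

text \<open>Pythagoras for this projection; it yields both monotonicity in the mesh and the Cauchy
  property of the quotients.\<close>

lemma integral_dquot_diff_sq:
  "(\<integral>t. (dquot (N + k) f t - dquot N f t)\<^sup>2 \<partial>leb01) = SB (N + k) f f - SB N f f"
proof -
  have "(\<integral>t. (dquot (N + k) f t - dquot N f t)\<^sup>2 \<partial>leb01)
    = (\<integral>t. (dquot (N + k) f t)\<^sup>2 + (dquot N f t)\<^sup>2 - 2 * (dquot (N + k) f t * dquot N f t) \<partial>leb01)"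
    by (simp add: power2_diff mult.assoc)
  also have "\<dots> = SB (N + k) f f + SB N f f - 2 * SB N f f"
    using in_L2_dquot[of "N + k" f] in_L2_dquot[of N f] in_L2_mult[OF in_L2_dquot in_L2_dquot]
    by (simp add: in_L2_def integral_dquot_sq integral_dquot_mult)
  finally show ?thesis by simp
qed

lemma SB_mono: "N \<le> M \<Longrightarrow> SB N f f \<le> SB M f f"
proof -
  assume "N \<le> M"
  then obtain k where "M = N + k" using le_Suc_ex by blast
  moreover have "0 \<le> (\<integral>t. (dquot (N + k) f t - dquot N f t)\<^sup>2 \<partial>leb01)" by simp
  ultimately show ?thesis by (simp add: integral_dquot_diff_sq)
qed

lemma SB_nonneg: "0 \<le> SB N f f"
  unfolding SB_def by (intro sum_nonneg) auto

lemma sum_by_parts: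
  fixes a b :: "nat \<Rightarrow> real"
  shows "(\<Sum>i<n. a i * (b (Suc i) - b i)) = a n * b n - a 0 * b 0 - (\<Sum>i<n. b (Suc i) * (a (Suc i) - a i))"
  by (induction n) (auto simp: algebra_simps)

lemma dinc_eq_deriv:
  assumes "\<And>t. (\<phi> has_real_derivative \<phi>' t) (at t)"
  shows "\<exists>z. real i / 2 ^ N < z \<and> z < real (Suc i) / 2 ^ N \<and> 2 ^ N * dinc N \<phi> i = \<phi>' z"
proof -
  have "real i / 2 ^ N < real (Suc i) / 2 ^ N" by (simp add: divide_strict_right_mono)
  from MVT2[OF this] assms obtain z where z: "real i / 2 ^ N < z" "z < real (Suc i) / 2 ^ N"
    "\<phi> (real (Suc i) / 2 ^ N) - \<phi> (real i / 2 ^ N) = (real (Suc i) / 2 ^ N - real i / 2 ^ N) * \<phi>' z"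
    by metis
  have "real (Suc i) / 2 ^ N - real i / 2 ^ N = 1 / 2 ^ N" by (simp add: field_simps)
  with z(3) have "2 ^ N * dinc N \<phi> i = \<phi>' z" by (simp add: dinc_def)
  with z show ?thesis by blast
qed

text \<open>Sample points may be chosen freely in the closed dyadic cell of \<open>t\<close>;
  endpoints and mean value points are both used below.\<close>

lemma dyadic_tendsto:
  assumes t: "0 < t" "t < 1"
    and z: "\<And>N. real (ix N t) / 2 ^ N \<le> z N" "\<And>N. z N \<le> real (Suc (ix N t)) / 2 ^ N"
  shows "z \<longlonglongrightarrow> t"
proof (rule tendsto_sandwich)
  have "(\<lambda>N. inverse ((2::real) ^ N)) \<longlonglongrightarrow> 0" by (rule LIMSEQ_inverse_realpow_zero) simp
  then have l: "(\<lambda>N. 1 / (2::real) ^ N) \<longlonglongrightarrow> 0" by (simp add: inverse_eq_divide)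
  show "(\<lambda>N. t - 1 / 2 ^ N) \<longlonglongrightarrow> t" "(\<lambda>N. t + 1 / 2 ^ N) \<longlonglongrightarrow> t"
    using tendsto_diff[OF tendsto_const[of t] l] tendsto_add[OF tendsto_const[of t] l] by simp_all
  have "real (Suc (ix N t)) / 2 ^ N = real (ix N t) / 2 ^ N + 1 / 2 ^ N" for N
    by (simp add: field_simps)
  then show "\<forall>\<^sub>F N in sequentially. t - 1 / 2 ^ N \<le> z N" "\<forall>\<^sub>F N in sequentially. z N \<le> t + 1 / 2 ^ N"
    using ix_bounds[OF t] z by (auto intro!: always_eventually) (smt (verit))+
qed

lemma dyadic_point_bounds:
  assumes "0 < t" "t < 1"
  shows "real (ix N t) / 2 ^ N \<in> {0..1}" "real (Suc (ix N t)) / 2 ^ N \<in> {0..1}"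
proof -
  have "Suc (ix N t) \<le> 2 ^ N" using ix_bounds(3)[OF assms, of N] by simp
  then have "real (Suc (ix N t)) \<le> 2 ^ N"
    by (metis of_nat_le_iff of_nat_numeral of_nat_power)
  then show "real (Suc (ix N t)) / 2 ^ N \<in> {0..1}" by (auto simp: field_simps)
  show "real (ix N t) / 2 ^ N \<in> {0..1}"
    using order_trans[OF ix_bounds(1)[OF assms, of N] less_imp_le[OF assms(2)]]
    by (auto simp del: divide_le_eq_1_pos)
qed

lemma continuous_bounded_01:
  fixes f :: "real \<Rightarrow> real"
  assumes "continuous_on {0..1} f"
  obtains C where "\<And>t. t \<in> {0..1} \<Longrightarrow> \<bar>f t\<bar> \<le> C"
proof -
  have "bounded (f ` {0..1})"
    using assms by (intro compact_imp_bounded compact_continuous_image) auto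
  then obtain C where "\<forall>x\<in>f ` {0..1}. norm x \<le> C" unfolding bounded_iff by blast
  then show thesis by (intro that[of C]) auto
qed

lemma test_function_boundary:
  assumes "test_function \<phi> \<phi>'"
  shows "\<phi> 0 = 0" "\<phi> 1 = 0"
  using assms by (auto simp: test_function_def)

text \<open>Abel summation with vanishing boundary terms. Taking the test function at left and
  \<open>f\<close> at right endpoints makes the discrete product rule exact.\<close>

lemma dyadic_parts:
  assumes "\<phi> 0 = 0" "\<phi> 1 = 0"
  shows "(\<integral>t. dquot N f t * \<phi> (real (ix N t) / 2 ^ N) \<partial>leb01)
     = - (\<integral>t. f (real (Suc (ix N t)) / 2 ^ N) * dquot N \<phi> t \<partial>leb01)"
proof -
  have "(\<integral>t. dquot N f t * \<phi> (real (ix N t) / 2 ^ N) \<partial>leb01)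
    = (\<Sum>i<2 ^ N. \<phi> (real i / 2 ^ N) * dinc N f i)"
    unfolding dquot_def
    by (subst has_integral_step(2)[of "\<lambda>i. 2 ^ N * dinc N f i * \<phi> (real i / 2 ^ N)"])
      (simp add: sum_divide_distrib mult_ac)
  moreover have "(\<integral>t. f (real (Suc (ix N t)) / 2 ^ N) * dquot N \<phi> t \<partial>leb01)
    = (\<Sum>i<2 ^ N. f (real (Suc i) / 2 ^ N) * dinc N \<phi> i)"
    unfolding dquot_def
    by (subst has_integral_step(2)[of "\<lambda>i. f (real (Suc i) / 2 ^ N) * (2 ^ N * dinc N \<phi> i)"])
      (simp add: sum_divide_distrib mult_ac)
  ultimately show ?thesis
    using sum_by_parts[of "\<lambda>i. \<phi> (real i / 2 ^ N)" "\<lambda>i. f (real i / 2 ^ N)" "2 ^ N"] assms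
    by (simp add: dinc_def)
qed

text \<open>The weak derivative is the \<open>L2\<close> limit of the dyadic difference quotients, which form a Cauchy
  sequence because coarse quotients are orthogonal projections of fine ones.\<close>

lemma weak_deriv_exists:
  assumes f: "continuous_on {0..1} f" and bnd: "\<And>N. SB N f f \<le> c"
  obtains g where "in_L2 leb01 g" "is_weak_deriv f g" "(\<integral>t. (g t)\<^sup>2 \<partial>leb01) \<le> c"
proof -
  have inc: "incseq (\<lambda>N. SB N f f)" by (auto simp: incseq_def intro: SB_mono)
  obtain L where L: "(\<lambda>N. SB N f f) \<longlonglongrightarrow> L" "\<And>N. SB N f f \<le> L"
    using incseq_convergent[OF inc, of c] bnd by blast
  have Cauchy: "\<exists>N. \<forall>m\<ge>N. \<forall>n\<ge>N. (\<integral>x. (dquot m f x - dquot n f x)\<^sup>2 \<partial>leb01) < e" if e: "0 < e" for e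
  proof -
    obtain N where N: "\<And>n. n \<ge> N \<Longrightarrow> \<bar>SB n f f - L\<bar> < e"
      using LIMSEQ_D[OF L(1) e] by auto
    have le: "(\<integral>x. (dquot m f x - dquot n f x)\<^sup>2 \<partial>leb01) < e" if "n \<ge> N" "m \<ge> n" for m n
    proof -
      obtain k where "m = n + k" using le_Suc_ex[OF \<open>m \<ge> n\<close>] by blast
      then have "(\<integral>x. (dquot m f x - dquot n f x)\<^sup>2 \<partial>leb01) = SB m f f - SB n f f"
        by (simp add: integral_dquot_diff_sq)
      also have "\<dots> < e" using N[of n] L(2)[of m] L(2)[of n] that by linarith
      finally show ?thesis .
    qed
    have "(\<integral>x. (dquot m f x - dquot n f x)\<^sup>2 \<partial>leb01) < e" if "n \<ge> N" "m \<ge> N" for m n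
      using le[of n m] le[of m n] that by (cases "n \<le> m") (simp_all add: power2_commute)
    then show ?thesis by blast
  qed
  obtain g where g: "in_L2 leb01 g" and lim: "(\<lambda>n. \<integral>x. (dquot n f x - g x)\<^sup>2 \<partial>leb01) \<longlonglongrightarrow> 0"
    by (rule L2_complete[OF leb01.finite_measure_axioms in_L2_dquot Cauchy])
  have L2d: "in_L2 leb01 (\<lambda>x. dquot n f x - g x)" for n by (rule in_L2_diff[OF in_L2_dquot g])
  \<comment> \<open>The test functions will vary with \<open>n\<close> too, so convergence is needed
    for pairings with any bounded sequence in L2, not only with a fixed function.\<close>
  have pair: "(\<lambda>n. \<integral>t. (dquot n f t - g t) * h n t \<partial>leb01) \<longlonglongrightarrow> 0"
    if h: "\<And>n. in_L2 leb01 (h n)" "\<And>n. (\<integral>t. (h n t)\<^sup>2 \<partial>leb01) \<le> B" for h B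
  proof -
    have "(\<lambda>n. (\<integral>x. (dquot n f x - g x)\<^sup>2 \<partial>leb01) * B) \<longlonglongrightarrow> 0 * B"
      by (intro tendsto_mult lim tendsto_const)
    then have l0: "(\<lambda>n. (\<integral>x. (dquot n f x - g x)\<^sup>2 \<partial>leb01) * B) \<longlonglongrightarrow> 0" by simp
    have le: "(\<integral>t. (dquot n f t - g t) * h n t \<partial>leb01)\<^sup>2 \<le> (\<integral>x. (dquot n f x - g x)\<^sup>2 \<partial>leb01) * B" for n
      by (rule order_trans[OF Cauchy_Schwarz_integral[OF L2d h(1)]]) (intro mult_left_mono h(2), simp)
    have "(\<lambda>n. (\<integral>t. (dquot n f t - g t) * h n t \<partial>leb01)\<^sup>2) \<longlonglongrightarrow> 0"
      by (rule tendsto_sandwich[OF _ _ tendsto_const l0]) (use le in \<open>auto intro!: always_eventually\<close>)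
    from tendsto_real_sqrt[OF this] show ?thesis by (simp add: tendsto_rabs_zero_iff)
  qed
  have "(\<integral>t. (g t)\<^sup>2 \<partial>leb01) \<le> c"
  proof (rule LIMSEQ_le_const2)
    \<comment> \<open>Expanding the square around \<open>g\<close> exhibits the squared norm of
      \<open>g\<close> as the limit of those of the quotients, which \<open>c\<close>
      bounds.\<close>
    have "(\<lambda>n. (\<integral>t. (dquot n f t - g t) * g t \<partial>leb01)) \<longlonglongrightarrow> 0"
      by (rule pair[OF g order_refl])
    from tendsto_diff[OF L(1) tendsto_add[OF lim tendsto_mult[OF tendsto_const[of 2] this]]]
    have "(\<lambda>n. SB n f f - ((\<integral>x. (dquot n f x - g x)\<^sup>2 \<partial>leb01)
       + 2 * (\<integral>t. (dquot n f t - g t) * g t \<partial>leb01))) \<longlonglongrightarrow> L" by simp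
    moreover have "SB n f f - ((\<integral>x. (dquot n f x - g x)\<^sup>2 \<partial>leb01)
       + 2 * (\<integral>t. (dquot n f t - g t) * g t \<partial>leb01)) = (\<integral>t. (g t)\<^sup>2 \<partial>leb01)" for n
    proof -
      have "SB n f f = (\<integral>t. (dquot n f t - g t)\<^sup>2 + 2 * ((dquot n f t - g t) * g t) + (g t)\<^sup>2 \<partial>leb01)"
        unfolding integral_dquot_sq[symmetric] by (simp add: power2_eq_square algebra_simps)
      also have "\<dots> = (\<integral>x. (dquot n f x - g x)\<^sup>2 \<partial>leb01)
         + 2 * (\<integral>t. (dquot n f t - g t) * g t \<partial>leb01) + (\<integral>t. (g t)\<^sup>2 \<partial>leb01)"
        using L2d[of n] g in_L2_mult[OF L2d[of n] g] by (simp add: in_L2_def)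
      finally show ?thesis by simp
    qed
    ultimately have "(\<lambda>n. \<integral>t. (g t)\<^sup>2 \<partial>leb01) \<longlonglongrightarrow> L" by simp
    then have "(\<integral>t. (g t)\<^sup>2 \<partial>leb01) = L" by (simp add: LIMSEQ_const_iff)
    then show "(\<lambda>n. SB n f f) \<longlonglongrightarrow> (\<integral>t. (g t)\<^sup>2 \<partial>leb01)" using L(1) by simp
    show "\<exists>N. \<forall>n\<ge>N. SB n f f \<le> c" using bnd by auto
  qed
  moreover have "is_weak_deriv f g"
    unfolding is_weak_deriv_def
  proof (intro allI impI)
    fix \<phi> \<phi>' assume tf: "test_function \<phi> \<phi>'"
    then have d: "\<And>t. (\<phi> has_real_derivative \<phi>' t) (at t)" and c': "continuous_on UNIV \<phi>'"
      by (auto simp: test_function_def)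
    have c0: "continuous_on UNIV \<phi>"
      using d by (meson DERIV_isCont continuous_at_imp_continuous_on)
    obtain C1 where C1: "\<And>t. t \<in> {0..1} \<Longrightarrow> \<bar>f t\<bar> \<le> C1"
      using continuous_bounded_01[OF f] by blast
    obtain C2 where C2: "\<And>t. t \<in> {0..1} \<Longrightarrow> \<bar>\<phi> t\<bar> \<le> C2"
      using continuous_bounded_01[OF continuous_on_subset[OF c0]] by blast
    obtain C3 where C3: "\<And>t. t \<in> {0..1} \<Longrightarrow> \<bar>\<phi>' t\<bar> \<le> C3"
      using continuous_bounded_01[OF continuous_on_subset[OF c']] by blast
    have pos: "0 \<le> C1" "0 \<le> C2" "0 \<le> C3" using C1[of 0] C2[of 0] C3[of 0] by auto
    have [measurable]: "(\<lambda>t. F (ix N t)) \<in> borel_measurable leb01" for F :: "nat \<Rightarrow> real" and N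
      by (rule has_integral_step)
    have [measurable]: "dquot N h \<in> borel_measurable leb01" for N h
      using in_L2_dquot by (auto simp: in_L2_def)
    have [measurable]: "f \<in> borel_measurable leb01"
      by (rule borel_measurable_leb01_continuous) (rule continuous_on_subset[OF f], auto)
    have [measurable]: "\<phi> \<in> borel_measurable leb01" "\<phi>' \<in> borel_measurable leb01"
      using c0 c' by (auto intro!: borel_measurable_leb01_continuous intro: continuous_on_subset)
    have [measurable]: "g \<in> borel_measurable leb01" using g by (auto simp: in_L2_def)
    \<comment> \<open>The test function frozen at left grid points, as the discrete integration by
      parts requires.\<close>
    define \<phi>N where "\<phi>N N t = \<phi> (real (ix N t) / 2 ^ N)" for N t
    have [measurable]: "\<phi>N N \<in> borel_measurable leb01" for N unfolding \<phi>N_def by measurable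
    have \<phi>Nb: "\<bar>\<phi>N N t\<bar> \<le> C2" if "t \<in> {0<..<1}" for N t
      unfolding \<phi>N_def using that by (intro C2 dyadic_point_bounds) auto
    have L2N: "in_L2 leb01 (\<phi>N N)" for N
      by (rule in_L2_bounded[of _ _ C2]) (use \<phi>Nb in \<open>auto intro: leb01.finite_measure_axioms\<close>)
    have "(\<lambda>N. \<integral>t. (dquot N f t - g t) * \<phi>N N t \<partial>leb01) \<longlonglongrightarrow> 0"
    proof (rule pair[OF L2N])
      fix N
      have "(\<integral>t. (\<phi>N N t)\<^sup>2 \<partial>leb01) \<le> (\<integral>t. C2\<^sup>2 \<partial>leb01)"
        using L2N[of N] \<phi>Nb pos by (intro integral_mono) (auto simp: in_L2_def abs_le_square_iff[symmetric])
      then show "(\<integral>t. (\<phi>N N t)\<^sup>2 \<partial>leb01) \<le> C2\<^sup>2 * measure leb01 (space leb01)" by (simp add: mult.commute)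
    qed
    moreover have "(\<lambda>N. \<integral>t. g t * \<phi>N N t \<partial>leb01) \<longlonglongrightarrow> (\<integral>t. g t * \<phi> t \<partial>leb01)"
    proof (rule integral_dominated_convergence)
      show "integrable leb01 (\<lambda>t. C2 * \<bar>g t\<bar>)"
        using in_L2_integrable[OF leb01.finite_measure_axioms g] by auto
      show "AE t in leb01. (\<lambda>N. g t * \<phi>N N t) \<longlonglongrightarrow> g t * \<phi> t"
      proof (rule AE_I2)
        fix t assume "t \<in> space leb01"
        then have t: "0 < t" "t < 1" by auto
        have "(\<lambda>N. real (ix N t) / 2 ^ N) \<longlonglongrightarrow> t"
          by (rule dyadic_tendsto[OF t]) (auto simp: divide_right_mono)
        from isCont_tendsto_compose[OF DERIV_isCont[OF d] this]
        show "(\<lambda>N. g t * \<phi>N N t) \<longlonglongrightarrow> g t * \<phi> t"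
          unfolding \<phi>N_def by (rule tendsto_mult[OF tendsto_const])
      qed
      show "AE t in leb01. norm (g t * \<phi>N N t) \<le> C2 * \<bar>g t\<bar>" for N
        using mult_right_mono[OF \<phi>Nb abs_ge_zero] by (intro AE_I2) (auto simp: abs_mult mult.commute)
    qed auto
    ultimately have "(\<lambda>N. (\<integral>t. (dquot N f t - g t) * \<phi>N N t \<partial>leb01) + (\<integral>t. g t * \<phi>N N t \<partial>leb01))
      \<longlonglongrightarrow> 0 + (\<integral>t. g t * \<phi> t \<partial>leb01)"
      by (rule tendsto_add)
    moreover have "(\<integral>t. (dquot N f t - g t) * \<phi>N N t \<partial>leb01) + (\<integral>t. g t * \<phi>N N t \<partial>leb01)
        = (\<integral>t. dquot N f t * \<phi>N N t \<partial>leb01)" for N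
      using in_L2_mult[OF L2d[of N] L2N[of N]] in_L2_mult[OF g L2N[of N]]
      by (simp add: algebra_simps flip: Bochner_Integration.integral_add)
    ultimately have lim1: "(\<lambda>N. \<integral>t. dquot N f t * \<phi>N N t \<partial>leb01) \<longlonglongrightarrow> (\<integral>t. g t * \<phi> t \<partial>leb01)"
      by simp
    have lim2: "(\<lambda>N. \<integral>t. f (real (Suc (ix N t)) / 2 ^ N) * dquot N \<phi> t \<partial>leb01) \<longlonglongrightarrow> (\<integral>t. f t * \<phi>' t \<partial>leb01)"
    proof (rule integral_dominated_convergence)
      show "integrable leb01 (\<lambda>t. C1 * C3)" by simp
      \<comment> \<open>The mean value theorem turns the quotient of the test function into a value
        of its derivative nearby, so pointwise convergence follows from continuity.\<close>
      have "\<exists>z. real (ix N t) / 2 ^ N < z \<and> z < real (Suc (ix N t)) / 2 ^ N \<and> dquot N \<phi> t = \<phi>' z" for N t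
        unfolding dquot_def by (rule dinc_eq_deriv[OF d])
      then obtain z where z: "\<And>N t. real (ix N t) / 2 ^ N < z N t"
        "\<And>N t. z N t < real (Suc (ix N t)) / 2 ^ N" "\<And>N t. dquot N \<phi> t = \<phi>' (z N t)" by metis
      show "AE t in leb01. (\<lambda>N. f (real (Suc (ix N t)) / 2 ^ N) * dquot N \<phi> t) \<longlonglongrightarrow> f t * \<phi>' t"
      proof (rule AE_I2)
        fix t assume "t \<in> space leb01"
        then have t: "0 < t" "t < 1" by auto
        have l1: "(\<lambda>N. real (Suc (ix N t)) / 2 ^ N) \<longlonglongrightarrow> t"
          by (rule dyadic_tendsto[OF t]) (auto simp: divide_right_mono)
        have c1: "isCont f t"
          using continuous_on_interior[OF f] t by (simp add: interior_atLeastAtMost_real)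
        have l2: "(\<lambda>N. z N t) \<longlonglongrightarrow> t"
          by (rule dyadic_tendsto[OF t]) (use z in \<open>auto intro: less_imp_le\<close>)
        have c2: "isCont \<phi>' t" using c' by (simp add: continuous_on_eq_continuous_at)
        show "(\<lambda>N. f (real (Suc (ix N t)) / 2 ^ N) * dquot N \<phi> t) \<longlonglongrightarrow> f t * \<phi>' t"
          unfolding z(3)
          by (rule tendsto_mult[OF isCont_tendsto_compose[OF c1 l1] isCont_tendsto_compose[OF c2 l2]])
      qed
      show "AE t in leb01. norm (f (real (Suc (ix N t)) / 2 ^ N) * dquot N \<phi> t) \<le> C1 * C3" for N
      proof (rule AE_I2)
        fix t assume "t \<in> space leb01"
        then have t: "0 < t" "t < 1" by auto
        have "z N t \<in> {0..1}"
          using z(1,2)[of N t] dyadic_point_bounds[OF t, of N] unfolding atLeastAtMost_iff by linarith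
        then show "norm (f (real (Suc (ix N t)) / 2 ^ N) * dquot N \<phi> t) \<le> C1 * C3"
          unfolding z(3) using dyadic_point_bounds[OF t, of N] C1 C3 pos
          by (auto simp: abs_mult simp del: of_nat_Suc intro!: mult_mono)
      qed
    qed auto
    have "(\<lambda>N. \<integral>t. dquot N f t * \<phi>N N t \<partial>leb01) \<longlonglongrightarrow> - (\<integral>t. f t * \<phi>' t \<partial>leb01)"
      using tendsto_minus[OF lim2]
      by (simp add: \<phi>N_def dyadic_parts test_function_boundary[OF tf])
    from LIMSEQ_unique[OF lim1 this]
    show "(\<integral>t. f t * \<phi>' t \<partial>leb01) = - (\<integral>t. g t * \<phi> t \<partial>leb01)" by simp
  qed
  ultimately show thesis using that g by blast
qed

section \<open>Smoothed step functions, and increments as integrals of the weak derivative\<close>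

definition bump :: "real \<Rightarrow> real" where
  "bump t = max 0 (t + 1) - 2 * max 0 t + max 0 (t - 1)"

text \<open>Continuously differentiable smoothing of the Heaviside function, half the second
  difference of the squared positive part; its derivative \<open>bump\<close> is the hat function of
  unit mass on [-1,1].\<close>

definition ramp :: "real \<Rightarrow> real" where
  "ramp t = ((max 0 (t + 1))\<^sup>2 - 2 * (max 0 t)\<^sup>2 + (max 0 (t - 1))\<^sup>2) / 2"

lemma DERIV_max0_sq: "((\<lambda>t. (max 0 t)\<^sup>2) has_real_derivative 2 * max 0 x) (at (x::real))"
proof (cases "x = 0")
  case True
  have "((\<lambda>h. (max 0 h)\<^sup>2 / h) \<longlongrightarrow> 0) (at (0::real))"
  proof (rule Lim_null_comparison)
    show "\<forall>\<^sub>F h in at 0. norm ((max 0 h)\<^sup>2 / h) \<le> \<bar>h :: real\<bar>"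
      by (rule always_eventually) (auto simp: max_def power2_eq_square)
    show "((\<lambda>h::real. \<bar>h\<bar>) \<longlongrightarrow> 0) (at 0)"
      by (rule tendsto_rabs_zero) (rule tendsto_ident_at)
  qed
  then show ?thesis using True by (simp add: DERIV_def)
next
  case False
  then consider "x < 0" | "x > 0" by linarith
  then show ?thesis
  proof cases
    case 1
    have "((\<lambda>t. 0) has_real_derivative 2 * max 0 x) (at x)" using 1 by simp
    then show ?thesis
      by (rule has_field_derivative_transform_within_open[of _ _ _ "{..<0}"]) (use 1 in auto)
  next
    case 2
    have "((\<lambda>t. t\<^sup>2) has_real_derivative 2 * max 0 x) (at x)"
      using 2 by (auto intro!: derivative_eq_intros)
    then show ?thesis
      by (rule has_field_derivative_transform_within_open[of _ _ _ "{0<..}"]) (use 2 in auto)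
  qed
qed

lemma DERIV_ramp: "(ramp has_real_derivative bump x) (at x)"
proof -
  have s: "((\<lambda>t. (max 0 (t + c))\<^sup>2) has_real_derivative 2 * max 0 (x + c)) (at x)" for c
    using DERIV_shift[of "\<lambda>t. (max 0 t)\<^sup>2" "2 * max 0 (x + c)" x c] DERIV_max0_sq[of "x + c"]
    by simp
  have "((\<lambda>t. ((max 0 (t + 1))\<^sup>2 - 2 * (max 0 t)\<^sup>2 + (max 0 (t - 1))\<^sup>2) / 2) has_real_derivative
     (2 * max 0 (x + 1) - 2 * (2 * max 0 x) + 2 * max 0 (x - 1)) / 2) (at x)"
    using s[of 1] s[of "-1"] DERIV_max0_sq[of x]
    by (intro DERIV_cdivide DERIV_add DERIV_diff DERIV_cmult) simp_all
  then show ?thesis by (simp add: ramp_def[abs_def] bump_def add_divide_distrib diff_divide_distrib)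
qed

lemma DERIV_ramp_scaled:
  "((\<lambda>t. ramp (n * (t - a))) has_real_derivative n * bump (n * (t - a))) (at t)"
proof -
  have "((\<lambda>t. n * (t - a)) has_real_derivative n) (at t)"
    by (auto intro!: derivative_eq_intros)
  from DERIV_chain2[OF DERIV_ramp this] show ?thesis by (simp add: mult.commute)
qed

lemma bump_bounds: "0 \<le> bump t" "t \<notin> {-1<..<1} \<Longrightarrow> bump t = 0"
  by (auto simp: bump_def max_def)

lemma ramp_left: "t \<le> -1 \<Longrightarrow> ramp t = 0"
  by (simp add: ramp_def max_def)

lemma ramp_right: "1 \<le> t \<Longrightarrow> ramp t = 1"
  by (cases "t = 1") (simp_all add: ramp_def max_def power2_eq_square field_simps)

lemma ramp_bounds: "0 \<le> ramp t" "ramp t \<le> 1"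
proof -
  have mono: "ramp s \<le> ramp t" if "s \<le> t" for s t
    by (rule DERIV_nonneg_imp_nondecreasing[OF that]) (use DERIV_ramp bump_bounds in blast)
  show "0 \<le> ramp t" using mono[of "min t (-1)" t] ramp_left[of "min t (-1)"] by simp
  show "ramp t \<le> 1" using mono[of t "max t 1"] ramp_right[of "max t 1"] by simp
qed

lemma continuous_bump: "continuous_on UNIV bump"
  unfolding bump_def[abs_def] by (intro continuous_intros)

text \<open>Rescaled hats form an approximate identity at \<open>a\<close>: unit mass and support
  shrinking to \<open>a\<close>, so the integral averages values of \<open>f\<close> close to
  \<open>f a\<close>.\<close>

lemma bump_approx:
  assumes f: "continuous_on {0..1} f" and a: "0 < a" "a < 1"
  shows "(\<lambda>n. \<integral>t. f t * (real n * bump (real n * (t - a))) \<partial>leb01) \<longlonglongrightarrow> f a"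
proof (rule LIMSEQ_I)
  fix e :: real assume e: "0 < e"
  have "isCont f a" using continuous_on_interior[OF f] a by (simp add: interior_atLeastAtMost_real)
  then obtain d where d: "d > 0" "\<And>t. \<bar>t - a\<bar> < d \<Longrightarrow> \<bar>f t - f a\<bar> < e / 2"
    using e unfolding continuous_at_eps_delta by (metis dist_real_def half_gt_zero)
  \<comment> \<open>Keeps the support of the hat inside (0,1), so that \<open>leb01\<close> cuts off
    none of its mass.\<close>
  define d' where "d' = min d (min a (1 - a))"
  have d': "d' > 0" "d' \<le> d" "d' \<le> a" "d' \<le> 1 - a" using d a by (auto simp: d'_def)
  obtain n0 where n0: "inverse (real (Suc n0)) < d'" using reals_Archimedean[OF d'(1)] by blast
  have "norm ((\<integral>t. f t * (real n * bump (real n * (t - a))) \<partial>leb01) - f a) < e" if n: "n \<ge> Suc n0" for n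
  proof -
    define k where "k t = real n * bump (real n * (t - a))" for t
    have npos: "real n > 0" using n by simp
    have nd: "1 \<le> real n * d'"
    proof -
      have "1 < real (Suc n0) * d'" using n0 by (simp add: field_simps)
      also have "\<dots> \<le> real n * d'" using n d' by (intro mult_right_mono) auto
      finally show ?thesis by simp
    qed
    have ck: "continuous_on UNIV k"
      unfolding k_def by (intro continuous_intros continuous_on_compose2[OF continuous_bump]) auto
    have k0: "0 \<le> k t" for t unfolding k_def using npos bump_bounds by simp
    have ksupp: "k t = 0" if "\<not> \<bar>t - a\<bar> < d" for t
    proof -
      have "1 \<le> real n * \<bar>t - a\<bar>"
        using nd mult_left_mono[of d' "\<bar>t - a\<bar>" "real n"] that d' npos by linarith
      then have "1 \<le> \<bar>real n * (t - a)\<bar>" by (simp add: abs_mult)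
      then show ?thesis unfolding k_def by (subst bump_bounds(2)) auto
    qed
    have "((\<lambda>t. ramp (real n * (t - a))) has_real_derivative k t) (at t)" for t
      unfolding k_def by (rule DERIV_ramp_scaled)
    from integral_leb01_FTC[OF this ck]
    have "(\<integral>t. k t \<partial>leb01) = ramp (real n * (1 - a)) - ramp (real n * (0 - a))" by simp
    also have "\<dots> = 1"
    proof -
      have "1 \<le> real n * (1 - a)" "1 \<le> real n * a"
        using nd mult_left_mono[OF d'(3), of "real n"] mult_left_mono[OF d'(4), of "real n"] npos by linarith+
      then show ?thesis by (simp add: ramp_left ramp_right)
    qed
    finally have k1: "(\<integral>t. k t \<partial>leb01) = 1" .
    obtain C where C: "\<And>t. t \<in> {0..1} \<Longrightarrow> \<bar>f t\<bar> \<le> C" using continuous_bounded_01[OF f] by blast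
    obtain D where D: "\<And>t. t \<in> {0..1} \<Longrightarrow> \<bar>k t\<bar> \<le> D"
      using continuous_bounded_01[OF continuous_on_subset[OF ck]] by blast
    have [measurable]: "f \<in> borel_measurable leb01"
      by (rule borel_measurable_leb01_continuous) (rule continuous_on_subset[OF f], auto)
    have [measurable]: "k \<in> borel_measurable leb01"
      by (rule borel_measurable_leb01_continuous) (rule continuous_on_subset[OF ck], auto)
    have L2: "in_L2 leb01 f" "in_L2 leb01 k"
      by (rule in_L2_bounded[of _ _ C], use C in \<open>auto intro: leb01.finite_measure_axioms\<close>)
        (rule in_L2_bounded[of _ _ D], use D in \<open>auto intro: leb01.finite_measure_axioms\<close>)
    have ik: "integrable leb01 k" "integrable leb01 (\<lambda>t. f t * k t)"
      using in_L2_integrable[OF leb01.finite_measure_axioms L2(2)] in_L2_mult[OF L2] by auto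
    have "(\<integral>t. f t * k t \<partial>leb01) - f a = (\<integral>t. f t * k t - f a * k t \<partial>leb01)"
      using ik k1 by simp
    also have "\<bar>\<dots>\<bar> \<le> (\<integral>t. e / 2 * k t \<partial>leb01)"
    proof (rule order_trans[OF integral_abs_bound], rule integral_mono)
      show "\<bar>f t * k t - f a * k t\<bar> \<le> e / 2 * k t" for t
      proof (cases "\<bar>t - a\<bar> < d")
        case True
        then show ?thesis
          using mult_right_mono[of "\<bar>f t - f a\<bar>" "e / 2" "k t"] d(2)[of t] k0[of t]
          by (simp add: abs_mult flip: left_diff_distrib)
      qed (simp add: ksupp)
    qed (use ik in auto)
    also have "\<dots> = e / 2" using k1 by simp
    finally show ?thesis using e by (simp add: k_def)
  qed
  then show "\<exists>no. \<forall>n\<ge>no. norm ((\<integral>t. f t * (real n * bump (real n * (t - a))) \<partial>leb01) - f a) < e"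
    by blast
qed

text \<open>Testing against smoothed indicators of \<open>(a,b)\<close>.\<close>

lemma weak_deriv_FTC:
  assumes f: "continuous_on {0..1} f" and g: "in_L2 leb01 g" and w: "is_weak_deriv f g"
    and ab: "0 < a" "a < b" "b < 1"
  shows "f b - f a = (\<integral>t. indicator {a<..<b} t * g t \<partial>leb01)"
proof -
  define \<phi> where "\<phi> n t = ramp (real n * (t - a)) - ramp (real n * (t - b))" for n t
  define \<phi>' where "\<phi>' n t = real n * bump (real n * (t - a)) - real n * bump (real n * (t - b))" for n t
  have d\<phi>: "(\<phi> n has_real_derivative \<phi>' n t) (at t)" for n t
    unfolding \<phi>_def[abs_def] \<phi>'_def by (intro DERIV_diff DERIV_ramp_scaled)
  have c\<phi>': "continuous_on UNIV (\<phi>' n)" for n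
    unfolding \<phi>'_def[abs_def] by (intro continuous_intros continuous_on_compose2[OF continuous_bump]) auto
  have c\<phi>: "continuous_on UNIV (\<phi> n)" for n
    using d\<phi> by (meson DERIV_isCont continuous_at_imp_continuous_on)
  define m where "m = min a (1 - b)"
  have m: "0 < m" "m \<le> a" "m \<le> 1 - b" using ab by (auto simp: m_def)
  obtain n0 where n0: "inverse (real (Suc n0)) < m" using reals_Archimedean[OF m(1)] by blast
  have tf: "test_function (\<phi> n) (\<phi>' n)" if n: "n \<ge> Suc n0" for n
  proof -
    have npos: "real n > 0" using n by simp
    define h where "h = inverse (real n)"
    have h: "h > 0" "real n * h = 1" using npos by (auto simp: h_def)
    have "h \<le> inverse (real (Suc n0))" unfolding h_def using n by (intro le_imp_inverse_le) auto
    then have hm: "h < m" using n0 by linarith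
    have "\<phi> n t = 0" if out: "t \<notin> {a - h..b + h}" for t
    proof -
      consider "t < a - h" | "t > b + h" using out by fastforce
      then show ?thesis
      proof cases
        case 1
        then have "t - a \<le> - h" "t - b \<le> - h" using ab by auto
        then have "real n * (t - a) \<le> real n * (- h)" "real n * (t - b) \<le> real n * (- h)"
          by (simp_all only: mult_left_mono of_nat_0_le_iff)
        then show ?thesis using h by (simp add: \<phi>_def ramp_left)
      next
        case 2
        then have "t - a \<ge> h" "t - b \<ge> h" using ab by auto
        then have "real n * (t - a) \<ge> real n * h" "real n * (t - b) \<ge> real n * h"
          using npos by (auto intro!: mult_left_mono)
        then show ?thesis using h by (simp add: \<phi>_def ramp_right)
      qed
    qed
    moreover have "0 < a - h" "b + h < 1" using hm m by auto
    ultimately show ?thesis unfolding test_function_def using d\<phi> c\<phi>' by blast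
  qed
  have [measurable]: "f \<in> borel_measurable leb01" "g \<in> borel_measurable leb01" "\<phi> n \<in> borel_measurable leb01" for n
    using g by (auto simp: in_L2_def intro!: borel_measurable_leb01_continuous continuous_on_subset[OF f] continuous_on_subset[OF c\<phi>])
  have lim1: "(\<lambda>n. \<integral>t. g t * \<phi> n t \<partial>leb01) \<longlonglongrightarrow> (\<integral>t. g t * indicator {a<..<b} t \<partial>leb01)"
  proof (rule integral_dominated_convergence)
    show "integrable leb01 (\<lambda>t. \<bar>g t\<bar>)"
      using in_L2_integrable[OF leb01.finite_measure_axioms g] by auto
    have "\<bar>\<phi> n t\<bar> \<le> 1" for n t
      using ramp_bounds[of "real n * (t - a)"] ramp_bounds[of "real n * (t - b)"] by (auto simp: \<phi>_def)
    then show "AE t in leb01. norm (g t * \<phi> n t) \<le> \<bar>g t\<bar>" for n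
      by (intro AE_I2) (auto simp: abs_mult intro: mult_left_le)
    have lim: "(\<lambda>n. ramp (real n * s)) \<longlonglongrightarrow> (if s > 0 then 1 else 0)" if s: "s \<noteq> 0" for s
    proof (rule tendsto_eventually)
      obtain n0 where n0: "1 < real n0 * \<bar>s\<bar>" using reals_Archimedean3[of "\<bar>s\<bar>"] s by auto
      show "\<forall>\<^sub>F n in sequentially. ramp (real n * s) = (if s > 0 then 1 else 0)"
        using eventually_ge_at_top[of n0]
      proof eventually_elim
        case (elim n)
        have "1 \<le> real n * \<bar>s\<bar>" using n0 mult_right_mono[of "real n0" "real n" "\<bar>s\<bar>"] elim by auto
        then show ?case using s by (auto simp: ramp_right ramp_left abs_if split: if_splits)
      qed
    qed
    \<comment> \<open>At \<open>a\<close> and \<open>b\<close> the smoothed indicator tends to 1/2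
      instead; these two points form a null set.\<close>
    have ptw: "(\<lambda>n. g t * \<phi> n t) \<longlonglongrightarrow> g t * indicator {a<..<b} t" if t: "t \<noteq> a" "t \<noteq> b" for t
    proof -
      have "(\<lambda>n. g t * \<phi> n t) \<longlonglongrightarrow> g t * ((if t - a > 0 then 1 else 0) - (if t - b > 0 then 1 else 0))"
        unfolding \<phi>_def using t by (intro tendsto_intros lim) auto
      also have "((if t - a > 0 then 1 else 0) - (if t - b > 0 then 1 else 0)) = (indicator {a<..<b} t :: real)"
        using t ab by (auto simp: indicator_def)
      finally show ?thesis .
    qed
    have "AE t in lborel. t \<in> {0<..<1} \<longrightarrow> (\<lambda>n. g t * \<phi> n t) \<longlonglongrightarrow> g t * indicator {a<..<b} t"
      using AE_lborel_singleton[of a] AE_lborel_singleton[of b] by eventually_elim (use ptw in auto)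
    then show "AE t in leb01. (\<lambda>n. g t * \<phi> n t) \<longlonglongrightarrow> g t * indicator {a<..<b} t"
      unfolding leb01_def by (subst AE_restrict_space_iff) auto
  qed auto
  have i: "integrable leb01 (\<lambda>t. f t * (real n * bump (real n * (t - c))))" for n c
  proof -
    have cb: "continuous_on {0..1} (\<lambda>t. f t * (real n * bump (real n * (t - c))))"
      by (intro continuous_intros continuous_on_compose2[OF continuous_bump] f) auto
    obtain C where "\<And>t. t \<in> {0..1} \<Longrightarrow> \<bar>f t * (real n * bump (real n * (t - c)))\<bar> \<le> C"
      using continuous_bounded_01[OF cb] by blast
    then show ?thesis
      by (intro leb01.integrable_const_bound[of _ C] AE_I2 borel_measurable_leb01_continuous continuous_on_subset[OF cb]) auto
  qed
  have "(\<lambda>n. \<integral>t. f t * \<phi>' n t \<partial>leb01) \<longlonglongrightarrow> f a - f b"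
  proof -
    have "(\<integral>t. f t * \<phi>' n t \<partial>leb01) = (\<integral>t. f t * (real n * bump (real n * (t - a))) \<partial>leb01)
        - (\<integral>t. f t * (real n * bump (real n * (t - b))) \<partial>leb01)" for n
      using i[of n a] i[of n b]
      by (simp add: \<phi>'_def right_diff_distrib flip: Bochner_Integration.integral_diff)
    then show ?thesis using tendsto_diff[OF bump_approx[OF f, of a] bump_approx[OF f, of b]] ab by simp
  qed
  moreover have "(\<lambda>n. \<integral>t. f t * \<phi>' n t \<partial>leb01) \<longlonglongrightarrow> - (\<integral>t. g t * indicator {a<..<b} t \<partial>leb01)"
  proof (rule Lim_transform_eventually[OF tendsto_minus[OF lim1]])
    show "\<forall>\<^sub>F n in sequentially. - (\<integral>t. g t * \<phi> n t \<partial>leb01) = (\<integral>t. f t * \<phi>' n t \<partial>leb01)"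
      using eventually_ge_at_top[of "Suc n0"]
      by eventually_elim (use w[unfolded is_weak_deriv_def, rule_format, OF tf] in simp)
  qed
  ultimately have "f a - f b = - (\<integral>t. g t * indicator {a<..<b} t \<partial>leb01)"
    by (rule LIMSEQ_unique)
  then show ?thesis by (simp add: mult.commute)
qed

text \<open>Test functions reach only points strictly inside (0,1); intervals up to the endpoints
  are exhausted by these shrunken ones. The summand 3 limits each shift to a third of the length,
  which keeps the new endpoints ordered.\<close>

lemma shrink_interval:
  fixes a b :: real
  assumes "a < b"
  shows "a < a + (b - a) / (real n + 3)"
    "a + (b - a) / (real n + 3) < b - (b - a) / (real n + 3)"
    "b - (b - a) / (real n + 3) < b"
proof -
  define u where "u = (b - a) / (real n + 3)"
  have u0: "0 < u" unfolding u_def using assms by simp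
  have "u \<le> (b - a) / 3" unfolding u_def by (rule divide_left_mono) (use assms in auto)
  then have u3: "3 * u \<le> b - a" by simp
  have "a < a + u" using u0 by linarith
  moreover have "a + u < b - u" using u3 u0 by linarith
  moreover have "b - u < b" using u0 by linarith
  ultimately show "a < a + (b - a) / (real n + 3)"
    "a + (b - a) / (real n + 3) < b - (b - a) / (real n + 3)"
    "b - (b - a) / (real n + 3) < b" unfolding u_def by blast+
qed

text \<open>Cauchy-Schwarz for the increment between interior points, written as an integral of
  \<open>g\<close>; continuity of \<open>f\<close> then lets the points move to \<open>a\<close> and
  \<open>b\<close>, which may be 0 and 1.\<close>

lemma weak_deriv_increment_le:
  assumes f: "continuous_on {0..1} f" and g: "in_L2 leb01 g" and w: "is_weak_deriv f g"
    and ab: "0 \<le> a" "a < b" "b \<le> 1"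
  shows "(f b - f a)\<^sup>2 \<le> (b - a) * (\<integral>t. indicator {a<..<b} t * (g t)\<^sup>2 \<partial>leb01)"
proof -
  define I where "I = (\<integral>t. indicator {a<..<b} t * (g t)\<^sup>2 \<partial>leb01)"
  have [measurable]: "g \<in> borel_measurable leb01" using g by (auto simp: in_L2_def)
  have ig: "integrable leb01 (\<lambda>t. (g t)\<^sup>2)" using g by (auto simp: in_L2_def)
  have int: "integrable leb01 (\<lambda>t. indicator A t * (g t)\<^sup>2)" if [measurable]: "A \<in> sets borel" for A
    by (rule Bochner_Integration.integrable_bound[OF ig]) (auto split: split_indicator)
  have le: "(f y - f x)\<^sup>2 \<le> (y - x) * I" if xy: "a < x" "x < y" "y < b" for x y
  proof -
    have m: "(\<integral>t. indicator {x<..<y} t \<partial>leb01) = y - x"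
    proof -
      have "(\<integral>t. indicator {x<..<y} t \<partial>leb01) = (\<integral>t. (indicator {x<..<y} t :: real) \<partial>lborel)"
        unfolding integral_leb01[of "indicator {x<..<y}"] using xy ab
        by (intro Bochner_Integration.integral_cong refl) (auto simp: indicator_def)
      then show ?thesis using xy by simp
    qed
    have L2i: "in_L2 leb01 (\<lambda>t. indicator {x<..<y} t)"
      by (rule in_L2_bounded[of _ _ 1]) (auto intro: leb01.finite_measure_axioms split: split_indicator)
    have L2g: "in_L2 leb01 (\<lambda>t. indicator {x<..<y} t * g t)"
    proof -
      have "(\<lambda>t. (indicator {x<..<y} t * g t)\<^sup>2) = (\<lambda>t. indicator {x<..<y} t * (g t)\<^sup>2)"
        by (auto simp: indicator_def)
      then show ?thesis using int[of "{x<..<y}"] by (simp add: in_L2_def)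
    qed
    have "(f y - f x)\<^sup>2 = (\<integral>t. indicator {x<..<y} t * (indicator {x<..<y} t * g t) \<partial>leb01)\<^sup>2"
      using weak_deriv_FTC[OF f g w, of x y] xy ab by (simp flip: mult.assoc indicator_inter_arith)
    also have "\<dots> \<le> (\<integral>t. (indicator {x<..<y} t)\<^sup>2 \<partial>leb01) * (\<integral>t. (indicator {x<..<y} t * g t)\<^sup>2 \<partial>leb01)"
      by (rule Cauchy_Schwarz_integral[OF L2i L2g])
    also have "(\<integral>t. (indicator {x<..<y} t)\<^sup>2 \<partial>leb01) = y - x"
      using m by (simp add: power2_eq_square flip: indicator_inter_arith)
    also have "(\<integral>t. (indicator {x<..<y} t * g t)\<^sup>2 \<partial>leb01) \<le> I"
      unfolding I_def
    proof (rule integral_mono)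
      show "integrable leb01 (\<lambda>t. (indicator {x<..<y} t * g t)\<^sup>2)" using L2g by (simp add: in_L2_def)
      show "integrable leb01 (\<lambda>t. indicator {a<..<b} t * (g t)\<^sup>2)" by (rule int) simp
    qed (use xy in \<open>auto split: split_indicator\<close>)
    finally show ?thesis using xy by (simp add: mult_left_mono)
  qed
  have cont: "continuous_on {a..b} f" using f ab by (auto intro: continuous_on_subset)
  define m where "m = (a + b) / 2"
  have "(\<lambda>n. a + (b - a) / (real n + 3)) \<longlonglongrightarrow> a + 0" "(\<lambda>n. b - (b - a) / (real n + 3)) \<longlonglongrightarrow> b - 0"
    by (intro tendsto_add tendsto_diff tendsto_const, real_asymp)+
  then have lx: "(\<lambda>n. a + (b - a) / (real n + 3)) \<longlonglongrightarrow> a" and ly: "(\<lambda>n. b - (b - a) / (real n + 3)) \<longlonglongrightarrow> b"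
    by simp_all
  note in1 = shrink_interval[OF ab(2)]
  have in2: "a + (b - a) / (real n + 3) \<in> {a..b}" "b - (b - a) / (real n + 3) \<in> {a..b}" for n
    using in1[of n] unfolding atLeastAtMost_iff by (smt (verit))+
  have fx: "(\<lambda>n. f (a + (b - a) / (real n + 3))) \<longlonglongrightarrow> f a"
    by (rule continuous_on_tendsto_compose[OF cont lx]) (use in2 ab in \<open>simp_all only: always_eventually atLeastAtMost_iff less_imp_le order_refl simp_thms eventually_True\<close>)
  have fy: "(\<lambda>n. f (b - (b - a) / (real n + 3))) \<longlonglongrightarrow> f b"
    by (rule continuous_on_tendsto_compose[OF cont ly]) (use in2 ab in \<open>simp_all only: always_eventually atLeastAtMost_iff less_imp_le order_refl simp_thms eventually_True\<close>)
  have "(f b - f a)\<^sup>2 \<le> (b - a) * I"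
    by (rule LIMSEQ_le[OF tendsto_power[OF tendsto_diff[OF fy fx]] tendsto_mult[OF tendsto_diff[OF ly lx] tendsto_const]])
      (use le in1 in blast)
  then show ?thesis by (simp add: I_def)
qed

text \<open>The increment estimate summed over the dyadic cells; taken open, these are disjoint, so
  no part of the integral is counted twice.\<close>

lemma SB_le_weak_deriv:
  assumes f: "continuous_on {0..1} f" and g: "in_L2 leb01 g" and w: "is_weak_deriv f g"
  shows "SB N f f \<le> (\<integral>t. (g t)\<^sup>2 \<partial>leb01)"
proof -
  define I where "I i = {real i / 2 ^ N<..<real (Suc i) / 2 ^ N}" for i
  have [measurable]: "g \<in> borel_measurable leb01" using g by (auto simp: in_L2_def)
  have ig: "integrable leb01 (\<lambda>t. (g t)\<^sup>2)" using g by (auto simp: in_L2_def)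
  have int: "integrable leb01 (\<lambda>t. indicator (I i) t * (g t)\<^sup>2)" for i
    by (rule Bochner_Integration.integrable_bound[OF ig]) (auto simp: I_def split: split_indicator)
  have step: "2 ^ N * (dinc N f i * dinc N f i) \<le> (\<integral>t. indicator (I i) t * (g t)\<^sup>2 \<partial>leb01)"
    if "i < 2 ^ N" for i
  proof -
    have "real (Suc i) \<le> 2 ^ N" using that
      by (metis Suc_leI of_nat_le_iff of_nat_numeral of_nat_power)
    then have "real (Suc i) / 2 ^ N \<le> 1" by (simp add: field_simps)
    then have "(dinc N f i)\<^sup>2 \<le> (real (Suc i) / 2 ^ N - real i / 2 ^ N) * (\<integral>t. indicator (I i) t * (g t)\<^sup>2 \<partial>leb01)"
      unfolding dinc_def I_def
      by (intro weak_deriv_increment_le[OF f g w]) (auto simp: divide_strict_right_mono)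
    also have "real (Suc i) / 2 ^ N - real i / 2 ^ N = 1 / 2 ^ N" by (simp add: field_simps)
    finally show ?thesis by (simp add: field_simps power2_eq_square)
  qed
  have "SB N f f \<le> (\<Sum>i<2 ^ N. \<integral>t. indicator (I i) t * (g t)\<^sup>2 \<partial>leb01)"
    unfolding SB_def by (intro sum_mono step) auto
  also have "\<dots> = (\<integral>t. (\<Sum>i<2 ^ N. indicator (I i) t * (g t)\<^sup>2) \<partial>leb01)"
    by (rule Bochner_Integration.integral_sum[symmetric]) (rule int)
  also have "\<dots> \<le> (\<integral>t. (g t)\<^sup>2 \<partial>leb01)"
  proof (rule integral_mono)
    fix t assume "t \<in> space leb01"
    then have t: "0 < t" "t < 1" by auto
    have "(\<Sum>i<2 ^ N. indicator (I i) t * (g t)\<^sup>2) \<le> (\<Sum>i<2 ^ N. if i = ix N t then (g t)\<^sup>2 else 0)"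
    proof (rule sum_mono)
      fix i
      show "indicator (I i) t * (g t)\<^sup>2 \<le> (if i = ix N t then (g t)\<^sup>2 else 0)"
        using ix_eq_iff[OF t(1), of N i] by (auto simp: I_def indicator_def)
    qed
    also have "\<dots> \<le> (g t)\<^sup>2" by simp
    finally show "(\<Sum>i<2 ^ N. indicator (I i) t * (g t)\<^sup>2) \<le> (g t)\<^sup>2" .
  next
    show "integrable leb01 (\<lambda>t. \<Sum>i<2 ^ N. indicator (I i) t * (g t)\<^sup>2)"
      by (intro Bochner_Integration.integrable_sum int)
  qed (rule ig)
  finally show ?thesis .
qed

text \<open>The positive and negative parts of \<open>h\<close> are densities of two finite measures
  that agree on every half-line and hence coincide. Then both parts agree almost everywhere, which
  is possible only where \<open>h\<close> vanishes.\<close>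

lemma integral_intervals_zero_AE:
  fixes h :: "real \<Rightarrow> real"
  assumes h: "integrable leb01 h"
    and z: "\<And>a b. 0 < a \<Longrightarrow> a < b \<Longrightarrow> b < 1 \<Longrightarrow> (\<integral>t. indicator {a<..<b} t * h t \<partial>leb01) = 0"
  shows "AE t in leb01. h t = 0"
proof -
  define H where "H t = indicator {0<..<1} t * h t" for t
  have iH: "integrable lborel H"
    using h integrable_restrict_space[of "{0<..<1}" lborel h] by (simp add: leb01_def H_def[abs_def])
  then have [measurable]: "H \<in> borel_measurable borel" by auto
  have zI: "(\<integral>t. indicator {a<..<b} t * H t \<partial>lborel) = 0" if "0 < a" "a < b" "b < 1" for a b
    using z[OF that] unfolding integral_leb01 H_def by (simp add: mult.left_commute)
  have int: "integrable lborel (\<lambda>t. indicator A t * H t)" if [measurable]: "A \<in> sets borel" for A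
    by (rule Bochner_Integration.integrable_bound[OF iH]) (auto split: split_indicator)
  \<comment> \<open>\<open>H\<close> vanishes off (0,1), so a half-line amounts to an interval that
    may reach the endpoints, again approached from inside.\<close>
  have tail: "(\<integral>t. indicator {x<..} t * H t \<partial>lborel) = 0" for x
  proof -
    define y where "y = max 0 x"
    have eq: "indicator {x<..} t * H t = indicator {y<..<1} t * H t" for t
      by (auto simp: H_def y_def indicator_def)
    show ?thesis
    proof (cases "y < 1")
      case False
      then show ?thesis unfolding eq by simp
    next
      case True
      define A where "A n = {y + (1 - y) / (real n + 3)<..<1 - (1 - y) / (real n + 3)}" for n
      have y0: "0 \<le> y" by (simp add: y_def)
      note ord = shrink_interval[OF True]
      have A0: "(\<integral>t. indicator (A n) t * H t \<partial>lborel) = 0" for n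
        unfolding A_def by (intro zI ord order_le_less_trans[OF y0 ord(1)])
      have l0: "(\<lambda>n. (1 - y) / (real n + 3)) \<longlonglongrightarrow> 0"
        by real_asymp
      have "(\<lambda>n. \<integral>t. indicator (A n) t * H t \<partial>lborel) \<longlonglongrightarrow> (\<integral>t. indicator {y<..<1} t * H t \<partial>lborel)"
      proof (rule integral_dominated_convergence)
        show "integrable lborel (\<lambda>t. \<bar>H t\<bar>)" using iH by auto
        have "(\<lambda>n. indicator (A n) t * H t) \<longlonglongrightarrow> indicator {y<..<1} t * H t" for t
        proof (rule tendsto_eventually)
          show "\<forall>\<^sub>F n in sequentially. indicator (A n) t * H t = indicator {y<..<1} t * H t"
          proof (cases "t \<in> {y<..<1}")
            case False
            then have "t \<notin> A n" for n
              using ord(1,3)[of n] unfolding A_def greaterThanLessThan_iff by (meson less_trans)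
            then show ?thesis using False by simp
          next
            case True
            define m where "m = min (t - y) (1 - t)"
            have "0 < m" using True by (auto simp: m_def)
            from order_tendstoD(2)[OF l0 this] show ?thesis
            proof eventually_elim
              case (elim n)
              then have "t \<in> A n" unfolding A_def m_def by auto
              then show ?case using True by simp
            qed
          qed
        qed
        then show "AE t in lborel. (\<lambda>n. indicator (A n) t * H t) \<longlonglongrightarrow> indicator {y<..<1} t * H t"
          by simp
        show "AE t in lborel. norm (indicator (A n) t * H t) \<le> \<bar>H t\<bar>" for n
          by (auto split: split_indicator)
      qed (auto simp: A_def)
      then show ?thesis unfolding eq A0 by (simp add: LIMSEQ_const_iff)
    qed
  qed
  have nn: "(\<integral>\<^sup>+t. ennreal (max 0 (s * H t)) * indicator {x<..} t \<partial>lborel)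
      = ennreal (\<integral>t. indicator {x<..} t * max 0 (s * H t) \<partial>lborel)" for s x
  proof -
    have i: "integrable lborel (\<lambda>t. indicator {x<..} t * max 0 (s * H t))"
      by (rule Bochner_Integration.integrable_bound[of _ "\<lambda>t. s * H t"]) (use iH in \<open>auto split: split_indicator\<close>)
    have "(\<integral>\<^sup>+t. ennreal (max 0 (s * H t)) * indicator {x<..} t \<partial>lborel)
       = (\<integral>\<^sup>+t. ennreal (indicator {x<..} t * max 0 (s * H t)) \<partial>lborel)"
      by (intro nn_integral_cong) (auto split: split_indicator)
    also have "\<dots> = ennreal (\<integral>t. indicator {x<..} t * max 0 (s * H t) \<partial>lborel)"
      by (rule nn_integral_eq_integral[OF i]) auto
    finally show ?thesis .
  qed
  have "density lborel (\<lambda>t. ennreal (max 0 (1 * H t))) = density lborel (\<lambda>t. ennreal (max 0 (-1 * H t)))"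
  proof (rule measure_eqI_lessThan)
    fix x
    have i: "integrable lborel (\<lambda>t. indicator {x<..} t * max 0 (s * H t))" for s
      by (rule Bochner_Integration.integrable_bound[of _ "\<lambda>t. s * H t"]) (use iH in \<open>auto split: split_indicator\<close>)
    have "(\<integral>t. indicator {x<..} t * max 0 (1 * H t) \<partial>lborel) - (\<integral>t. indicator {x<..} t * max 0 (-1 * H t) \<partial>lborel)
       = (\<integral>t. indicator {x<..} t * max 0 (1 * H t) - indicator {x<..} t * max 0 (-1 * H t) \<partial>lborel)"
      by (rule Bochner_Integration.integral_diff[symmetric]) (rule i)+
    also have "\<dots> = (\<integral>t. indicator {x<..} t * H t \<partial>lborel)"
      by (rule Bochner_Integration.integral_cong) (auto simp: indicator_def max_def)
    finally have "(\<integral>t. indicator {x<..} t * max 0 (1 * H t) \<partial>lborel) - (\<integral>t. indicator {x<..} t * max 0 (-1 * H t) \<partial>lborel)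
       = (\<integral>t. indicator {x<..} t * H t \<partial>lborel)" .
    then have "(\<integral>t. indicator {x<..} t * max 0 (1 * H t) \<partial>lborel) = (\<integral>t. indicator {x<..} t * max 0 (-1 * H t) \<partial>lborel)"
      using tail[of x] by simp
    then show "emeasure (density lborel (\<lambda>t. ennreal (max 0 (1 * H t)))) {x<..}
       = emeasure (density lborel (\<lambda>t. ennreal (max 0 (-1 * H t)))) {x<..}"
      by (subst (1 2) emeasure_density) (simp_all only: nn, auto)
    show "emeasure (density lborel (\<lambda>t. ennreal (max 0 (1 * H t)))) {x<..} < \<infinity>"
      by (subst emeasure_density) (simp_all only: nn, auto)
  qed auto
  then have "AE t in lborel. ennreal (max 0 (1 * H t)) = ennreal (max 0 (-1 * H t))"
    by (subst (asm) sigma_finite_measure.density_unique_iff[OF lborel.sigma_finite_measure_axioms]) auto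
  then have "AE t in lborel. t \<in> {0<..<1} \<longrightarrow> h t = 0"
  proof eventually_elim
    case (elim t)
    then have "max 0 (1 * H t) = max 0 (-1 * H t)" by simp
    then have "H t = 0" by (auto simp: max_def split: if_splits)
    then show ?case by (auto simp: H_def)
  qed
  then show ?thesis unfolding leb01_def by (subst AE_restrict_space_iff) auto
qed

section \<open>Dyadic characterization of H1 and of the Dirichlet integral\<close>

lemma weak_deriv_unique:
  assumes f: "continuous_on {0..1} f" and g: "in_L2 leb01 g" "is_weak_deriv f g"
    and g': "in_L2 leb01 g'" "is_weak_deriv f g'"
  shows "AE t in leb01. g t = g' t"
proof -
  note int = in_L2_integrable[OF leb01.finite_measure_axioms]
  have "AE t in leb01. g t - g' t = 0"
  proof (rule integral_intervals_zero_AE)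
    show "integrable leb01 (\<lambda>t. g t - g' t)" using int[OF g(1)] int[OF g'(1)] by auto
    fix a b :: real assume ab: "0 < a" "a < b" "b < 1"
    have i: "integrable leb01 (\<lambda>t. indicator {a<..<b} t * g t)" if "in_L2 leb01 g" for g
      by (rule Bochner_Integration.integrable_bound[OF int[OF that]])
        (use that in \<open>auto simp: in_L2_def split: split_indicator\<close>)
    show "(\<integral>t. indicator {a<..<b} t * (g t - g' t) \<partial>leb01) = 0"
      using weak_deriv_FTC[OF f g ab] weak_deriv_FTC[OF f g' ab] i[OF g(1)] i[OF g'(1)]
      by (simp add: right_diff_distrib)
  qed
  then show ?thesis by simp
qed

theorem in_H1_iff_SB_bounded:
  assumes f: "continuous_on {0..1} f"
  shows "in_H1 f \<longleftrightarrow> (\<exists>c. \<forall>N. SB N f f \<le> c)"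
proof
  assume "in_H1 f"
  then show "\<exists>c. \<forall>N. SB N f f \<le> c"
    using SB_le_weak_deriv[OF f] by (auto simp: in_H1_def)
next
  assume "\<exists>c. \<forall>N. SB N f f \<le> c"
  then obtain c where c: "\<And>N. SB N f f \<le> c" by blast
  obtain g where g: "in_L2 leb01 g" "is_weak_deriv f g"
    using weak_deriv_exists[OF f c] by metis
  obtain C where C: "\<And>t. t \<in> {0..1} \<Longrightarrow> \<bar>f t\<bar> \<le> C" using continuous_bounded_01[OF f] by blast
  have "in_L2 leb01 f"
    by (rule in_L2_bounded[OF leb01.finite_measure_axioms
          borel_measurable_leb01_continuous[OF continuous_on_subset[OF f]], of C]) (use C in auto)
  with g show "in_H1 f" by (auto simp: in_H1_def)
qed

text \<open>Makes the edge integrals of the energy increasing limits of finite sums of point values.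
  As \<open>weak_deriv\<close> is an arbitrary choice, it is compared almost everywhere with the
  limit \<open>g\<close> of the difference quotients, whose norm is controlled.\<close>

theorem nn_integral_weak_deriv_eq_SUP:
  assumes f: "continuous_on {0..1} f" and H: "in_H1 f"
  shows "(\<integral>\<^sup>+t. ennreal ((weak_deriv f t)\<^sup>2) \<partial>leb01) = (SUP N. ennreal (SB N f f))"
proof -
  obtain c where c: "\<And>N. SB N f f \<le> c" using H in_H1_iff_SB_bounded[OF f] by blast
  then have bdd: "bdd_above (range (\<lambda>N. SB N f f))" by (auto simp: bdd_above_def)
  define S where "S = (SUP N. SB N f f)"
  have S: "SB N f f \<le> S" for N unfolding S_def using bdd by (rule cSUP_upper2) auto
  have w: "in_L2 leb01 (weak_deriv f) \<and> is_weak_deriv f (weak_deriv f)"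
    unfolding weak_deriv_def using H someI_ex unfolding in_H1_def by (metis (mono_tags, lifting))
  obtain g where g: "in_L2 leb01 g" "is_weak_deriv f g" "(\<integral>t. (g t)\<^sup>2 \<partial>leb01) \<le> S"
    using weak_deriv_exists[OF f S] by metis
  have ae: "AE t in leb01. (weak_deriv f t)\<^sup>2 = (g t)\<^sup>2"
    using weak_deriv_unique[OF f conjunct1[OF w] conjunct2[OF w] g(1,2)] by eventually_elim simp
  have int: "integrable leb01 (\<lambda>t. (weak_deriv f t)\<^sup>2)" "integrable leb01 (\<lambda>t. (g t)\<^sup>2)"
    using w g by (auto simp: in_L2_def)
  have "(\<integral>t. (weak_deriv f t)\<^sup>2 \<partial>leb01) = (\<integral>t. (g t)\<^sup>2 \<partial>leb01)"
    using ae int by (intro integral_cong_AE) auto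
  then have le: "(\<integral>t. (weak_deriv f t)\<^sup>2 \<partial>leb01) \<le> S" using g by simp
  have ge: "S \<le> (\<integral>t. (weak_deriv f t)\<^sup>2 \<partial>leb01)"
    unfolding S_def using SB_le_weak_deriv[OF f] w by (intro cSUP_least) auto
  have "(\<integral>\<^sup>+t. ennreal ((weak_deriv f t)\<^sup>2) \<partial>leb01) = ennreal (\<integral>t. (weak_deriv f t)\<^sup>2 \<partial>leb01)"
    by (rule nn_integral_eq_integral[OF int(1)]) auto
  also have "\<dots> = ennreal S" using le ge by simp
  also have "\<dots> = (SUP N. ennreal (SB N f f))"
  proof (rule antisym)
    show "(SUP N. ennreal (SB N f f)) \<le> ennreal S" by (intro SUP_least ennreal_leI S)
    have "(\<lambda>N. SB N f f) \<longlonglongrightarrow> S" unfolding S_def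
      by (rule LIMSEQ_incseq_SUP[OF bdd]) (auto simp: incseq_def intro: SB_mono)
    then have "(\<lambda>N. ennreal (SB N f f)) \<longlonglongrightarrow> ennreal S" by (intro tendsto_ennrealI)
    then show "ennreal S \<le> (SUP N. ennreal (SB N f f))"
      by (rule LIMSEQ_le_const2) (meson SUP_upper UNIV_I)
  qed
  finally show ?thesis .
qed

text \<open>Bounded dyadic energy controls a Hoelder modulus of exponent 1/2, the source of
  equicontinuity along the connecting edges.\<close>

lemma SB_Holder:
  assumes f: "continuous_on {0..1} f" and c: "\<And>N. SB N f f \<le> c"
    and st: "s \<in> {0..1}" "t \<in> {0..1}"
  shows "(f t - f s)\<^sup>2 \<le> c * \<bar>t - s\<bar>"
proof -
  obtain g where g: "in_L2 leb01 g" "is_weak_deriv f g" "(\<integral>t. (g t)\<^sup>2 \<partial>leb01) \<le> c"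
    using weak_deriv_exists[OF f c] by metis
  have [measurable]: "g \<in> borel_measurable leb01" using g by (auto simp: in_L2_def)
  have ig: "integrable leb01 (\<lambda>t. (g t)\<^sup>2)" using g by (auto simp: in_L2_def)
  have "(f b - f a)\<^sup>2 \<le> c * \<bar>b - a\<bar>" if ab: "0 \<le> a" "a < b" "b \<le> 1" for a b
  proof -
    have "(\<integral>t. indicator {a<..<b} t * (g t)\<^sup>2 \<partial>leb01) \<le> (\<integral>t. (g t)\<^sup>2 \<partial>leb01)"
    proof (rule integral_mono)
      show "integrable leb01 (\<lambda>t. indicator {a<..<b} t * (g t)\<^sup>2)"
        by (rule Bochner_Integration.integrable_bound[OF ig]) (auto split: split_indicator)
    qed (use ig in \<open>auto split: split_indicator\<close>)
    then have "(b - a) * (\<integral>t. indicator {a<..<b} t * (g t)\<^sup>2 \<partial>leb01) \<le> (b - a) * c"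
      using ab g(3) by (intro mult_left_mono) auto
    from order_trans[OF weak_deriv_increment_le[OF f g(1,2) ab] this]
    show ?thesis using ab by (simp add: mult.commute)
  qed
  from this[of s t] this[of t s] show ?thesis
    using st by (cases s t rule: linorder_cases) (auto simp: power2_commute abs_minus_commute)
qed

subsection \<open>Geometry of the gasket\<close>

lemma three_distinct [simp]:
  fixes i :: 3
  shows "i + 1 \<noteq> i" "i + 2 \<noteq> i" "i \<noteq> i + 1" "i \<noteq> i + 2" "i + 1 \<noteq> i + 2" "i + 2 \<noteq> i + 1"
  using exhaust_3[of i] by auto

lemma three_cases:
  fixes i j :: 3
  obtains "j = i" | "j = i + 1" | "j = i + 2"
  using exhaust_3[of i] exhaust_3[of j] by fastforce

lemma UNIV_three: "(UNIV :: 3 set) = {i, i + 1, i + 2}"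
  using three_cases[of _ i] by blast

lemma sum_three: "(\<Sum>j\<in>(UNIV :: 3 set). f j) = f i + f (i + 1) + (f (i + 2) :: 'b :: comm_monoid_add)"
  by (subst UNIV_three[of i]) (simp add: add.assoc)

text \<open>The Gram determinant of \<open>a\<close> and \<open>b\<close> is the square of their 2
  by 2 determinant \<open>D\<close>; hence \<open>D\<close> is nonzero and Cramer's rule
  applies.\<close>

lemma plane_orthogonal_zero:
  fixes y a b :: "real^2"
  assumes "y \<bullet> a = 0" "y \<bullet> b = 0" "(a \<bullet> a) * (b \<bullet> b) \<noteq> (a \<bullet> b)\<^sup>2"
  shows "y = 0"
proof -
  define D where "D = a$1 * b$2 - a$2 * b$1"
  have "(a \<bullet> a) * (b \<bullet> b) - (a \<bullet> b)\<^sup>2 = D\<^sup>2"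
    by (simp add: D_def inner_vec_def sum_2 power2_eq_square algebra_simps)
  then have D: "D \<noteq> 0" using assms(3) by auto
  have e: "y$1 * a$1 + y$2 * a$2 = 0" "y$1 * b$1 + y$2 * b$2 = 0"
    using assms(1,2) by (simp_all add: inner_vec_def sum_2)
  have "y$1 * D = b$2 * (y$1 * a$1 + y$2 * a$2) - a$2 * (y$1 * b$1 + y$2 * b$2)"
    "y$2 * D = a$1 * (y$1 * b$1 + y$2 * b$2) - b$1 * (y$1 * a$1 + y$2 * a$2)"
    by (simp_all add: D_def algebra_simps)
  then have "y$1 * D = 0" "y$2 * D = 0" unfolding e by simp_all
  then show ?thesis using D by (simp add: vec_eq_iff forall_2)
qed

locale gasket =
  fixes \<alpha> :: real and p :: "3 \<Rightarrow> real^2" and K :: "(real^2) set"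
  assumes alpha: "0 < \<alpha>" "\<alpha> < 1" and equilateral: "equilateral p"
    and gasket: "is_stretched_gasket \<alpha> p K"
begin

abbreviation GG :: "3 \<Rightarrow> real^2 \<Rightarrow> real^2" where "GG \<equiv> G \<alpha> p"

abbreviation GW :: "3 list \<Rightarrow> real^2 \<Rightarrow> real^2" where "GW \<equiv> Gw \<alpha> p"

abbreviation X :: "3 list \<Rightarrow> 3 \<Rightarrow> real \<Rightarrow> real^2" where "X \<equiv> xi \<alpha> p"

text \<open>Contraction ratio of the maps \<open>GG i\<close>. That it stays below 1/2 is what
  separates the three cells.\<close>

definition s :: real where "s = (1 - \<alpha>) / 2"

lemma s: "0 < s" "s < 1 / 2"
  using alpha by (auto simp: s_def)

lemma G_eq: "GG i x = (1 - s) *\<^sub>R p i + s *\<^sub>R x"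
  by (simp add: G_def s_def algebra_simps)

lemma K_eq: "K = (\<Union>i. GG i ` K) \<union> (\<Union>i. edge \<alpha> p i)" and compact_K: "compact K" and K_ne: "K \<noteq> {}"
  using gasket by (auto simp: is_stretched_gasket_def)

lemma closed_K: "closed K"
  using compact_K by (rule compact_imp_closed)

definition cen :: "real^2" where "cen = (1/3) *\<^sub>R (p 1 + p 2 + p 3)"

text \<open>The barycentric coordinates with respect to \<open>p\<close>; the formula uses that the inner product of
  \<open>p i - cen\<close> and \<open>p j - cen\<close> is \<open>1/3\<close> for \<open>i = j\<close> and \<open>-1/6\<close> otherwise.\<close>

definition bc :: "3 \<Rightarrow> real^2 \<Rightarrow> real" where
  "bc i x = 1/3 + 2 * ((x - cen) \<bullet> (p i - cen))"

lemma inner_vertices: "i \<noteq> j \<Longrightarrow> p i \<bullet> p i + p j \<bullet> p j - 2 * (p i \<bullet> p j) = 1"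
proof -
  assume "i \<noteq> j"
  then have "dist (p i) (p j) = 1" using equilateral by (auto simp: equilateral_def)
  then have "(p i - p j) \<bullet> (p i - p j) = 1" by (simp add: dist_norm dot_square_norm)
  then show ?thesis by (simp add: inner_diff_left inner_diff_right inner_commute)
qed

text \<open>Only differences of vertices survive the expansion, so the unit side lengths determine
  the value wherever the triangle lies.\<close>

lemma inner_cen: "(p i - cen) \<bullet> (p j - cen) = (if i = j then 1/3 else -1/6)"
proof -
  note e = inner_vertices[of 1 2] inner_vertices[of 1 3] inner_vertices[of 2 3]
  have c: "p i \<bullet> cen = (p i \<bullet> p 1 + p i \<bullet> p 2 + p i \<bullet> p 3) / 3" for i
    by (simp add: cen_def inner_add_right)
  have cc: "cen \<bullet> cen = (cen \<bullet> p 1 + cen \<bullet> p 2 + cen \<bullet> p 3) / 3"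
    by (subst (2) cen_def) (simp add: inner_add_right)
  have "(p i - cen) \<bullet> (p j - cen) = p i \<bullet> p j - p i \<bullet> cen - p j \<bullet> cen + cen \<bullet> cen"
    by (simp add: inner_diff_left inner_diff_right inner_commute)
  also have "cen \<bullet> cen = (p 1 \<bullet> cen + p 2 \<bullet> cen + p 3 \<bullet> cen) / 3"
    unfolding cc by (simp add: inner_commute)
  finally show ?thesis
    using exhaust_3[of i] exhaust_3[of j] e unfolding c by (auto simp: inner_commute field_simps)
qed

lemma bc_vertex: "bc i (p j) = (if i = j then 1 else 0)"
  unfolding bc_def inner_cen by auto

lemma bc_affine: "bc i ((1 - t) *\<^sub>R x + t *\<^sub>R y) = (1 - t) * bc i x + t * bc i y"
proof -
  have "(1 - t) *\<^sub>R x + t *\<^sub>R y - cen = (1 - t) *\<^sub>R (x - cen) + t *\<^sub>R (y - cen)"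
    by (simp add: algebra_simps)
  then show ?thesis by (simp add: bc_def inner_add_left algebra_simps diff_divide_distrib)
qed

lemma sum_centered: "(\<Sum>i\<in>UNIV. p i - cen) = 0"
  by (simp add: sum_3 cen_def vec_eq_iff field_simps)

lemma bc_sum: "(\<Sum>i\<in>UNIV. bc i x) = 1"
proof -
  have "(\<Sum>i\<in>UNIV. bc i x) = 1 + 2 * ((x - cen) \<bullet> (\<Sum>i\<in>UNIV. p i - cen))"
    by (simp add: bc_def sum.distrib sum_distrib_left inner_sum_right)
  then show ?thesis by (simp add: sum_centered)
qed

text \<open>The defect \<open>y\<close> is orthogonal to two centred vertices, and these are
  linearly independent by the computed Gram matrix.\<close>

lemma bary: "(\<Sum>i\<in>UNIV. bc i x *\<^sub>R p i) = x"
proof -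
  define y where "y = (\<Sum>i\<in>UNIV. bc i x *\<^sub>R p i) - x"
  have "(\<Sum>j\<in>UNIV. bc j x *\<^sub>R p j) = (\<Sum>j\<in>UNIV. bc j x *\<^sub>R (p j - cen)) + (\<Sum>j\<in>UNIV. bc j x) *\<^sub>R cen"
    by (simp add: sum.distrib[symmetric] scaleR_sum_left algebra_simps)
  then have y: "y = (\<Sum>j\<in>UNIV. bc j x *\<^sub>R (p j - cen)) - (x - cen)"
    by (simp add: y_def bc_sum)
  have orth: "y \<bullet> (p i - cen) = 0" for i
  proof -
    have "y \<bullet> (p i - cen) = (\<Sum>j\<in>UNIV. bc j x * ((p j - cen) \<bullet> (p i - cen))) - (x - cen) \<bullet> (p i - cen)"
      by (simp add: y inner_diff_left[of _ "x - cen"] inner_sum_left)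
    also have "(\<Sum>j\<in>UNIV. bc j x * ((p j - cen) \<bullet> (p i - cen)))
        = bc i x / 3 - bc (i + 1) x / 6 - bc (i + 2) x / 6"
      by (simp add: sum_three[of _ i] inner_cen)
    also have "\<dots> = bc i x / 2 - (\<Sum>j\<in>UNIV. bc j x) / 6"
      by (simp add: sum_three[of _ i] field_simps)
    also have "\<dots> = (x - cen) \<bullet> (p i - cen)"
      unfolding bc_sum by (simp add: bc_def field_simps)
    finally show ?thesis by simp
  qed
  have "y = 0"
    by (rule plane_orthogonal_zero[OF orth[of 1] orth[of 2]])
      (simp only: inner_cen, simp add: power2_eq_square)
  then show ?thesis by (simp add: y_def)
qed

lemma continuous_bc [continuous_intros]:
  "continuous_on A f \<Longrightarrow> continuous_on A (\<lambda>x. bc i (f x))"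
  unfolding bc_def by (intro continuous_intros)

lemma bc_G: "bc i (GG j x) = s * bc i x + (if i = j then 1 - s else 0)"
  unfolding G_eq bc_affine bc_vertex by auto

lemma X_Cons: "X (j # w) i t = GG j (X w i t)"
  by (simp add: xi_def)

lemma X_conv: "X w i t = GW w (X [] i t)"
  by (simp add: xi_def)

text \<open>The edge \<open>i\<close> lies on the side opposite to \<open>p i\<close>; along it the
  other two coordinates move linearly between \<open>1 - s\<close> and \<open>s\<close>.\<close>

lemma bc_X:
  "bc i (X [] i t) = 0"
  "bc (i + 1) (X [] i t) = (1 - t) * (1 - s) + t * s"
  "bc (i + 2) (X [] i t) = (1 - t) * s + t * (1 - s)"
  unfolding xi_def by (simp_all add: bc_affine bc_G bc_vertex)

lemma G_inj: "GG i x = GG i y \<longleftrightarrow> x = y"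
  using s by (simp add: G_eq)

lemma dist_G: "dist (GG i x) (GG i y) = s * dist x y"
  using s by (simp add: G_eq dist_norm flip: scaleR_diff_right)

lemma G_fix: "GG i (p i) = p i"
  by (simp add: G_def)

lemma continuous_G: "continuous_on A (GG i)"
  unfolding G_def[abs_def] by (intro continuous_intros)

lemma continuous_X: "continuous_on A (X w i)"
proof (induction w)
  case Nil
  show ?case unfolding xi_def[abs_def] by (simp, intro continuous_intros)
next
  case (Cons j w)
  show ?case unfolding X_Cons[abs_def]
    by (rule continuous_on_compose2[OF continuous_G Cons]) auto
qed

lemma G_in_K: "x \<in> K \<Longrightarrow> GG i x \<in> K"
  by (subst K_eq) auto

lemma GW_in_K: "x \<in> K \<Longrightarrow> GW w x \<in> K"
  by (induction w) (auto intro: G_in_K)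

lemma edge_endpoints_distinct: "GG (i + 1) (p (i + 2)) \<noteq> GG (i + 2) (p (i + 1))"
proof
  assume "GG (i + 1) (p (i + 2)) = GG (i + 2) (p (i + 1))"
  then have "bc (i + 1) (GG (i + 1) (p (i + 2))) = bc (i + 1) (GG (i + 2) (p (i + 1)))" by simp
  then show False using s by (simp add: bc_G bc_vertex)
qed

lemma edge_eq: "edge \<alpha> p i = X [] i ` {0<..<1}"
  using edge_endpoints_distinct[of i] by (auto simp: edge_def open_segment_image_interval xi_def)

text \<open>\<open>p i\<close> is the fixed point of \<open>GG i\<close>, hence the limit of the
  iterates of any point of the closed set \<open>K\<close>.\<close>

lemma vertex_in_K: "p i \<in> K"
proof -
  obtain x where x: "x \<in> K" using K_ne by blast
  have "((GG i) ^^ m) x \<in> K \<and> dist (((GG i) ^^ m) x) (p i) = s ^ m * dist x (p i)" for m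
  proof (induction m)
    case (Suc m)
    then show ?case using dist_G[of i _ "p i"] by (auto simp: G_fix intro: G_in_K)
  qed (use x in simp)
  then have m: "\<And>m. ((GG i) ^^ m) x \<in> K" "\<And>m. dist (((GG i) ^^ m) x) (p i) = s ^ m * dist x (p i)" by auto
  have "(\<lambda>m. s ^ m * dist x (p i)) \<longlonglongrightarrow> 0 * dist x (p i)"
    by (intro tendsto_intros LIMSEQ_realpow_zero) (use s in auto)
  then have "(\<lambda>m. ((GG i) ^^ m) x) \<longlonglongrightarrow> p i"
    by (subst tendsto_dist_iff) (simp add: m(2))
  then show ?thesis by (rule closed_sequentially[OF closed_K m(1)])
qed

lemma X_endpoints: "X [] i 0 = GG (i + 1) (p (i + 2))" "X [] i 1 = GG (i + 2) (p (i + 1))"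
  by (simp_all add: xi_def)

lemma X0_in_K: "t \<in> {0..1} \<Longrightarrow> X [] i t \<in> K"
proof -
  assume t: "t \<in> {0..1}"
  consider "t = 0" | "t = 1" | "t \<in> {0<..<1}" using t by fastforce
  then show ?thesis
  proof cases
    case 3
    then have "X [] i t \<in> edge \<alpha> p i" by (simp add: edge_eq)
    then show ?thesis using K_eq by blast
  qed (simp_all add: X_endpoints G_in_K vertex_in_K)
qed

lemma X_in_K: "t \<in> {0..1} \<Longrightarrow> X w i t \<in> K"
  by (subst X_conv) (intro GW_in_K X0_in_K)

lemma K_cases:
  assumes "x \<in> K"
  obtains (cell) i y where "y \<in> K" "x = GG i y" | (edge) i t where "t \<in> {0<..<1}" "x = X [] i t"
  using assms by (subst (asm) K_eq) (auto simp: edge_eq)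

text \<open>Closing the edges adds only corners of cells and yields a finite cover by compact sets,
  suited to gluing continuous functions.\<close>

lemma K_cover: "K = (\<Union>i. GG i ` K) \<union> (\<Union>i. X [] i ` {0..1})"
proof
  show "K \<subseteq> (\<Union>i. GG i ` K) \<union> (\<Union>i. X [] i ` {0..1})"
  proof
    fix x assume "x \<in> K"
    then show "x \<in> (\<Union>i. GG i ` K) \<union> (\<Union>i. X [] i ` {0..1})"
    proof (cases rule: K_cases)
      case (edge i t)
      then have "x \<in> X [] i ` {0..1}" by auto
      then show ?thesis by blast
    qed blast
  qed
  show "(\<Union>i. GG i ` K) \<union> (\<Union>i. X [] i ` {0..1}) \<subseteq> K"
    using G_in_K X0_in_K by blast
qed

text \<open>A minimum principle: at a minimizer in a cell, self-similarity gives
  \<open>s * bc i z \<le> bc i z\<close>, which excludes a negative minimum; on an edge the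
  coordinates are explicit.\<close>

lemma K_bc_nonneg:
  assumes "x \<in> K"
  shows "0 \<le> bc i x"
proof -
  obtain z where z: "z \<in> K" "\<And>y. y \<in> K \<Longrightarrow> bc i z \<le> bc i y"
    using continuous_attains_inf[OF compact_K K_ne continuous_bc[OF continuous_on_id], of i] by auto
  have "0 \<le> bc i z"
    using z(1)
  proof (cases rule: K_cases)
    case (cell j y)
    have "s * bc i z \<le> s * bc i y" using z(2)[OF cell(1)] s by simp
    also have "\<dots> \<le> bc i z" using s by (simp add: cell bc_G)
    finally have "0 \<le> (1 - s) * bc i z" by (simp add: algebra_simps)
    then show ?thesis using s by (simp add: zero_le_mult_iff)
  next
    case (edge j t)
    then show ?thesis using s
      by (cases i rule: three_cases[of _ j]) (auto simp: bc_X)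
  qed
  then show ?thesis using z(2)[OF assms] by simp
qed

lemma bc_cell: "x \<in> K \<Longrightarrow> 1 - s \<le> bc i (GG i x)"
  using K_bc_nonneg[of x i] s by (simp add: bc_G)

lemma bc_le_one: "x \<in> K \<Longrightarrow> bc i x \<le> 1"
  using bc_sum[of x] K_bc_nonneg[of x] by (simp add: sum_three[of _ i]) (smt (verit))

text \<open>On cell \<open>i\<close> the coordinate \<open>bc i\<close> is at least
  \<open>1 - s\<close>, on the other cells at most \<open>s\<close>, and
  \<open>s < 1 - s\<close>.\<close>

lemma cells_disjoint:
  assumes "x \<in> K" "y \<in> K" "GG i x = GG j y"
  shows "i = j" "x = y"
proof -
  show "i = j"
  proof (rule ccontr)
    assume "i \<noteq> j"
    then have "bc i (GG j y) = s * bc i y" by (simp add: bc_G)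
    also have "\<dots> \<le> s" using bc_le_one[OF assms(2), of i] s by (simp add: mult_left_le)
    finally show False using bc_cell[OF assms(1), of i] assms(3) s by simp
  qed
  then show "x = y" using assms(3) by (simp add: G_inj)
qed

text \<open>On an open edge every coordinate stays strictly below \<open>1 - s\<close>, whereas
  \<open>bc j\<close> is at least \<open>1 - s\<close> on cell \<open>j\<close>.\<close>

lemma edge_cell_disjoint:
  assumes "t \<in> {0<..<1}" "x \<in> K"
  shows "X [] i t \<noteq> GG j x"
proof
  assume e: "X [] i t = GG j x"
  have a: "(1 - t) * (1 - s) + t * s < 1 - s"
    using mult_strict_left_mono[of s "1 - s" t] assms s by (simp add: algebra_simps)
  have b: "(1 - t) * s + t * (1 - s) < 1 - s"
    using mult_strict_left_mono[of s "1 - s" "1 - t"] assms s by (simp add: algebra_simps)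
  have "1 - s \<le> bc j (X [] i t)" using bc_cell[OF assms(2), of j] e by simp
  then show False using a b s by (cases j rule: three_cases[of _ i]) (auto simp: bc_X)
qed

lemma X0_inj:
  assumes "t \<in> {0<..<1}" "t' \<in> {0<..<1}" "X [] i t = X [] j t'"
  shows "i = j" "t = t'"
proof -
  have pos: "0 < bc j (X [] i t)" if "t \<in> {0<..<1}" "j \<noteq> i" for i j t
    using that s by (cases j rule: three_cases[of _ i]) (auto simp: bc_X intro!: add_pos_pos)
  show ij: "i = j"
  proof (rule ccontr)
    assume "i \<noteq> j"
    then have "0 < bc i (X [] j t')" using pos[OF assms(2)] by blast
    then show False using assms(3) bc_X(1)[of i t] by simp
  qed
  have "(1 - t) * (1 - s) + t * s = (1 - t') * (1 - s) + t' * s"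
    using arg_cong[OF assms(3), of "bc (i + 1)"] ij by (simp add: bc_X)
  then have "(t - t') * (1 - 2 * s) = 0" by (simp add: algebra_simps)
  then show "t = t'" using s by simp
qed

text \<open>Common first letters are peeled off; different first letters lead to disjoint cells, and
  an exhausted word to an open edge, which meets no cell.\<close>

lemma X_inj:
  assumes "t \<in> {0<..<1}" "t' \<in> {0<..<1}" "X w i t = X w' j t'"
  shows "w = w' \<and> i = j \<and> t = t'"
  using assms(3)
proof (induction w arbitrary: w')
  case Nil
  show ?case
  proof (cases w')
    case Nil
    then show ?thesis using X0_inj[OF assms(1,2)] \<open>X [] i t = X w' j t'\<close> by simp
  next
    case (Cons k v)
    then show ?thesis
      using \<open>X [] i t = X w' j t'\<close> edge_cell_disjoint[OF assms(1) X_in_K] assms(2) by (auto simp: X_Cons)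
  qed
next
  case (Cons k v)
  show ?case
  proof (cases w')
    case Nil
    then show ?thesis
      using Cons.prems edge_cell_disjoint[OF assms(2), of "X v i t" j k] X_in_K[of t v i] assms(1)
      by (auto simp: X_Cons)
  next
    case (Cons k' v')
    have "GG k (X v i t) = GG k' (X v' j t')" using Cons.prems Cons by (simp add: X_Cons)
    moreover have "X v i t \<in> K" "X v' j t' \<in> K" using assms by (auto intro: X_in_K)
    ultimately have "k = k'" "X v i t = X v' j t'" using cells_disjoint by blast+
    then show ?thesis using Cons.IH Cons by simp
  qed
qed

lemma GW_inj:
  assumes "x \<in> K" "y \<in> K" "length w = length w'" "GW w x = GW w' y"
  shows "w = w' \<and> x = y"
  using assms(3,4)
proof (induction w w' rule: list_induct2)
  case (Cons i w j w')
  then have "GG i (GW w x) = GG j (GW w' y)" by simp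
  then have "i = j" "GW w x = GW w' y"
    using cells_disjoint[OF GW_in_K[OF assms(1)] GW_in_K[OF assms(2)]] by blast+
  then show ?case using Cons by simp
qed simp

lemma dist_GW: "dist (GW w x) (GW w y) = s ^ length w * dist x y"
  by (induction w) (auto simp: dist_G)

lemma continuous_GW: "continuous_on A (GW w)"
proof (induction w)
  case (Cons i w)
  show ?case using continuous_on_compose[OF Cons continuous_G] by simp
qed (simp add: continuous_on_id')

subsection \<open>The symmetries of the gasket\<close>

text \<open>The affine map sending each vertex \<open>p i\<close> to \<open>p (\<pi> i)\<close>;
  barycentric coordinates give all symmetries of the triangle without choosing a frame.\<close>

definition symm :: "(3 \<Rightarrow> 3) \<Rightarrow> real^2 \<Rightarrow> real^2" where
  "symm \<pi> x = (\<Sum>i\<in>UNIV. bc i x *\<^sub>R p (\<pi> i))"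

lemma continuous_symm: "continuous_on A (symm \<pi>)"
  unfolding symm_def[abs_def] by (intro continuous_intros)

lemma symm_affine: "symm \<pi> ((1 - t) *\<^sub>R x + t *\<^sub>R y) = (1 - t) *\<^sub>R symm \<pi> x + t *\<^sub>R symm \<pi> y"
  by (simp add: symm_def bc_affine scaleR_left_distrib sum.distrib scaleR_sum_right)

lemma symm_vertex: "symm \<pi> (p i) = p (\<pi> i)"
proof -
  have "symm \<pi> (p i) = (\<Sum>j\<in>UNIV. if j = i then p (\<pi> j) else 0)"
    unfolding symm_def bc_vertex by (intro sum.cong) auto
  then show ?thesis by simp
qed

lemma symm_G: "symm \<pi> (GG j x) = GG (\<pi> j) (symm \<pi> x)"
  by (simp add: G_eq symm_affine symm_vertex)

lemma bc_symm:
  assumes "\<pi> permutes UNIV"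
  shows "bc (\<pi> i) (symm \<pi> x) = bc i x"
proof -
  have inj: "\<pi> i = \<pi> j \<longleftrightarrow> i = j" for i j using permutes_inj[OF assms] by (auto simp: inj_def)
  have "bc k (symm \<pi> x) = (\<Sum>j\<in>UNIV. bc j x * bc k (p (\<pi> j)))" for k
  proof -
    have "symm \<pi> x - cen = (\<Sum>j\<in>UNIV. bc j x *\<^sub>R (p (\<pi> j) - cen))"
      by (simp add: symm_def scaleR_diff_right sum_subtractf bc_sum flip: scaleR_sum_left)
    then have "bc k (symm \<pi> x) = (\<Sum>j\<in>UNIV. bc j x) * (1/3) + 2 * (\<Sum>j\<in>UNIV. bc j x * ((p (\<pi> j) - cen) \<bullet> (p k - cen)))"
      by (simp add: bc_def[of k] bc_sum inner_sum_left)
    also have "\<dots> = (\<Sum>j\<in>UNIV. bc j x * bc k (p (\<pi> j)))"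
      unfolding bc_def[of k] by (simp add: distrib_left sum.distrib sum_distrib_left sum_distrib_right mult_ac)
    finally show ?thesis .
  qed
  then have "bc (\<pi> i) (symm \<pi> x) = (\<Sum>j\<in>UNIV. bc j x * bc (\<pi> i) (p (\<pi> j)))" .
  also have "\<dots> = (\<Sum>j\<in>UNIV. if j = i then bc j x else 0)"
    by (intro sum.cong) (auto simp: bc_vertex inj)
  finally have "bc (\<pi> i) (symm \<pi> x) = (\<Sum>j\<in>UNIV. if j = i then bc j x else 0)" .
  then show ?thesis by simp
qed

lemma symm_comp:
  assumes "\<tau> permutes UNIV"
  shows "symm \<pi> (symm \<tau> x) = symm (\<pi> \<circ> \<tau>) x"
proof -
  have "symm \<pi> (symm \<tau> x) = (\<Sum>i\<in>UNIV. bc (\<tau> i) (symm \<tau> x) *\<^sub>R p (\<pi> (\<tau> i)))"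
    unfolding symm_def[of \<pi> "symm \<tau> x"]
    by (rule sum.reindex_bij_betw[symmetric]) (rule permutes_imp_bij[OF assms])
  then show ?thesis unfolding bc_symm[OF assms] by (simp add: symm_def)
qed

lemma symm_id: "symm id x = x"
  by (simp add: symm_def bary)

lemma symm_inv:
  assumes "\<pi> permutes UNIV"
  shows "symm (inv \<pi>) (symm \<pi> x) = x" "symm \<pi> (symm (inv \<pi>) x) = x"
  using assms by (simp_all add: symm_comp permutes_inv permutes_inv_o symm_id)

lemma perm_three:
  fixes \<pi> :: "3 \<Rightarrow> 3"
  assumes "\<pi> permutes UNIV"
  shows "\<pi> (i + 1) = \<pi> i + 1 \<and> \<pi> (i + 2) = \<pi> i + 2 \<or> \<pi> (i + 1) = \<pi> i + 2 \<and> \<pi> (i + 2) = \<pi> i + 1"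
proof -
  have inj: "inj \<pi>" using permutes_inj[OF assms] .
  have "\<pi> (i + 1) \<noteq> \<pi> i" "\<pi> (i + 2) \<noteq> \<pi> i" "\<pi> (i + 1) \<noteq> \<pi> (i + 2)"
    using injD[OF inj, of "i + 1" i] injD[OF inj, of "i + 2" i] injD[OF inj, of "i + 1" "i + 2"] by auto
  then show ?thesis
    using three_cases[of "\<pi> (i + 1)" "\<pi> i"] three_cases[of "\<pi> (i + 2)" "\<pi> i"] by metis
qed

text \<open>A permutation keeps or reverses the cyclic order of the alphabet, and with it the
  orientation in which the edges are parametrized.\<close>

lemma symm_X0:
  assumes "\<pi> permutes UNIV"
  shows "(\<forall>t. symm \<pi> (X [] i t) = X [] (\<pi> i) t) \<or> (\<forall>t. symm \<pi> (X [] i t) = X [] (\<pi> i) (1 - t))"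
proof -
  have e: "symm \<pi> (X [] i t) = (1 - t) *\<^sub>R GG (\<pi> (i + 1)) (p (\<pi> (i + 2))) + t *\<^sub>R GG (\<pi> (i + 2)) (p (\<pi> (i + 1)))" for t
    by (simp add: xi_def symm_affine symm_G symm_vertex)
  from perm_three[OF assms, of i] show ?thesis
  proof (elim disjE conjE)
    assume "\<pi> (i + 1) = \<pi> i + 1" "\<pi> (i + 2) = \<pi> i + 2"
    then show ?thesis unfolding e by (simp add: xi_def)
  next
    assume "\<pi> (i + 1) = \<pi> i + 2" "\<pi> (i + 2) = \<pi> i + 1"
    then show ?thesis unfolding e by (simp add: xi_def)
  qed
qed

text \<open>Each descent into a cell shrinks the distance from the image point to \<open>K\<close>
  by the factor \<open>s\<close>, and points on edges are mapped to edges. So the distance is zero,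
  and \<open>K\<close> is closed.\<close>

lemma symm_in_K:
  assumes \<pi>: "\<pi> permutes UNIV" and x: "x \<in> K"
  shows "symm \<pi> x \<in> K"
proof -
  have "compact (symm \<pi> ` K)" by (rule compact_continuous_image[OF continuous_symm compact_K])
  then have "bounded (symm \<pi> ` K \<union> K)" using compact_K by (simp add: compact_imp_bounded)
  then obtain C where C: "\<And>x y. x \<in> K \<Longrightarrow> y \<in> K \<Longrightarrow> dist (symm \<pi> x) y \<le> C"
    unfolding bounded_two_points by blast
  have "\<exists>y\<in>K. dist (symm \<pi> x) y \<le> s ^ m * C" if "x \<in> K" for m x
    using that
  proof (induction m arbitrary: x)
    case 0
    then show ?case using C by (intro bexI[of _ x]) auto
  next
    case (Suc m)
    have C0: "0 \<le> C" using C[OF Suc.prems Suc.prems] zero_le_dist order_trans by blast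
    from Suc.prems show ?case
    proof (cases rule: K_cases)
      case (cell j z)
      obtain y where y: "y \<in> K" "dist (symm \<pi> z) y \<le> s ^ m * C" using Suc.IH[OF cell(1)] by blast
      have "dist (symm \<pi> x) (GG (\<pi> j) y) \<le> s ^ Suc m * C"
        using mult_left_mono[OF y(2), of s] s by (simp add: cell symm_G dist_G mult.assoc)
      then show ?thesis using G_in_K[OF y(1)] by blast
    next
      case (edge j t)
      have "symm \<pi> x \<in> K"
        using symm_X0[OF \<pi>, of j] edge by (auto intro!: X0_in_K)
      then show ?thesis using C0 s by (intro bexI[of _ "symm \<pi> x"]) auto
    qed
  qed
  then obtain y where y: "\<And>m. y m \<in> K" "\<And>m. dist (symm \<pi> x) (y m) \<le> s ^ m * C" using x by metis
  have "(\<lambda>m. s ^ m * C) \<longlonglongrightarrow> 0 * C"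
    by (intro tendsto_intros LIMSEQ_realpow_zero) (use s in auto)
  then have l0: "(\<lambda>m. s ^ m * C) \<longlonglongrightarrow> 0" by simp
  have "(\<lambda>m. dist (y m) (symm \<pi> x)) \<longlonglongrightarrow> 0"
    by (rule tendsto_sandwich[OF _ _ tendsto_const l0]) (use y in \<open>auto simp: dist_commute\<close>)
  then have "y \<longlonglongrightarrow> symm \<pi> x" by (subst tendsto_dist_iff)
  then show ?thesis by (rule closed_sequentially[OF closed_K y(1)])
qed

subsection \<open>Transplantation to a cell\<close>

text \<open>Extension by zero of \<open>u\<close> transported to cell \<open>i\<close>; the argument
  of \<open>u\<close> is the inverse of \<open>GG i\<close>, written out.\<close>

definition Tr :: "3 \<Rightarrow> (real^2 \<Rightarrow> real) \<Rightarrow> real^2 \<Rightarrow> real" where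
  "Tr i u x = (if x \<in> GG i ` K then u ((1 / s) *\<^sub>R (x - (1 - s) *\<^sub>R p i)) else 0)"

primrec TW :: "3 list \<Rightarrow> (real^2 \<Rightarrow> real) \<Rightarrow> real^2 \<Rightarrow> real" where
  "TW [] u = u"
| "TW (i # w) u = Tr i (TW w u)"

lemma Tr_G: "x \<in> K \<Longrightarrow> Tr i u (GG j x) = (if j = i then u x else 0)"
  using s cells_disjoint(1)[of x _ j i] unfolding Tr_def by (auto simp: G_eq)

text \<open>Interior points of the edge lie in no cell. The endpoints do, but they are images of
  vertices, where \<open>u\<close> vanishes.\<close>

lemma Tr_X:
  assumes "\<And>i. u (p i) = 0" "t \<in> {0..1}"
  shows "Tr i u (X [] j t) = 0"
proof -
  consider "t = 0" | "t = 1" | "t \<in> {0<..<1}" using assms(2) by fastforce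
  then show ?thesis
  proof cases
    case 3
    then have "X [] j t \<notin> GG i ` K" using edge_cell_disjoint by blast
    then show ?thesis by (simp add: Tr_def)
  qed (simp_all add: X_endpoints Tr_G vertex_in_K assms(1))
qed

lemma Tr_vertex: "(\<And>i. u (p i) = 0) \<Longrightarrow> Tr i u (p j) = 0"
  using Tr_G[OF vertex_in_K, of i u j j] by (simp add: G_fix)

text \<open>Pasting over the finite closed cover of \<open>K\<close> by cells and closed edges.
  Cells and edges touch only at images of vertices, where the transported function is zero as
  well.\<close>

lemma continuous_Tr:
  assumes u: "continuous_on K u" "\<And>i. u (p i) = 0"
  shows "continuous_on K (Tr i u)"
proof -
  have c1: "continuous_on (GG j ` K) (Tr i u)" for j
  proof (cases "j = i")
    case True
    have "continuous_on (GG j ` K) (\<lambda>x. u ((1 / s) *\<^sub>R (x - (1 - s) *\<^sub>R p i)))"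
      by (rule continuous_on_compose2[OF u(1)], intro continuous_intros) (use s True in \<open>auto simp: G_eq\<close>)
    then show ?thesis
      by (rule continuous_on_eq) (use True in \<open>auto simp: Tr_def\<close>)
  next
    case False
    have "continuous_on (GG j ` K) (\<lambda>x. 0 :: real)" by simp
    then show ?thesis by (rule continuous_on_eq) (use False in \<open>auto simp: Tr_G\<close>)
  qed
  have c2: "continuous_on (X [] j ` {0..1}) (Tr i u)" for j
  proof -
    have "continuous_on (X [] j ` {0..1}) (\<lambda>x. 0 :: real)" by simp
    then show ?thesis by (rule continuous_on_eq) (auto simp: Tr_X u)
  qed
  have cl: "closed (GG j ` K)" "closed (X [] j ` {0..1})" for j
    using compact_K by (auto intro!: compact_imp_closed compact_continuous_image continuous_G continuous_X)
  have fin: "finite (UNIV :: 3 set)" by simp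
  have "continuous_on ((\<Union>j. GG j ` K) \<union> (\<Union>j. X [] j ` {0..1})) (Tr i u)"
    by (intro continuous_on_closed_Un continuous_on_closed_Union closed_UN fin ballI cl c1 c2)
  then show ?thesis using K_cover by simp
qed

lemma TW_props:
  assumes u: "continuous_on K u" "\<And>i. u (p i) = 0"
  shows "continuous_on K (TW w u) \<and> (\<forall>i. TW w u (p i) = 0)"
  by (induction w) (use u in \<open>auto intro!: continuous_Tr simp: Tr_vertex\<close>)

text \<open>The empty word is excluded because \<open>TW [] u\<close> is \<open>u\<close> itself,
  whose values off \<open>K\<close> are arbitrary; from one letter on, \<open>Tr\<close> supplies
  the zero.\<close>

lemma TW_outside: "w \<noteq> [] \<Longrightarrow> x \<notin> GW w ` K \<Longrightarrow> TW w u x = 0"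
proof (induction w arbitrary: x)
  case (Cons i w)
  show ?case
  proof (cases "x \<in> GG i ` K")
    case True
    then obtain y where y: "y \<in> K" "x = GG i y" by blast
    then have "y \<notin> GW w ` K" using Cons.prems(2) by auto
    then have "TW w u y = 0" using Cons.IH y(1) by (cases "w = []") auto
    then show ?thesis using y by (simp add: Tr_G)
  qed (simp add: Tr_def)
qed simp

lemma TW_GW: "x \<in> K \<Longrightarrow> TW w u (GW w x) = u x"
  by (induction w) (auto simp: Tr_G GW_in_K)

lemma TW_GW_other:
  assumes "x \<in> K" "length w = length w'" "w \<noteq> w'"
  shows "TW w u (GW w' x) = 0"
proof (rule TW_outside)
  show "w \<noteq> []" using assms by auto
  show "GW w' x \<notin> GW w ` K" using assms GW_inj[of _ x w w'] by (metis imageE)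
qed

end

subsection \<open>Discrete energies\<close>

lemma SB_commute: "SB N f g = SB N g f"
  by (simp add: SB_def mult.commute)

lemma SB_linear: "SB N (\<lambda>t. a * f t + b * g t) h = a * SB N f h + b * SB N g h"
  by (simp add: SB_def dinc_def sum_distrib_left sum.distrib[symmetric] algebra_simps)

lemma SB_cong:
  assumes "\<And>t. t \<in> {0..1} \<Longrightarrow> f t = f' t" "\<And>t. t \<in> {0..1} \<Longrightarrow> g t = g' t"
  shows "SB N f g = SB N f' g'"
proof -
  have "dinc N f i = dinc N f' i \<and> dinc N g i = dinc N g' i" if "i < 2 ^ N" for i
  proof -
    have "real (Suc i) \<le> 2 ^ N" using that
      by (metis Suc_leI of_nat_le_iff of_nat_numeral of_nat_power)
    then have "real (Suc i) / 2 ^ N \<in> {0..1}" "real i / 2 ^ N \<in> {0..1}"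
      using that by (auto simp: field_simps)
    then show ?thesis using assms by (simp add: dinc_def)
  qed
  then show ?thesis unfolding SB_def by (intro sum.cong) auto
qed

lemma SB_zero: "SB N (\<lambda>t. 0) g = 0"
  by (simp add: SB_def dinc_def)

text \<open>Symmetries may reverse an edge, so the form must not see orientation: the reflected
  increments come in reverse order with opposite signs.\<close>

lemma SB_reverse: "SB N (\<lambda>t. f (1 - t)) (\<lambda>t. g (1 - t)) = SB N f g"
proof -
  have d: "dinc N (\<lambda>t. f (1 - t)) i = - dinc N f (2 ^ N - Suc i)" if "i < 2 ^ N" for i f
  proof -
    have "Suc i \<le> 2 ^ N" using that by simp
    then have "1 - real i / 2 ^ N = real (Suc (2 ^ N - Suc i)) / 2 ^ N"
      "1 - real (Suc i) / 2 ^ N = real (2 ^ N - Suc i) / 2 ^ N"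
      by (simp_all add: of_nat_diff field_simps)
    then show ?thesis by (simp add: dinc_def)
  qed
  have "SB N (\<lambda>t. f (1 - t)) (\<lambda>t. g (1 - t))
      = (\<Sum>i<2 ^ N. (\<lambda>j. 2 ^ N * (dinc N f j * dinc N g j)) (2 ^ N - Suc i))"
    unfolding SB_def by (intro sum.cong) (auto simp: d)
  also have "\<dots> = SB N f g" unfolding SB_def by (rule sum.nat_diff_reindex)
  finally show ?thesis .
qed

lemma SB_0: "SB 0 f f = (f 1 - f 0)\<^sup>2"
  by (simp add: SB_def dinc_def power2_eq_square)

text \<open>Completing squares with the currents \<open>j\<close>, \<open>l\<close> of the optimal flow through a triangle.\<close>

lemma triangle_flow:
  fixes r a b j l :: real
  assumes "r > 0"
  shows "2 * (a * j + b * l) - 2 / 3 * r * (j\<^sup>2 + j * l + l\<^sup>2) \<le> (a\<^sup>2 + (a - b)\<^sup>2 + b\<^sup>2) / r"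
proof -
  \<comment> \<open>The potential drops that drive the currents \<open>j\<close> and
    \<open>l\<close> through the triangle, solved from \<open>2 * f - g = r * j\<close> and
    \<open>2 * g - f = r * l\<close>.\<close>
  define f g where "f = r * (2 * j + l) / 3" and "g = r * (j + 2 * l) / 3"
  have "0 \<le> (a - f)\<^sup>2 + ((a - f) - (b - g))\<^sup>2 + (b - g)\<^sup>2" by simp
  also have "\<dots> = (a\<^sup>2 + (a - b)\<^sup>2 + b\<^sup>2) - 2 * (a * (2 * f - g) + b * (2 * g - f)) + (f * (2 * f - g) + g * (2 * g - f))"
    by (simp add: power2_eq_square algebra_simps)
  finally have *: "0 \<le> (a\<^sup>2 + (a - b)\<^sup>2 + b\<^sup>2) - 2 * (a * (2 * f - g) + b * (2 * g - f)) + (f * (2 * f - g) + g * (2 * g - f))" .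
  have fg: "2 * f - g = r * j" "2 * g - f = r * l" by (simp_all add: f_def g_def field_simps)
  from * have "2 * (a * (r * j) + b * (r * l)) - (f * (r * j) + g * (r * l)) \<le> a\<^sup>2 + (a - b)\<^sup>2 + b\<^sup>2"
    unfolding fg by linarith
  also have "2 * (a * (r * j) + b * (r * l)) - (f * (r * j) + g * (r * l))
     = r * (2 * (a * j + b * l) - 2 / 3 * r * (j\<^sup>2 + j * l + l\<^sup>2))"
    by (simp add: f_def g_def power2_eq_square field_simps)
  finally show ?thesis using assms by (simp add: pos_le_divide_eq mult.commute)
qed

text \<open>Completes the square for a single resistor of resistance \<open>\<rho>\<close>; equality
  holds at the Ohmic current \<open>j = e / \<rho>\<close>.\<close>

lemma edge_flow:
  fixes \<rho> e j :: real
  assumes "\<rho> > 0"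
  shows "2 * (e * j) - \<rho> * j\<^sup>2 \<le> e\<^sup>2 / \<rho>"
proof -
  have "0 \<le> (e - \<rho> * j)\<^sup>2" by simp
  then have "\<rho> * (2 * (e * j) - \<rho> * j\<^sup>2) \<le> e\<^sup>2" by (simp add: power2_eq_square algebra_simps)
  then show ?thesis using assms by (simp add: pos_le_divide_eq mult.commute)
qed

text \<open>The network of three triangles joined by three edges has trace \<open>Q\<^sub>0\<close> on its outer vertices
  exactly for matching pairs; the lower bound tests with the flow of the harmonic extension.\<close>

lemma delta_wye:
  fixes r \<rho> :: real
  assumes r: "r > 0" and \<rho>: "\<rho> > 0" and m: "5 / 3 * r + \<rho> = 1"
  shows "(x11 - x22)\<^sup>2 + (x22 - x33)\<^sup>2 + (x33 - x11)\<^sup>2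
    \<le> (((x11 - x12)\<^sup>2 + (x12 - x13)\<^sup>2 + (x13 - x11)\<^sup>2)
      + ((x21 - x22)\<^sup>2 + (x22 - x23)\<^sup>2 + (x23 - x21)\<^sup>2)
      + ((x31 - x32)\<^sup>2 + (x32 - x33)\<^sup>2 + (x33 - x31)\<^sup>2)) / r
     + ((x23 - x32)\<^sup>2 + (x31 - x13)\<^sup>2 + (x12 - x21)\<^sup>2) / \<rho>"
proof -
  \<comment> \<open>Boundary differences serve as currents: \<open>j\<close> runs from corner 1 to
    2, \<open>l\<close> from 2 to 3, \<open>k\<close> from 3 to 1, each through the edge joining the
    two cells.\<close>
  define j l k where "j = x11 - x22" and "l = x22 - x33" and "k = x33 - x11"
  have k: "k = - j - l" by (simp add: j_def l_def k_def)
  have 1: "2 * ((x11 - x12) * j + (x11 - x13) * (- k)) - 2/3 * r * (j\<^sup>2 + j * (- k) + (- k)\<^sup>2)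
     \<le> ((x11 - x12)\<^sup>2 + (x12 - x13)\<^sup>2 + (x13 - x11)\<^sup>2) / r"
    using triangle_flow[OF r, of "x11 - x12" j "x11 - x13" "- k"]
    by (simp add: power2_commute[of x13])
  have 2: "2 * ((x22 - x23) * l + (x22 - x21) * (- j)) - 2/3 * r * (l\<^sup>2 + l * (- j) + (- j)\<^sup>2)
     \<le> ((x21 - x22)\<^sup>2 + (x22 - x23)\<^sup>2 + (x23 - x21)\<^sup>2) / r"
    using triangle_flow[OF r, of "x22 - x23" l "x22 - x21" "- j"]
    by (simp add: power2_commute[of x21] add_ac)
  have 3: "2 * ((x33 - x31) * k + (x33 - x32) * (- l)) - 2/3 * r * (k\<^sup>2 + k * (- l) + (- l)\<^sup>2)
     \<le> ((x31 - x32)\<^sup>2 + (x32 - x33)\<^sup>2 + (x33 - x31)\<^sup>2) / r"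
    using triangle_flow[OF r, of "x33 - x31" k "x33 - x32" "- l"]
    by (simp add: power2_commute[of x32] add_ac)
  have e: "2 * ((x23 - x32) * l) - \<rho> * l\<^sup>2 \<le> (x23 - x32)\<^sup>2 / \<rho>"
    "2 * ((x31 - x13) * k) - \<rho> * k\<^sup>2 \<le> (x31 - x13)\<^sup>2 / \<rho>"
    "2 * ((x12 - x21) * j) - \<rho> * j\<^sup>2 \<le> (x12 - x21)\<^sup>2 / \<rho>"
    by (rule edge_flow[OF \<rho>])+
  have "(x11 - x22)\<^sup>2 + (x22 - x33)\<^sup>2 + (x33 - x11)\<^sup>2 = j\<^sup>2 + l\<^sup>2 + k\<^sup>2"
    by (simp add: j_def l_def k_def)
  also have "\<dots> = (2 * ((x11 - x12) * j + (x11 - x13) * (- k)) - 2/3 * r * (j\<^sup>2 + j * (- k) + (- k)\<^sup>2))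
    + (2 * ((x22 - x23) * l + (x22 - x21) * (- j)) - 2/3 * r * (l\<^sup>2 + l * (- j) + (- j)\<^sup>2))
    + (2 * ((x33 - x31) * k + (x33 - x32) * (- l)) - 2/3 * r * (k\<^sup>2 + k * (- l) + (- l)\<^sup>2))
    + (2 * ((x23 - x32) * l) - \<rho> * l\<^sup>2) + (2 * ((x31 - x13) * k) - \<rho> * k\<^sup>2)
    + (2 * ((x12 - x21) * j) - \<rho> * j\<^sup>2)" (is "_ = ?R")
  proof -
    have "?R = 2 * (j * (x11 - x22) + l * (x22 - x33) + k * (x33 - x11))
      - 2/3 * r * (2 * (j\<^sup>2 + l\<^sup>2 + k\<^sup>2) - j * k - l * j - k * l) - \<rho> * (j\<^sup>2 + l\<^sup>2 + k\<^sup>2)"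
      by (simp add: algebra_simps)
    also have "\<dots> = 2 * (j\<^sup>2 + l\<^sup>2 + k\<^sup>2) - 2/3 * r * (2 * (j\<^sup>2 + l\<^sup>2 + k\<^sup>2) - j * k - l * j - k * l) - \<rho> * (j\<^sup>2 + l\<^sup>2 + k\<^sup>2)"
      by (simp add: j_def[symmetric] l_def[symmetric] k_def[symmetric] power2_eq_square)
    \<comment> \<open>The three differences sum to zero. The resulting factor 5/2 times 2/3 is the
      5/3 of the matching condition.\<close>
    also have "- j * k - l * j - k * l = (j\<^sup>2 + l\<^sup>2 + k\<^sup>2) / 2"
      unfolding k by (simp add: power2_eq_square field_simps)
    then have "2 * (j\<^sup>2 + l\<^sup>2 + k\<^sup>2) - j * k - l * j - k * l = 5/2 * (j\<^sup>2 + l\<^sup>2 + k\<^sup>2)" by simp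
    also have "2 * (j\<^sup>2 + l\<^sup>2 + k\<^sup>2) - 2/3 * r * (5/2 * (j\<^sup>2 + l\<^sup>2 + k\<^sup>2)) - \<rho> * (j\<^sup>2 + l\<^sup>2 + k\<^sup>2)
       = (2 - (5/3 * r + \<rho>)) * (j\<^sup>2 + l\<^sup>2 + k\<^sup>2)" by (simp add: algebra_simps)
    finally show ?thesis unfolding m by simp
  qed
  also have "\<dots> \<le> (((x11 - x12)\<^sup>2 + (x12 - x13)\<^sup>2 + (x13 - x11)\<^sup>2)
      + ((x21 - x22)\<^sup>2 + (x22 - x23)\<^sup>2 + (x23 - x21)\<^sup>2)
      + ((x31 - x32)\<^sup>2 + (x32 - x33)\<^sup>2 + (x33 - x31)\<^sup>2)) / r
     + ((x23 - x32)\<^sup>2 + (x31 - x13)\<^sup>2 + (x12 - x21)\<^sup>2) / \<rho>"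
    unfolding add_divide_distrib using 1 2 3 e unfolding add_divide_distrib by linarith
  finally show ?thesis .
qed

text \<open>The pairs as seen from inside a first-level cell, with the first pair dropped.\<close>

abbreviation sh :: "(nat \<Rightarrow> real) \<Rightarrow> nat \<Rightarrow> real" where "sh r \<equiv> \<lambda>k. r (Suc k)"

lemma matching_sh: "matching_pairs r \<rho> \<Longrightarrow> matching_pairs (sh r) (sh \<rho>)"
  by (auto simp: matching_pairs_def)

lemma matching_1:
  assumes "matching_pairs r \<rho>"
  shows "r 1 > 0" "\<rho> 1 > 0" "5 / 3 * r 1 + \<rho> 1 = 1"
  using assms unfolding matching_pairs_def by blast+

lemma sum_words_Suc:
  "(\<Sum>w\<in>{w :: 3 list. length w = Suc k}. F w) = (\<Sum>i\<in>UNIV. \<Sum>w\<in>{w. length w = k}. F (i # w))"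
proof -
  have "{w :: 3 list. length w = Suc k} = (\<lambda>(i, w). i # w) ` (UNIV \<times> {w. length w = k})"
    by (auto simp: length_Suc_conv)
  moreover have "inj_on (\<lambda>(i, w). i # w) (UNIV \<times> {w :: 3 list. length w = k})"
    by (auto simp: inj_on_def)
  ultimately show ?thesis
    by (simp add: sum.reindex sum.cartesian_product case_prod_unfold)
qed

lemma finite_words: "finite {w :: 3 list. length w = k}"
  using finite_lists_length_eq[of "UNIV :: 3 set" k] by simp

lemma delta_eq: "delta r m = (\<Prod>i<m. r (Suc i))"
  by (simp add: delta_def prod.atLeast1_atMost_eq)

lemma gam_eq: "gam r \<rho> (Suc k) = (\<Prod>i<k. r (Suc i)) * \<rho> (Suc k)"
  by (simp add: gam_def prod.atLeast1_atMost_eq)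

lemma delta_Suc: "delta r (Suc m) = r 1 * delta (sh r) m"
  by (simp add: delta_eq prod.lessThan_Suc_shift del: prod.lessThan_Suc)

lemma gam_Suc: "gam r \<rho> (Suc (Suc k)) = r 1 * gam (sh r) (sh \<rho>) (Suc k)"
  by (simp add: gam_eq prod.lessThan_Suc_shift mult.assoc del: prod.lessThan_Suc)

lemma delta_pos: "matching_pairs r \<rho> \<Longrightarrow> 0 < delta r m"
  by (auto simp: delta_eq matching_pairs_def intro!: prod_pos)

lemma gam_pos: "matching_pairs r \<rho> \<Longrightarrow> 0 < gam r \<rho> (Suc k)"
  by (auto simp: gam_eq matching_pairs_def intro!: mult_pos_pos prod_pos)

context gasket
begin

text \<open>Polarization of \<open>Q0\<close>, summed over ordered pairs and halved, so that
  invariance under permutations of the vertices is a mere reindexing.\<close>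

definition q0 :: "(real^2 \<Rightarrow> real) \<Rightarrow> (real^2 \<Rightarrow> real) \<Rightarrow> real" where
  "q0 u v = (\<Sum>i\<in>UNIV. \<Sum>j\<in>UNIV. (u (p i) - u (p j)) * (v (p i) - v (p j))) / 2"

lemma q0_eq_Q0: "q0 u u = Q0 p u"
  by (simp add: q0_def Q0_def sum_3 power2_eq_square field_simps)

text \<open>The energy form approximated by its levels up to \<open>m\<close>, with every edge integral replaced by
  difference quotients on the dyadic grid of mesh \<open>2\<^sup>-\<^sup>N\<close>. The recursion expresses the
  self-similarity of the form under a shift of the matching pairs.\<close>

primrec BN :: "nat \<Rightarrow> (nat \<Rightarrow> real) \<Rightarrow> (nat \<Rightarrow> real) \<Rightarrow> nat \<Rightarrow> (real^2 \<Rightarrow> real) \<Rightarrow> (real^2 \<Rightarrow> real) \<Rightarrow> real" where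
  "BN 0 = (\<lambda>r \<rho> N u v. q0 u v)"
| "BN (Suc m) = (\<lambda>r \<rho> N u v.
     (\<Sum>i\<in>UNIV. BN m (sh r) (sh \<rho>) N (\<lambda>x. u (GG i x)) (\<lambda>x. v (GG i x))) / r 1
     + (\<Sum>i\<in>UNIV. SB N (\<lambda>t. u (X [] i t)) (\<lambda>t. v (X [] i t))) / \<rho> 1)"

lemma q0_commute: "q0 u v = q0 v u"
  by (simp add: q0_def mult.commute)

lemma BN_commute: "BN m r \<rho> N u v = BN m r \<rho> N v u"
  by (induction m arbitrary: r \<rho> u v) (auto simp: q0_commute SB_commute intro!: arg_cong2[where f = "(+)"])

lemma q0_linear: "q0 (\<lambda>x. a * u x + b * v x) z = a * q0 u z + b * q0 v z"
  by (simp add: q0_def sum_3 algebra_simps add_divide_distrib diff_divide_distrib)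

lemma BN_linear: "BN m r \<rho> N (\<lambda>x. a * u x + b * v x) z = a * BN m r \<rho> N u z + b * BN m r \<rho> N v z"
proof (induction m arbitrary: r \<rho> u v z)
  case (Suc m)
  show ?case
    by (simp add: Suc SB_linear sum.distrib algebra_simps add_divide_distrib
        flip: sum_distrib_left)
qed (simp add: q0_linear)

lemma BN_zero: "BN m r \<rho> N (\<lambda>x. 0) z = 0"
  using BN_linear[of m r \<rho> N 0 "\<lambda>x. 0" 0 "\<lambda>x. 0" z] by simp

lemma BN_add: "BN m r \<rho> N (\<lambda>x. u x + v x) z = BN m r \<rho> N u z + BN m r \<rho> N v z"
  using BN_linear[of m r \<rho> N 1 u 1 v z] by simp

lemma BN_diff: "BN m r \<rho> N (\<lambda>x. u x - v x) z = BN m r \<rho> N u z - BN m r \<rho> N v z"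
  using BN_linear[of m r \<rho> N 1 u "-1" v z] by simp

lemma BN_cmult: "BN m r \<rho> N (\<lambda>x. a * u x) z = a * BN m r \<rho> N u z"
  using BN_linear[of m r \<rho> N a u 0 u z] by simp

lemma BN_sum: "finite S \<Longrightarrow> BN m r \<rho> N (\<lambda>x. \<Sum>k\<in>S. c k * f k x) z = (\<Sum>k\<in>S. c k * BN m r \<rho> N (f k) z)"
  by (induction S rule: finite_induct) (simp_all add: BN_zero BN_add BN_cmult)

lemma BN_add_right: "BN m r \<rho> N z (\<lambda>x. u x + v x) = BN m r \<rho> N z u + BN m r \<rho> N z v"
  using BN_add BN_commute by metis

lemma BN_diff_right: "BN m r \<rho> N z (\<lambda>x. u x - v x) = BN m r \<rho> N z u - BN m r \<rho> N z v"
  using BN_diff BN_commute by metis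

lemma BN_cmult_right: "BN m r \<rho> N z (\<lambda>x. a * u x) = a * BN m r \<rho> N z u"
  using BN_cmult BN_commute by metis

text \<open>Functions live on the whole plane, yet \<open>BN\<close> samples only points of
  \<open>K\<close>.\<close>

lemma BN_cong:
  assumes "\<And>x. x \<in> K \<Longrightarrow> u x = u' x" "\<And>x. x \<in> K \<Longrightarrow> v x = v' x"
  shows "BN m r \<rho> N u v = BN m r \<rho> N u' v'"
  using assms
proof (induction m arbitrary: r \<rho> u u' v v')
  case 0
  then show ?case by (simp add: q0_def vertex_in_K)
next
  case (Suc m)
  have "BN m (sh r) (sh \<rho>) N (\<lambda>x. u (GG i x)) (\<lambda>x. v (GG i x))
      = BN m (sh r) (sh \<rho>) N (\<lambda>x. u' (GG i x)) (\<lambda>x. v' (GG i x))" for i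
    by (rule Suc.IH) (simp_all add: Suc.prems G_in_K)
  moreover have "SB N (\<lambda>t. u (X [] i t)) (\<lambda>t. v (X [] i t)) = SB N (\<lambda>t. u' (X [] i t)) (\<lambda>t. v' (X [] i t))" for i
    by (rule SB_cong) (simp_all add: Suc.prems X_in_K)
  ultimately show ?case by simp
qed

lemma BN_nonneg:
  assumes "matching_pairs r \<rho>"
  shows "0 \<le> BN m r \<rho> N u u"
  using assms
proof (induction m arbitrary: r \<rho> u)
  case 0
  then show ?case by (simp add: q0_eq_Q0 Q0_def)
next
  case (Suc m)
  then show ?case using matching_1[OF Suc.prems]
    by (auto intro!: add_nonneg_nonneg divide_nonneg_pos sum_nonneg Suc.IH matching_sh SB_nonneg)
qed

lemma BN_mono_N:
  assumes "matching_pairs r \<rho>" "N \<le> N'"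
  shows "BN m r \<rho> N u u \<le> BN m r \<rho> N' u u"
  using assms(1)
proof (induction m arbitrary: r \<rho> u)
  case (Suc m)
  then show ?case using matching_1[OF Suc.prems] assms(2)
    by (auto intro!: add_mono divide_right_mono sum_mono Suc.IH matching_sh SB_mono)
qed simp

text \<open>At level 0 this is the network inequality for matching pairs, each edge energy being at
  least its coarsest value, the squared difference of the end values. Higher levels inherit it cell
  by cell with shifted pairs.\<close>

lemma BN_le_Suc:
  assumes "matching_pairs r \<rho>"
  shows "BN m r \<rho> N u u \<le> BN (Suc m) r \<rho> N u u"
  using assms
proof (induction m arbitrary: r \<rho> u)
  case 0
  note m = matching_1[OF 0]
  have e: "(\<lambda>i. (u (X [] i 1) - u (X [] i 0))\<^sup>2) i \<le> SB N (\<lambda>t. u (X [] i t)) (\<lambda>t. u (X [] i t))" for i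
    using SB_mono[of 0 N "\<lambda>t. u (X [] i t)"] by (simp add: SB_0)
  have "q0 u u \<le> (\<Sum>i\<in>UNIV. Q0 p (\<lambda>x. u (GG i x))) / r 1 + (\<Sum>i\<in>UNIV. (u (X [] i 1) - u (X [] i 0))\<^sup>2) / \<rho> 1"
  proof -
    \<comment> \<open>The numerals 4 and 5 arise from \<open>i + 1\<close> and \<open>i + 2\<close>
      and are reduced modulo 3.\<close>
    have wrap: "(4::3) = 1" "(5::3) = 2" by auto
    show ?thesis
      using delta_wye[OF m, of "u (GG 1 (p 1))" "u (GG 2 (p 2))" "u (GG 3 (p 3))"
        "u (GG 1 (p 2))" "u (GG 1 (p 3))" "u (GG 2 (p 1))" "u (GG 2 (p 3))" "u (GG 3 (p 1))" "u (GG 3 (p 2))"]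
      by (simp add: q0_eq_Q0 sum_3 X_endpoints G_fix Q0_def power2_commute wrap)
  qed
  also have "\<dots> \<le> BN (Suc 0) r \<rho> N u u"
    using m e by (auto simp: q0_eq_Q0 intro!: divide_right_mono sum_mono)
  finally show ?case by simp
next
  case (Suc m)
  show ?case using matching_1[OF Suc.prems] Suc.IH[OF matching_sh[OF Suc.prems]]
    by (subst (1 2) BN.simps) (auto intro!: divide_right_mono sum_mono simp del: BN.simps)
qed

lemma BN_mono:
  assumes "matching_pairs r \<rho>" "m \<le> m'" "N \<le> N'"
  shows "BN m r \<rho> N u u \<le> BN m' r \<rho> N' u u"
proof -
  have "BN m r \<rho> N u u \<le> BN m' r \<rho> N u u"
    using assms(2) by (rule lift_Suc_mono_le[of "\<lambda>m. BN m r \<rho> N u u", rotated]) (rule BN_le_Suc[OF assms(1)])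
  then show ?thesis using BN_mono_N[OF assms(1,3), of m' u] by simp
qed

lemma BN_le_diag:
  assumes "matching_pairs r \<rho>"
  shows "BN m r \<rho> N u u \<le> BN (max m N) r \<rho> (max m N) u u"
  by (rule BN_mono[OF assms]) auto

text \<open>Discretization of \<open>DI \<alpha> p (Suc k) u\<close>: edges indexed by words of
  length \<open>k\<close> belong to the term of index \<open>k + 1\<close> in the energy.\<close>

definition edge_sum :: "nat \<Rightarrow> nat \<Rightarrow> (real^2 \<Rightarrow> real) \<Rightarrow> real" where
  "edge_sum k N u = (\<Sum>w\<in>{w. length w = k}. \<Sum>i\<in>UNIV. SB N (\<lambda>t. u (X w i t)) (\<lambda>t. u (X w i t)))"

lemma Q_Suc: "Q \<alpha> p (Suc m) u = (\<Sum>i\<in>UNIV. Q \<alpha> p m (\<lambda>x. u (GG i x)))"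
  by (simp add: Q_def sum_words_Suc o_def)

lemma edge_sum_Suc: "edge_sum (Suc k) N u = (\<Sum>i\<in>UNIV. edge_sum k N (\<lambda>x. u (GG i x)))"
  by (simp add: edge_sum_def sum_words_Suc X_Cons)

text \<open>Unwinding the recursion collects the factors \<open>r 1\<close>, \<open>r 2\<close> and
  so on into \<open>delta\<close> and \<open>gam\<close>, which returns the recursive form to the
  shape of the definition.\<close>

lemma BN_expand:
  "BN m r \<rho> N u u = Q \<alpha> p m u / delta r m + (\<Sum>k<m. edge_sum k N u / gam r \<rho> (Suc k))"
proof (induction m arbitrary: r \<rho> u)
  case 0
  show ?case by (simp add: q0_eq_Q0 Q_def delta_def)
next
  case (Suc m)
  have "(\<Sum>i\<in>UNIV. BN m (sh r) (sh \<rho>) N (\<lambda>x. u (GG i x)) (\<lambda>x. u (GG i x)))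
    = (\<Sum>i\<in>UNIV. Q \<alpha> p m (\<lambda>x. u (GG i x)) / delta (sh r) m)
      + (\<Sum>i\<in>UNIV. \<Sum>k<m. edge_sum k N (\<lambda>x. u (GG i x)) / gam (sh r) (sh \<rho>) (Suc k))"
    by (simp add: Suc sum.distrib)
  also have "(\<Sum>i\<in>UNIV. \<Sum>k<m. edge_sum k N (\<lambda>x. u (GG i x)) / gam (sh r) (sh \<rho>) (Suc k))
    = (\<Sum>k<m. \<Sum>i\<in>UNIV. edge_sum k N (\<lambda>x. u (GG i x)) / gam (sh r) (sh \<rho>) (Suc k))"
    by (rule sum.swap)
  also have "\<dots> = (\<Sum>k<m. edge_sum (Suc k) N u / gam (sh r) (sh \<rho>) (Suc k))"
    by (simp add: edge_sum_Suc sum_divide_distrib)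
  also have "(\<Sum>i\<in>UNIV. Q \<alpha> p m (\<lambda>x. u (GG i x)) / delta (sh r) m) = Q \<alpha> p (Suc m) u / delta (sh r) m"
    by (simp add: Q_Suc sum_divide_distrib)
  finally have "BN (Suc m) r \<rho> N u u = Q \<alpha> p (Suc m) u / delta r (Suc m)
      + (\<Sum>k<m. edge_sum (Suc k) N u / gam (sh r) (sh \<rho>) (Suc k)) / r 1 + edge_sum 0 N u / \<rho> 1"
    by (simp add: add_divide_distrib delta_Suc mult.commute edge_sum_def)
  also have "(\<Sum>k<m. edge_sum (Suc k) N u / gam (sh r) (sh \<rho>) (Suc k)) / r 1
    = (\<Sum>k<m. edge_sum (Suc k) N u / gam r \<rho> (Suc (Suc k)))"
    unfolding sum_divide_distrib by (intro sum.cong) (simp_all add: gam_Suc mult.commute)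
  also have "\<rho> 1 = gam r \<rho> (Suc 0)" by (simp add: gam_eq)
  finally show ?case by (simp add: sum.lessThan_Suc_shift add_ac del: BN.simps sum.lessThan_Suc)
qed

subsection \<open>The energy form as a limit of discrete energies\<close>

lemma continuous_on_X:
  assumes "continuous_on K u"
  shows "continuous_on {0..1} (\<lambda>t. u (X w i t))"
  by (rule continuous_on_compose2[OF assms continuous_X]) (auto intro: X_in_K)

lemma incseq_edge_sum: "incseq (\<lambda>N. edge_sum k N u)"
  by (auto simp: incseq_def edge_sum_def intro!: sum_mono SB_mono)

lemma edge_sum_nonneg: "0 \<le> edge_sum k N u"
  unfolding edge_sum_def by (intro sum_nonneg SB_nonneg)

lemma edge_sum_tendsto_DI:
  assumes u: "continuous_on K u" and H: "\<And>w i. in_H1 (\<lambda>t. u (X w i t))"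
  shows "(\<lambda>N. ennreal (edge_sum k N u)) \<longlonglongrightarrow> DI \<alpha> p (Suc k) u"
proof -
  have "(\<lambda>N. ennreal (SB N (\<lambda>t. u (X w i t)) (\<lambda>t. u (X w i t))))
      \<longlonglongrightarrow> (\<integral>\<^sup>+t. ennreal ((weak_deriv (u \<circ> X w i) t)\<^sup>2) \<partial>leb01)" for w i
    using nn_integral_weak_deriv_eq_SUP[OF continuous_on_X[OF u] H]
    by (auto simp: o_def incseq_def SB_mono ennreal_leI intro!: LIMSEQ_SUP)
  then have "(\<lambda>N. \<Sum>w\<in>{w. length w = k}. \<Sum>i\<in>UNIV. ennreal (SB N (\<lambda>t. u (X w i t)) (\<lambda>t. u (X w i t))))
      \<longlonglongrightarrow> DI \<alpha> p (Suc k) u"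
    unfolding DI_def by (simp, intro tendsto_sum) auto
  then show ?thesis
    by (simp add: edge_sum_def sum_ennreal SB_nonneg sum_nonneg)
qed

text \<open>The triangle terms need not be monotone in the level, but the edge sums \<open>P\<close>
  and the whole of \<open>BN\<close> are. When the edge series \<open>T\<close> is finite, the
  triangle part converges as a difference of limits; when \<open>T\<close> is infinite, both sides
  are.\<close>

lemma energy_eq_SUP:
  assumes m: "matching_pairs r \<rho>" and u: "continuous_on K u" and H: "\<And>w i. in_H1 (\<lambda>t. u (X w i t))"
  shows "energy \<alpha> p r \<rho> u = (SUP m. ennreal (BN m r \<rho> m u u))"
proof -
  define P where "P M N = (\<Sum>k<M. edge_sum k N u / gam r \<rho> (Suc k))" for M N
  define PD where "PD M = (\<Sum>k<M. ennreal (1 / gam r \<rho> (Suc k)) * DI \<alpha> p (Suc k) u)" for M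
  define T where "T = (\<Sum>k. ennreal (1 / gam r \<rho> (Suc k)) * DI \<alpha> p (Suc k) u)"
  define B where "B = (SUP m. ennreal (BN m r \<rho> m u u))"
  note g = gam_pos[OF m]
  have P0: "0 \<le> P M N" for M N
    unfolding P_def using g by (intro sum_nonneg divide_nonneg_pos edge_sum_nonneg)
  have Pmono: "P M N \<le> P M' N'" if "M \<le> M'" "N \<le> N'" for M M' N N'
  proof -
    have "P M N \<le> P M N'"
      unfolding P_def using g incseqD[OF incseq_edge_sum that(2)]
      by (intro sum_mono divide_right_mono) (auto intro: less_imp_le)
    also have "\<dots> \<le> P M' N'"
      unfolding P_def using that g
      by (intro sum_mono2) (auto intro!: divide_nonneg_pos edge_sum_nonneg)
    finally show ?thesis .
  qed
  have PN: "(\<lambda>N. ennreal (P M N)) \<longlonglongrightarrow> PD M" for M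
  proof -
    have "(\<lambda>N. \<Sum>k<M. ennreal (1 / gam r \<rho> (Suc k)) * ennreal (edge_sum k N u)) \<longlonglongrightarrow> PD M"
      unfolding PD_def
      by (intro tendsto_sum ennreal_tendsto_cmult edge_sum_tendsto_DI[OF u H]) simp
    moreover have "(\<Sum>k<M. ennreal (1 / gam r \<rho> (Suc k)) * ennreal (edge_sum k N u)) = ennreal (P M N)" for N
      unfolding P_def
      by (subst sum_ennreal[symmetric])
        (use g in \<open>auto simp: edge_sum_nonneg ennreal_mult' less_imp_le simp flip: ennreal_mult\<close>)
    ultimately show ?thesis by simp
  qed
  have PDT: "PD \<longlonglongrightarrow> T" unfolding PD_def[abs_def] T_def by (rule summable_LIMSEQ) simp
  have PDle: "PD M \<le> T" for M unfolding PD_def T_def by (rule sum_le_suminf) auto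
  have Ple: "ennreal (P M N) \<le> PD M" for M N
    by (rule LIMSEQ_le_const[OF PN]) (auto intro!: exI[of _ N] ennreal_leI Pmono)
  have incP: "incseq (\<lambda>m. ennreal (P m m))" by (auto simp: incseq_def intro!: ennreal_leI Pmono)
  \<comment> \<open>Level and mesh can be sent to their limits together because \<open>P\<close>
    increases in both.\<close>
  have SP: "(SUP m. ennreal (P m m)) = T"
  proof (rule antisym)
    show "(SUP m. ennreal (P m m)) \<le> T" by (intro SUP_least order_trans[OF Ple PDle])
    have "PD M \<le> (SUP m. ennreal (P m m))" for M
    proof (rule LIMSEQ_le_const2[OF PN])
      have "ennreal (P M N) \<le> (SUP m. ennreal (P m m))" for N
        by (rule SUP_upper2[of "max M N"]) (auto intro!: ennreal_leI Pmono)
      then show "\<exists>n0. \<forall>N\<ge>n0. ennreal (P M N) \<le> (SUP m. ennreal (P m m))" by blast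
    qed
    then show "T \<le> (SUP m. ennreal (P m m))"
      by (intro LIMSEQ_le_const2[OF PDT]) blast
  qed
  have PT: "(\<lambda>m. ennreal (P m m)) \<longlonglongrightarrow> T" using LIMSEQ_SUP[OF incP] SP by simp
  have BB: "(\<lambda>m. ennreal (BN m r \<rho> m u u)) \<longlonglongrightarrow> B"
    unfolding B_def by (rule LIMSEQ_SUP) (auto simp: incseq_def intro!: ennreal_leI BN_mono[OF m])
  have Q0: "0 \<le> Q \<alpha> p k u" for k unfolding Q_def Q0_def by (intro sum_nonneg) auto
  have split: "BN k r \<rho> k u u = 1 / delta r k * Q \<alpha> p k u + P k k" for k
    by (simp add: BN_expand P_def)
  have A0: "0 \<le> 1 / delta r k * Q \<alpha> p k u" for k
    using Q0 delta_pos[OF m, of k] by (simp add: less_imp_le)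
  have TB: "T \<le> B"
    by (rule LIMSEQ_le[OF PT BB]) (use A0 in \<open>auto simp: split intro!: ennreal_leI\<close>)
  have "energy \<alpha> p r \<rho> u = B"
  proof (cases "T = \<infinity>")
    case True
    then show ?thesis using TB unfolding energy_def T_def by (simp add: top_unique)
  next
    case False
    have "(\<lambda>k. ennreal (BN k r \<rho> k u u) - ennreal (P k k)) \<longlonglongrightarrow> B - T"
      by (rule tendsto_diff_ennreal_general[OF BB PT]) (use False in simp)
    moreover have "ennreal (BN k r \<rho> k u u) - ennreal (P k k) = ennreal (1 / delta r k * Q \<alpha> p k u)" for k
      unfolding split using A0 P0 by (simp add: ennreal_minus)
    ultimately have "lim (\<lambda>k. ennreal (1 / delta r k * Q \<alpha> p k u)) = B - T"
      by (intro limI) simp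
    then show ?thesis unfolding energy_def T_def[symmetric]
      using TB by (simp add: diff_add_cancel_ennreal)
  qed
  then show ?thesis by (simp add: B_def)
qed

section \<open>Domain and energy as suprema of the discrete forms\<close>

definition bndd :: "(nat \<Rightarrow> real) \<Rightarrow> (nat \<Rightarrow> real) \<Rightarrow> (real^2 \<Rightarrow> real) \<Rightarrow> bool" where
  "bndd r \<rho> u \<longleftrightarrow> (\<exists>c. \<forall>m N. BN m r \<rho> N u u \<le> c)"

definition EN :: "(nat \<Rightarrow> real) \<Rightarrow> (nat \<Rightarrow> real) \<Rightarrow> (real^2 \<Rightarrow> real) \<Rightarrow> real" where
  "EN r \<rho> u = (SUP m. BN m r \<rho> m u u)"

definition DOM :: "(nat \<Rightarrow> real) \<Rightarrow> (nat \<Rightarrow> real) \<Rightarrow> (real^2 \<Rightarrow> real) set" where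
  "DOM r \<rho> = {u. continuous_on K u \<and> bndd r \<rho> u}"

lemma bndd_bdd_above: "bndd r \<rho> u \<Longrightarrow> bdd_above (range (\<lambda>m. BN m r \<rho> m u u))"
  by (auto simp: bndd_def bdd_above_def)

lemma BN_le_EN:
  assumes "matching_pairs r \<rho>" "bndd r \<rho> u"
  shows "BN m r \<rho> N u u \<le> EN r \<rho> u"
proof -
  have "BN (max m N) r \<rho> (max m N) u u \<le> EN r \<rho> u"
    unfolding EN_def by (rule cSUP_upper[OF _ bndd_bdd_above[OF assms(2)]]) simp
  then show ?thesis using BN_le_diag[OF assms(1), of m N u] by simp
qed

lemma EN_le: "(\<And>m. BN m r \<rho> m u u \<le> c) \<Longrightarrow> EN r \<rho> u \<le> c"
  unfolding EN_def by (rule cSUP_least) auto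

lemma BN_tendsto_EN:
  assumes "matching_pairs r \<rho>" "bndd r \<rho> u"
  shows "(\<lambda>m. BN m r \<rho> m u u) \<longlonglongrightarrow> EN r \<rho> u"
  unfolding EN_def
  by (rule LIMSEQ_incseq_SUP[OF bndd_bdd_above[OF assms(2)]]) (auto simp: incseq_def intro!: BN_mono[OF assms(1)])

text \<open>Up to the factor \<open>gam\<close>, the dyadic energy of a single edge is one of the
  nonnegative summands of \<open>BN\<close> at the level following the word.\<close>

lemma bndd_in_H1:
  assumes m: "matching_pairs r \<rho>" and u: "continuous_on K u" and b: "bndd r \<rho> u"
  shows "in_H1 (\<lambda>t. u (X w i t))"
proof -
  obtain c where c: "\<And>m N. BN m r \<rho> N u u \<le> c" using b by (auto simp: bndd_def)
  have "SB N (\<lambda>t. u (X w i t)) (\<lambda>t. u (X w i t)) \<le> gam r \<rho> (Suc (length w)) * c" for N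
  proof -
    have "SB N (\<lambda>t. u (X w i t)) (\<lambda>t. u (X w i t)) \<le> (\<Sum>i\<in>UNIV. SB N (\<lambda>t. u (X w i t)) (\<lambda>t. u (X w i t)))"
      by (rule member_le_sum) (auto intro: SB_nonneg)
    also have "\<dots> \<le> edge_sum (length w) N u"
      unfolding edge_sum_def by (rule member_le_sum) (auto intro!: sum_nonneg SB_nonneg finite_words)
    finally have 1: "SB N (\<lambda>t. u (X w i t)) (\<lambda>t. u (X w i t)) \<le> edge_sum (length w) N u" .
    have "edge_sum (length w) N u / gam r \<rho> (Suc (length w))
        \<le> (\<Sum>k<Suc (length w). edge_sum k N u / gam r \<rho> (Suc k))"
      by (rule member_le_sum[of "length w" _ "\<lambda>k. edge_sum k N u / gam r \<rho> (Suc k)"])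
        (auto intro!: divide_nonneg_pos edge_sum_nonneg gam_pos[OF m])
    also have "\<dots> \<le> BN (Suc (length w)) r \<rho> N u u"
    proof -
      have "0 \<le> Q \<alpha> p (Suc (length w)) u / delta r (Suc (length w))"
        unfolding Q_def Q0_def by (intro divide_nonneg_pos sum_nonneg delta_pos[OF m]) auto
      then show ?thesis unfolding BN_expand by simp
    qed
    also have "\<dots> \<le> c" by (rule c)
    finally show ?thesis using 1 gam_pos[OF m, of "length w"] by (simp add: field_simps)
  qed
  then show ?thesis using in_H1_iff_SB_bounded[OF continuous_on_X[OF u]] by blast
qed

text \<open>From here on \<open>DOM\<close> and \<open>EN\<close> replace the original domain and
  energy, and weak derivatives disappear from the statements.\<close>

lemma dom_energy_eq:
  assumes m: "matching_pairs r \<rho>"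
  shows "dom_energy \<alpha> p K r \<rho> = DOM r \<rho>"
    and "u \<in> DOM r \<rho> \<Longrightarrow> enn2real (energy \<alpha> p r \<rho> u) = EN r \<rho> u"
proof -
  have fin: "energy \<alpha> p r \<rho> u = ennreal (EN r \<rho> u)" if "u \<in> DOM r \<rho>" for u
  proof -
    have u: "continuous_on K u" "bndd r \<rho> u" using that by (auto simp: DOM_def)
    have e: "energy \<alpha> p r \<rho> u = (SUP m. ennreal (BN m r \<rho> m u u))"
      by (rule energy_eq_SUP[OF m u(1) bndd_in_H1[OF m u]])
    have l1: "(\<lambda>k. ennreal (BN k r \<rho> k u u)) \<longlonglongrightarrow> (SUP m. ennreal (BN m r \<rho> m u u))"
      by (rule LIMSEQ_SUP) (auto simp: incseq_def intro!: ennreal_leI BN_mono[OF m])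
    have l2: "(\<lambda>k. ennreal (BN k r \<rho> k u u)) \<longlonglongrightarrow> ennreal (EN r \<rho> u)"
      by (intro tendsto_ennrealI BN_tendsto_EN m u)
    show ?thesis using LIMSEQ_unique[OF l1 l2] e by simp
  qed
  have E0: "0 \<le> EN r \<rho> u" if "bndd r \<rho> u" for u
    using BN_le_EN[OF m that, of 0 0] BN_nonneg[OF m, of 0 0 u] by simp
  show "enn2real (energy \<alpha> p r \<rho> u) = EN r \<rho> u" if "u \<in> DOM r \<rho>"
    using fin[OF that] E0 that by (simp add: DOM_def)
  show "dom_energy \<alpha> p K r \<rho> = DOM r \<rho>"
  proof (rule set_eqI)
    fix u
    show "u \<in> dom_energy \<alpha> p K r \<rho> \<longleftrightarrow> u \<in> DOM r \<rho>"
    proof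
      assume "u \<in> DOM r \<rho>"
      then show "u \<in> dom_energy \<alpha> p K r \<rho>"
        using fin[of u] bndd_in_H1[OF m] by (auto simp: dom_energy_def DOM_def o_def)
    next
      assume a: "u \<in> dom_energy \<alpha> p K r \<rho>"
      then have u: "continuous_on K u" and H: "\<And>w i. in_H1 (\<lambda>t. u (X w i t))"
        and e: "energy \<alpha> p r \<rho> u < \<infinity>" by (auto simp: dom_energy_def o_def)
      define c where "c = enn2real (energy \<alpha> p r \<rho> u)"
      have c: "(SUP m. ennreal (BN m r \<rho> m u u)) = ennreal c" "0 \<le> c"
        using e unfolding energy_eq_SUP[OF m u H, symmetric] c_def by simp_all
      have "BN k r \<rho> k u u \<le> c" for k
      proof -
        have "ennreal (BN k r \<rho> k u u) \<le> ennreal c" unfolding c(1)[symmetric] by (rule SUP_upper) simp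
        then show ?thesis using c(2) by simp
      qed
      then have "BN k r \<rho> N u u \<le> c" for k N using BN_le_diag[OF m, of k N u] order_trans by blast
      then show "u \<in> DOM r \<rho>" using u by (auto simp: DOM_def bndd_def)
    qed
  qed
qed

lemma BN_pm:
  "BN m r \<rho> N (\<lambda>x. u x + v x) (\<lambda>x. u x + v x) = BN m r \<rho> N u u + 2 * BN m r \<rho> N u v + BN m r \<rho> N v v"
  "BN m r \<rho> N (\<lambda>x. u x - v x) (\<lambda>x. u x - v x) = BN m r \<rho> N u u - 2 * BN m r \<rho> N u v + BN m r \<rho> N v v"
  by (simp_all add: BN_add BN_diff BN_add_right BN_diff_right BN_commute[of _ _ _ _ v u])

text \<open>Parallelogram identity, with the nonnegative form of the difference discarded.\<close>

lemma DOM_add: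
  assumes m: "matching_pairs r \<rho>" and "u \<in> DOM r \<rho>" "v \<in> DOM r \<rho>"
  shows "(\<lambda>x. u x + v x) \<in> DOM r \<rho>"
proof -
  have b: "bndd r \<rho> u" "bndd r \<rho> v" using assms by (auto simp: DOM_def)
  have "BN k r \<rho> N (\<lambda>x. u x + v x) (\<lambda>x. u x + v x) \<le> 2 * EN r \<rho> u + 2 * EN r \<rho> v" for k N
    using BN_pm[of k r \<rho> N u v] BN_nonneg[OF m, of k N "\<lambda>x. u x - v x"]
      BN_le_EN[OF m b(1), of k N] BN_le_EN[OF m b(2), of k N] by linarith
  then show ?thesis using assms by (auto simp: DOM_def bndd_def intro!: continuous_intros)
qed

lemma DOM_cmult:
  assumes "u \<in> DOM r \<rho>"
  shows "(\<lambda>x. a * u x) \<in> DOM r \<rho>"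
proof -
  obtain c where "\<And>m N. BN m r \<rho> N u u \<le> c" using assms by (auto simp: DOM_def bndd_def)
  then have "a\<^sup>2 * BN m r \<rho> N u u \<le> a\<^sup>2 * c" for m N by (intro mult_left_mono) auto
  then have "BN m r \<rho> N (\<lambda>x. a * u x) (\<lambda>x. a * u x) \<le> a\<^sup>2 * c" for m N
    by (simp add: BN_cmult BN_cmult_right power2_eq_square mult.assoc)
  then show ?thesis using assms by (auto simp: DOM_def bndd_def intro!: continuous_intros)
qed

lemma DOM_diff:
  assumes "matching_pairs r \<rho>" "u \<in> DOM r \<rho>" "v \<in> DOM r \<rho>"
  shows "(\<lambda>x. u x - v x) \<in> DOM r \<rho>"
  using DOM_add[OF assms(1,2) DOM_cmult[OF assms(3), of "-1"]] by simp

lemma DOM_sum: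
  assumes "matching_pairs r \<rho>" "finite S" "\<And>k. k \<in> S \<Longrightarrow> f k \<in> DOM r \<rho>"
  shows "(\<lambda>x. \<Sum>k\<in>S. c k * f k x) \<in> DOM r \<rho>"
  using assms(2,3)
proof (induction S rule: finite_induct)
  case empty
  show ?case by (auto simp: DOM_def bndd_def BN_zero)
next
  case (insert k S)
  then show ?case by (auto intro!: DOM_add[OF assms(1)] DOM_cmult)
qed

definition EB :: "(nat \<Rightarrow> real) \<Rightarrow> (nat \<Rightarrow> real) \<Rightarrow> (real^2 \<Rightarrow> real) \<Rightarrow> (real^2 \<Rightarrow> real) \<Rightarrow> real" where
  "EB r \<rho> u v = (EN r \<rho> (\<lambda>x. u x + v x) - EN r \<rho> (\<lambda>x. u x - v x)) / 4"

lemma energy_form_eq: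
  assumes m: "matching_pairs r \<rho>" and "u \<in> DOM r \<rho>" "v \<in> DOM r \<rho>"
  shows "energy_form \<alpha> p r \<rho> u v = EB r \<rho> u v"
  by (simp add: energy_form_def EB_def dom_energy_eq(2)[OF m] DOM_add[OF assms] DOM_diff[OF assms])

lemma BN_tendsto_EB:
  assumes m: "matching_pairs r \<rho>" and "u \<in> DOM r \<rho>" "v \<in> DOM r \<rho>"
  shows "(\<lambda>k. BN k r \<rho> k u v) \<longlonglongrightarrow> EB r \<rho> u v"
proof -
  have b: "bndd r \<rho> (\<lambda>x. u x + v x)" "bndd r \<rho> (\<lambda>x. u x - v x)"
    using DOM_add[OF assms] DOM_diff[OF assms] by (auto simp: DOM_def)
  have "(\<lambda>k. (BN k r \<rho> k (\<lambda>x. u x + v x) (\<lambda>x. u x + v x) - BN k r \<rho> k (\<lambda>x. u x - v x) (\<lambda>x. u x - v x)) / 4)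
     \<longlonglongrightarrow> EB r \<rho> u v"
    unfolding EB_def by (intro tendsto_intros BN_tendsto_EN m b) simp
  then show ?thesis by (simp add: BN_pm)
qed

text \<open>Prepares the first variation at the minimizer; the expansion holds for each discrete
  form and passes to the limit.\<close>

lemma EN_linear_comb:
  assumes m: "matching_pairs r \<rho>" and u: "u \<in> DOM r \<rho>" and v: "v \<in> DOM r \<rho>"
  shows "EN r \<rho> (\<lambda>x. u x + t * v x) = EN r \<rho> u + 2 * t * EB r \<rho> u v + t\<^sup>2 * EN r \<rho> v"
proof -
  have b: "bndd r \<rho> u" "bndd r \<rho> v" "bndd r \<rho> (\<lambda>x. u x + t * v x)"
    using u v DOM_add[OF m u DOM_cmult[OF v]] by (auto simp: DOM_def)
  have "(\<lambda>k. BN k r \<rho> k u u + 2 * t * BN k r \<rho> k u v + t\<^sup>2 * BN k r \<rho> k v v)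
    \<longlonglongrightarrow> EN r \<rho> u + 2 * t * EB r \<rho> u v + t\<^sup>2 * EN r \<rho> v"
    by (intro tendsto_intros BN_tendsto_EN BN_tendsto_EB m b u v)
  moreover have "BN k r \<rho> k (\<lambda>x. u x + t * v x) (\<lambda>x. u x + t * v x)
    = BN k r \<rho> k u u + 2 * t * BN k r \<rho> k u v + t\<^sup>2 * BN k r \<rho> k v v" for k
    using BN_pm(1)[of k r \<rho> k u "\<lambda>x. t * v x"] by (simp add: BN_cmult BN_cmult_right power2_eq_square)
  ultimately show ?thesis using BN_tendsto_EN[OF m b(3)] LIMSEQ_unique by fastforce
qed

lemma EN_cmult:
  assumes m: "matching_pairs r \<rho>" and u: "u \<in> DOM r \<rho>"
  shows "EN r \<rho> (\<lambda>x. a * u x) = a\<^sup>2 * EN r \<rho> u"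
proof -
  have b: "bndd r \<rho> u" "bndd r \<rho> (\<lambda>x. a * u x)"
    using u DOM_cmult[OF u] by (auto simp: DOM_def)
  have "(\<lambda>k. a\<^sup>2 * BN k r \<rho> k u u) \<longlonglongrightarrow> a\<^sup>2 * EN r \<rho> u"
    by (intro tendsto_intros BN_tendsto_EN m b)
  moreover have "BN k r \<rho> k (\<lambda>x. a * u x) (\<lambda>x. a * u x) = a\<^sup>2 * BN k r \<rho> k u u" for k
    by (simp add: BN_cmult BN_cmult_right power2_eq_square)
  ultimately show ?thesis using BN_tendsto_EN[OF m b(2)] LIMSEQ_unique by fastforce
qed

lemma EN_nonneg:
  assumes "matching_pairs r \<rho>" "bndd r \<rho> u"
  shows "0 \<le> EN r \<rho> u"
  using BN_le_EN[OF assms, of 0 0] BN_nonneg[OF assms(1), of 0 0 u] by simp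

section \<open>Invariance of the form under symmetries and its scaling under transplantation\<close>

lemma BN_symm:
  assumes \<pi>: "\<pi> permutes UNIV"
  shows "BN m r \<rho> N (\<lambda>x. u (symm \<pi> x)) (\<lambda>x. v (symm \<pi> x)) = BN m r \<rho> N u v"
proof (induction m arbitrary: r \<rho> u v)
  case 0
  define F where "F i j = (u (p i) - u (p j)) * (v (p i) - v (p j))" for i j
  have "(\<Sum>i\<in>UNIV. \<Sum>j\<in>UNIV. F (\<pi> i) (\<pi> j)) = (\<Sum>i\<in>UNIV. \<Sum>j\<in>UNIV. F (\<pi> i) j)"
    by (intro sum.cong refl sum.reindex_bij_betw permutes_imp_bij[OF \<pi>])
  also have "\<dots> = (\<Sum>i\<in>UNIV. \<Sum>j\<in>UNIV. F i j)"
    by (rule sum.reindex_bij_betw[OF permutes_imp_bij[OF \<pi>]])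
  finally show ?case by (simp add: q0_def symm_vertex F_def)
next
  case (Suc m)
  have "(\<Sum>i\<in>UNIV. BN m (sh r) (sh \<rho>) N (\<lambda>x. u (symm \<pi> (GG i x))) (\<lambda>x. v (symm \<pi> (GG i x))))
    = (\<Sum>i\<in>UNIV. BN m (sh r) (sh \<rho>) N (\<lambda>x. u (GG (\<pi> i) x)) (\<lambda>x. v (GG (\<pi> i) x)))"
    using Suc.IH[of "sh r" "sh \<rho>" "\<lambda>x. u (GG (\<pi> _) x)" "\<lambda>x. v (GG (\<pi> _) x)"]
    by (simp add: symm_G)
  also have "\<dots> = (\<Sum>i\<in>UNIV. BN m (sh r) (sh \<rho>) N (\<lambda>x. u (GG i x)) (\<lambda>x. v (GG i x)))"
    by (rule sum.reindex_bij_betw[OF permutes_imp_bij[OF \<pi>]])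
  finally have 1: "(\<Sum>i\<in>UNIV. BN m (sh r) (sh \<rho>) N (\<lambda>x. u (symm \<pi> (GG i x))) (\<lambda>x. v (symm \<pi> (GG i x))))
    = (\<Sum>i\<in>UNIV. BN m (sh r) (sh \<rho>) N (\<lambda>x. u (GG i x)) (\<lambda>x. v (GG i x)))" .
  \<comment> \<open>A symmetry may reverse the edge, which the dyadic form does not notice.\<close>
  have "SB N (\<lambda>t. u (symm \<pi> (X [] i t))) (\<lambda>t. v (symm \<pi> (X [] i t)))
      = SB N (\<lambda>t. u (X [] (\<pi> i) t)) (\<lambda>t. v (X [] (\<pi> i) t))" for i
    using symm_X0[OF \<pi>, of i] SB_reverse[of N "\<lambda>t. u (X [] (\<pi> i) t)" "\<lambda>t. v (X [] (\<pi> i) t)"] by auto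
  then have "(\<Sum>i\<in>UNIV. SB N (\<lambda>t. u (symm \<pi> (X [] i t))) (\<lambda>t. v (symm \<pi> (X [] i t))))
      = (\<Sum>i\<in>UNIV. SB N (\<lambda>t. u (X [] (\<pi> i) t)) (\<lambda>t. v (X [] (\<pi> i) t)))" by simp
  also have "\<dots> = (\<Sum>i\<in>UNIV. SB N (\<lambda>t. u (X [] i t)) (\<lambda>t. v (X [] i t)))"
    by (rule sum.reindex_bij_betw[OF permutes_imp_bij[OF \<pi>]])
  finally show ?case using 1 by simp
qed

lemma DOM_symm:
  assumes \<pi>: "\<pi> permutes UNIV" and u: "u \<in> DOM r \<rho>"
  shows "(\<lambda>x. u (symm \<pi> x)) \<in> DOM r \<rho>"
proof -
  have "continuous_on K (\<lambda>x. u (symm \<pi> x))"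
    by (rule continuous_on_compose2[of K u]) (use u symm_in_K[OF \<pi>] in \<open>auto simp: DOM_def continuous_symm\<close>)
  then show ?thesis using u by (auto simp: DOM_def bndd_def BN_symm[OF \<pi>])
qed

text \<open>Of all summands only cell \<open>i\<close> survives: on \<open>K\<close> the transported
  function is zero in the other cells and on the edges \<open>X []\<close>, endpoints
  included.\<close>

lemma BN_Tr:
  assumes u: "\<And>i. u (p i) = 0"
  shows "BN (Suc m) r \<rho> N (Tr i u) v = BN m (sh r) (sh \<rho>) N u (\<lambda>x. v (GG i x)) / r 1"
proof -
  have "BN m (sh r) (sh \<rho>) N (\<lambda>x. Tr i u (GG j x)) (\<lambda>x. v (GG j x))
     = (if j = i then BN m (sh r) (sh \<rho>) N u (\<lambda>x. v (GG i x)) else 0)" for j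
  proof -
    have "BN m (sh r) (sh \<rho>) N (\<lambda>x. Tr i u (GG j x)) (\<lambda>x. v (GG j x))
      = BN m (sh r) (sh \<rho>) N (\<lambda>x. if j = i then u x else 0) (\<lambda>x. v (GG j x))"
      by (rule BN_cong) (simp_all add: Tr_G)
    then show ?thesis by (auto simp: BN_zero)
  qed
  moreover have "SB N (\<lambda>t. Tr i u (X [] j t)) (\<lambda>t. v (X [] j t)) = 0" for j
  proof -
    have "SB N (\<lambda>t. Tr i u (X [] j t)) (\<lambda>t. v (X [] j t)) = SB N (\<lambda>t. 0) (\<lambda>t. v (X [] j t))"
      by (rule SB_cong) (simp_all add: Tr_X[of u, OF u])
    then show ?thesis by (simp add: SB_zero)
  qed
  ultimately show ?thesis by simp
qed

abbreviation shn :: "nat \<Rightarrow> (nat \<Rightarrow> real) \<Rightarrow> nat \<Rightarrow> real" where "shn n r \<equiv> \<lambda>k. r (k + n)"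

lemma matching_shn: "matching_pairs r \<rho> \<Longrightarrow> matching_pairs (shn n r) (shn n \<rho>)"
  by (auto simp: matching_pairs_def)

text \<open>Every letter costs a division by the current first \<open>r\<close> and a shift of the
  pairs; over the whole word this accumulates to \<open>delta\<close> and
  \<open>shn\<close>.\<close>

lemma BN_TW:
  assumes u: "continuous_on K u" "\<And>i. u (p i) = 0"
  shows "BN (length w + m) r \<rho> N (TW w u) v
    = BN m (shn (length w) r) (shn (length w) \<rho>) N u (\<lambda>x. v (GW w x)) / delta r (length w)"
proof (induction w arbitrary: r \<rho> v)
  case Nil
  show ?case by (simp add: delta_def)
next
  case (Cons i w)
  have "BN (length (i # w) + m) r \<rho> N (TW (i # w) u) v
    = BN (length w + m) (sh r) (sh \<rho>) N (TW w u) (\<lambda>x. v (GG i x)) / r 1"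
    using BN_Tr[of "TW w u" "length w + m" r \<rho> N i v] TW_props[OF u, of w] by simp
  also have "\<dots> = BN m (shn (length w) (sh r)) (shn (length w) (sh \<rho>)) N u (\<lambda>x. v (GG i (GW w x)))
      / delta (sh r) (length w) / r 1"
    by (simp only: Cons)
  finally show ?case by (simp add: delta_Suc mult.commute)
qed

text \<open>A cell contributes one of several nonnegative summands to the energy of
  \<open>v\<close>; the others are dropped at each letter.\<close>

lemma BN_GW_le:
  assumes "matching_pairs r \<rho>"
  shows "BN m (shn (length w) r) (shn (length w) \<rho>) N (\<lambda>x. v (GW w x)) (\<lambda>x. v (GW w x))
    \<le> delta r (length w) * BN (length w + m) r \<rho> N v v"
  using assms
proof (induction w arbitrary: r \<rho> v)
  case Nil
  show ?case by (simp add: delta_def)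
next
  case (Cons i w)
  note mt = matching_1[OF Cons.prems] matching_sh[OF Cons.prems]
  have "BN m (shn (length w) (sh r)) (shn (length w) (sh \<rho>)) N (\<lambda>x. v (GG i (GW w x))) (\<lambda>x. v (GG i (GW w x)))
     \<le> delta (sh r) (length w) * BN (length w + m) (sh r) (sh \<rho>) N (\<lambda>x. v (GG i x)) (\<lambda>x. v (GG i x))"
    by (rule Cons.IH[OF mt(4)])
  also have "\<dots> \<le> delta (sh r) (length w) * (r 1 * BN (Suc (length w + m)) r \<rho> N v v)"
  proof (rule mult_left_mono)
    have "BN (length w + m) (sh r) (sh \<rho>) N (\<lambda>x. v (GG i x)) (\<lambda>x. v (GG i x))
       \<le> (\<Sum>i\<in>UNIV. BN (length w + m) (sh r) (sh \<rho>) N (\<lambda>x. v (GG i x)) (\<lambda>x. v (GG i x)))"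
      by (rule member_le_sum[of i UNIV "\<lambda>i. BN (length w + m) (sh r) (sh \<rho>) N (\<lambda>x. v (GG i x)) (\<lambda>x. v (GG i x))"])
        (auto intro: BN_nonneg[OF mt(4)])
    moreover have "0 \<le> r 1 * ((\<Sum>i\<in>UNIV. SB N (\<lambda>t. v (X [] i t)) (\<lambda>t. v (X [] i t))) / \<rho> 1)"
      using mt by (intro mult_nonneg_nonneg divide_nonneg_pos sum_nonneg SB_nonneg) auto
    ultimately show "BN (length w + m) (sh r) (sh \<rho>) N (\<lambda>x. v (GG i x)) (\<lambda>x. v (GG i x))
       \<le> r 1 * BN (Suc (length w + m)) r \<rho> N v v"
      using mt by (simp add: distrib_left)
  qed (use delta_pos[OF mt(4)] in \<open>simp add: less_imp_le\<close>)
  finally show ?case by (simp add: delta_Suc mult_ac del: BN.simps)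
qed

lemma DOM_GW:
  assumes m: "matching_pairs r \<rho>" and v: "v \<in> DOM r \<rho>"
  shows "(\<lambda>x. v (GW w x)) \<in> DOM (shn (length w) r) (shn (length w) \<rho>)"
proof -
  have b: "bndd r \<rho> v" using v by (simp add: DOM_def)
  have "BN k (shn (length w) r) (shn (length w) \<rho>) N (\<lambda>x. v (GW w x)) (\<lambda>x. v (GW w x))
     \<le> delta r (length w) * EN r \<rho> v" for k N
    by (rule order_trans[OF BN_GW_le[OF m]])
      (intro mult_left_mono BN_le_EN[OF m b] less_imp_le[OF delta_pos[OF m]])
  moreover have "continuous_on K (\<lambda>x. v (GW w x))"
    by (rule continuous_on_compose2[of K v]) (use v in \<open>auto simp: DOM_def continuous_GW GW_in_K\<close>)
  ultimately show ?thesis by (auto simp: DOM_def bndd_def)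
qed

lemma DOM_TW:
  assumes m: "matching_pairs r \<rho>" and u: "u \<in> DOM (shn (length w) r) (shn (length w) \<rho>)" "\<And>i. u (p i) = 0"
  shows "TW w u \<in> DOM r \<rho>"
proof -
  have uc: "continuous_on K u" and b: "bndd (shn (length w) r) (shn (length w) \<rho>) u"
    using u(1) by (auto simp: DOM_def)
  have "BN k r \<rho> N (TW w u) (TW w u) \<le> EN (shn (length w) r) (shn (length w) \<rho>) u / delta r (length w)" for k N
  proof -
    \<comment> \<open>Raising the level by \<open>length w\<close> costs nothing, since
      \<open>BN\<close> grows with the level, and gives the form that \<open>BN_TW\<close>
      evaluates.\<close>
    have "BN k r \<rho> N (TW w u) (TW w u) \<le> BN (length w + k) r \<rho> N (TW w u) (TW w u)"
      by (rule BN_mono[OF m]) auto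
    also have "\<dots> = BN k (shn (length w) r) (shn (length w) \<rho>) N u (\<lambda>x. TW w u (GW w x)) / delta r (length w)"
      by (rule BN_TW[OF uc u(2)])
    also have "BN k (shn (length w) r) (shn (length w) \<rho>) N u (\<lambda>x. TW w u (GW w x))
        = BN k (shn (length w) r) (shn (length w) \<rho>) N u u"
      by (rule BN_cong) (simp_all add: TW_GW)
    also have "\<dots> / delta r (length w) \<le> EN (shn (length w) r) (shn (length w) \<rho>) u / delta r (length w)"
      by (intro divide_right_mono BN_le_EN matching_shn m b less_imp_le[OF delta_pos[OF m]])
    finally show ?thesis .
  qed
  then show ?thesis using TW_props[OF uc u(2), of w] by (auto simp: DOM_def bndd_def)
qed

text \<open>\<open>BN_TW\<close> lowers the level by \<open>length w\<close> but keeps the dyadic mesh, so the energy is recovered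
  here as a limit off the diagonal of \<open>BN\<close>.\<close>

lemma EB_TW:
  assumes m: "matching_pairs r \<rho>" and u: "u \<in> DOM (shn (length w) r) (shn (length w) \<rho>)" "\<And>i. u (p i) = 0"
    and v: "v \<in> DOM r \<rho>"
  shows "EB r \<rho> (TW w u) v = EB (shn (length w) r) (shn (length w) \<rho>) u (\<lambda>x. v (GW w x)) / delta r (length w)"
proof -
  define n where "n = length w"
  have uc: "continuous_on K u" using u(1) by (auto simp: DOM_def)
  \<comment> \<open>Level \<open>n + k\<close> with mesh index \<open>k\<close> lies between the
    diagonal term at \<open>k\<close> and the supremum.\<close>
  have lim: "(\<lambda>k. BN (n + k) r \<rho> k f f) \<longlonglongrightarrow> EN r \<rho> f" if "bndd r \<rho> f" for f
  proof (rule tendsto_sandwich)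
    show "(\<lambda>k. BN k r \<rho> k f f) \<longlonglongrightarrow> EN r \<rho> f" by (rule BN_tendsto_EN[OF m that])
    show "(\<lambda>k. EN r \<rho> f) \<longlonglongrightarrow> EN r \<rho> f" by simp
  qed (auto intro!: always_eventually BN_mono[OF m] BN_le_EN[OF m that])
  note T = DOM_TW[OF m u]
  have b: "bndd r \<rho> (\<lambda>x. TW w u x + v x)" "bndd r \<rho> (\<lambda>x. TW w u x - v x)"
    using DOM_add[OF m T v] DOM_diff[OF m T v] by (auto simp: DOM_def)
  have "(\<lambda>k. (BN (n + k) r \<rho> k (\<lambda>x. TW w u x + v x) (\<lambda>x. TW w u x + v x)
       - BN (n + k) r \<rho> k (\<lambda>x. TW w u x - v x) (\<lambda>x. TW w u x - v x)) / 4) \<longlonglongrightarrow> EB r \<rho> (TW w u) v"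
    unfolding EB_def by (intro tendsto_intros lim b) simp
  then have "(\<lambda>k. BN (n + k) r \<rho> k (TW w u) v) \<longlonglongrightarrow> EB r \<rho> (TW w u) v"
    by (simp add: BN_pm)
  moreover have "(\<lambda>k. BN k (shn n r) (shn n \<rho>) k u (\<lambda>x. v (GW w x)) / delta r n)
      \<longlonglongrightarrow> EB (shn n r) (shn n \<rho>) u (\<lambda>x. v (GW w x)) / delta r n"
    unfolding n_def using delta_pos[OF m, of "length w"]
    by (intro tendsto_intros BN_tendsto_EB matching_shn m u DOM_GW v) auto
  ultimately show ?thesis
    unfolding n_def BN_TW[OF uc u(2)] by (rule LIMSEQ_unique)
qed

end

subsection \<open>Integrals against the measures\<close>

lemma integral_leb01_reverse:
  fixes h :: "real \<Rightarrow> real"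
  shows "(\<integral>t. h (1 - t) \<partial>leb01) = (\<integral>t. h t \<partial>leb01)"
proof -
  have "(\<integral>t. h t \<partial>leb01) = \<bar>-1\<bar> *\<^sub>R (\<integral>t. indicator {0<..<1} (1 + (-1) * t) * h (1 + (-1) * t) \<partial>lborel)"
    unfolding integral_leb01 by (rule lborel_integral_real_affine) simp
  also have "\<dots> = (\<integral>t. indicator {0<..<1} t * h (1 - t) \<partial>lborel)"
    by (auto intro!: Bochner_Integration.integral_cong simp: indicator_def)
  finally show ?thesis by (simp add: integral_leb01)
qed

text \<open>\<open>mu_eta\<close> is prescribed through its values on sets; integrals follow by the
  usual induction from indicators to monotone limits.\<close>

lemma nn_integral_mixture:
  assumes sets: "sets A = sets M" "sets B = sets M"
    and em: "\<And>X. X \<in> sets M \<Longrightarrow> emeasure M X = a * emeasure A X + b * emeasure B X"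
    and f: "f \<in> borel_measurable M"
  shows "(\<integral>\<^sup>+x. f x \<partial>M) = a * (\<integral>\<^sup>+x. f x \<partial>A) + b * (\<integral>\<^sup>+x. f x \<partial>B)"
  using f
proof (induction rule: borel_measurable_induct)
  case (cong f g)
  have "space A = space M" "space B = space M" using sets sets_eq_imp_space_eq by blast+
  then have "(\<integral>\<^sup>+x. f x \<partial>A) = (\<integral>\<^sup>+x. g x \<partial>A)" "(\<integral>\<^sup>+x. f x \<partial>B) = (\<integral>\<^sup>+x. g x \<partial>B)"
    "(\<integral>\<^sup>+x. f x \<partial>M) = (\<integral>\<^sup>+x. g x \<partial>M)"
    using cong(3) by (auto intro!: nn_integral_cong)
  then show ?case using cong by simp
next
  case (set X)
  then show ?case using em[of X] sets by simp
next
  case (mult u c)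
  have "u \<in> borel_measurable A" "u \<in> borel_measurable B"
    using mult sets measurable_cong_sets by blast+
  then show ?case using mult by (simp add: nn_integral_cmult distrib_left mult_ac)
next
  case (add u v)
  have "u \<in> borel_measurable A" "u \<in> borel_measurable B" "v \<in> borel_measurable A" "v \<in> borel_measurable B"
    using add sets measurable_cong_sets by blast+
  then show ?case using add by (simp add: nn_integral_add distrib_left add_ac)
next
  case (seq U)
  have m: "U i \<in> borel_measurable A" "U i \<in> borel_measurable B" for i
    using seq sets measurable_cong_sets by blast+
  have inc: "incseq (\<lambda>i. \<integral>\<^sup>+x. U i x \<partial>A)" "incseq (\<lambda>i. \<integral>\<^sup>+x. U i x \<partial>B)"
    using \<open>incseq U\<close> by (auto simp: incseq_def le_fun_def intro!: nn_integral_mono)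
  have app: "(SUP i. U i) x = (SUP i. U i x)" for x by (rule SUP_apply)
  have "(\<integral>\<^sup>+x. (SUP i. U i) x \<partial>M) = (SUP i. \<integral>\<^sup>+x. U i x \<partial>M)"
    unfolding app
    using nn_integral_monotone_convergence_SUP[OF \<open>incseq U\<close> seq(1)] by simp
  also have "\<dots> = (SUP i. a * (\<integral>\<^sup>+x. U i x \<partial>A) + b * (\<integral>\<^sup>+x. U i x \<partial>B))" using seq by simp
  also have "\<dots> = (SUP i. a * (\<integral>\<^sup>+x. U i x \<partial>A)) + (SUP i. b * (\<integral>\<^sup>+x. U i x \<partial>B))"
    by (rule ennreal_SUP_add) (use inc in \<open>auto simp: incseq_def intro!: mult_left_mono\<close>)
  also have "\<dots> = a * (SUP i. \<integral>\<^sup>+x. U i x \<partial>A) + b * (SUP i. \<integral>\<^sup>+x. U i x \<partial>B)"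
    by (simp add: SUP_mult_left_ennreal)
  also have "\<dots> = a * (\<integral>\<^sup>+x. (SUP i. U i) x \<partial>A) + b * (\<integral>\<^sup>+x. (SUP i. U i) x \<partial>B)"
    unfolding app using nn_integral_monotone_convergence_SUP[OF \<open>incseq U\<close> m(1)]
      nn_integral_monotone_convergence_SUP[OF \<open>incseq U\<close> m(2)] by simp
  finally show ?case .
qed

lemma finite_measure_borel_prob_on:
  assumes "borel_prob_on K \<mu>"
  shows "space \<mu> = K" "finite_measure \<mu>" "emeasure \<mu> (space \<mu>) = 1"
proof -
  have "sets \<mu> = sets (restrict_space borel K)" using assms by (simp add: borel_prob_on_def)
  from sets_eq_imp_space_eq[OF this] show sp: "space \<mu> = K" by (simp add: space_restrict_space)
  then show "emeasure \<mu> (space \<mu>) = 1" using assms by (simp add: borel_prob_on_def)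
  then show "finite_measure \<mu>" by (intro finite_measureI) simp
qed

lemma measurable_continuous_on_K:
  fixes f :: "real^2 \<Rightarrow> real"
  assumes "sets \<mu> = sets (restrict_space borel K)" "continuous_on K f"
  shows "f \<in> borel_measurable \<mu>"
  using borel_measurable_continuous_on_restrict[OF assms(2)] measurable_cong_sets[OF assms(1) refl] by blast

lemma integrable_continuous_on_K:
  fixes f :: "real^2 \<Rightarrow> real"
  assumes "compact K" "borel_prob_on K \<mu>" "continuous_on K f"
  shows "integrable \<mu> f"
proof -
  have s: "sets \<mu> = sets (restrict_space borel K)" using assms by (simp add: borel_prob_on_def)
  interpret finite_measure \<mu> by (rule finite_measure_borel_prob_on[OF assms(2)])
  have "compact (f ` K)" by (rule compact_continuous_image[OF assms(3,1)])
  then obtain C where "\<forall>y\<in>f ` K. norm y \<le> C" using compact_imp_bounded bounded_iff by metis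
  then show ?thesis
    using finite_measure_borel_prob_on(1)[OF assms(2)]
    by (intro integrable_const_bound[of _ C] AE_I2 measurable_continuous_on_K[OF s assms(3)]) auto
qed

context gasket
begin

section \<open>The cell measure \<open>\<mu>f\<close> through Riemann sums\<close>

lemma card_words: "card {w :: 3 list. length w = m} = 3 ^ m"
  using card_lists_length_eq[of "UNIV :: 3 set" m] by simp

lemma cell_in_sets: "sets \<mu> = sets (restrict_space borel K) \<Longrightarrow> GW w ` K \<in> sets \<mu>"
proof -
  assume s: "sets \<mu> = sets (restrict_space borel K)"
  have "closed (GW w ` K)"
    by (intro compact_imp_closed compact_continuous_image continuous_GW compact_K)
  then have "GW w ` K \<in> sets (restrict_space borel K)"
    using closed_K by (subst sets_restrict_space_iff) (auto intro: GW_in_K)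
  then show ?thesis using s by simp
qed

text \<open>Riemann sums over the cells of level \<open>m\<close>: equal masses, diameters tending
  to zero, and \<open>f\<close> uniformly continuous. The base point stays free, and invariance and
  scaling of the measure become reindexings of words.\<close>

lemma integral_mu_f:
  fixes f :: "real^2 \<Rightarrow> real"
  assumes \<mu>: "is_mu_f \<alpha> p K \<mu>" and f: "continuous_on K f" and x0: "x0 \<in> K"
  shows "(\<lambda>m. (\<Sum>w\<in>{w. length w = m}. f (GW w x0)) / 3 ^ m) \<longlonglongrightarrow> (\<integral>x. f x \<partial>\<mu>)"
proof (rule LIMSEQ_I)
  fix e :: real assume e: "0 < e"
  have pr: "borel_prob_on K \<mu>" and em: "\<And>w. emeasure \<mu> (GW w ` K) = ennreal ((1/3) ^ length w)"
    using \<mu> by (auto simp: is_mu_f_def)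
  have st: "sets \<mu> = sets (restrict_space borel K)" using pr by (simp add: borel_prob_on_def)
  note sp = finite_measure_borel_prob_on[OF pr]
  interpret finite_measure \<mu> by (rule sp(2))
  have ms: "measure \<mu> (space \<mu>) = 1" using sp(3) by (simp add: measure_def)
  have mc: "measure \<mu> (GW w ` K) = (1/3) ^ length w" for w using em[of w] by (simp add: measure_def)
  note cs = cell_in_sets[OF st]
  have [measurable]: "GW w ` K \<in> sets \<mu>" for w by (rule cs)
  have [measurable]: "f \<in> borel_measurable \<mu>" by (rule measurable_continuous_on_K[OF st f])
  have "uniformly_continuous_on K f" by (rule compact_uniformly_continuous[OF f compact_K])
  then obtain d where d: "d > 0" "\<And>x y. x \<in> K \<Longrightarrow> y \<in> K \<Longrightarrow> dist y x < d \<Longrightarrow> dist (f y) (f x) < e / 2"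
    unfolding uniformly_continuous_on_def using e by (metis half_gt_zero)
  obtain C where C: "\<And>x y. x \<in> K \<Longrightarrow> y \<in> K \<Longrightarrow> dist x y \<le> C"
    using compact_imp_bounded[OF compact_K] unfolding bounded_two_points by blast
  have "(\<lambda>m. s ^ m * C) \<longlonglongrightarrow> 0 * C"
    by (intro tendsto_intros LIMSEQ_realpow_zero) (use s in auto)
  then have "\<forall>\<^sub>F m in sequentially. s ^ m * C < d" using d(1) by (intro order_tendstoD(2)) auto
  then obtain m0 where m0: "\<And>m. m \<ge> m0 \<Longrightarrow> s ^ m * C < d" by (auto simp: eventually_sequentially)
  have "norm ((\<Sum>w\<in>{w. length w = m}. f (GW w x0)) / 3 ^ m - (\<integral>x. f x \<partial>\<mu>)) < e" if m: "m \<ge> m0" for m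
  proof -
    define W where "W = {w :: 3 list. length w = m}"
    have fW: "finite W" unfolding W_def by (rule finite_words)
    have disj: "disjoint_family_on (\<lambda>w. GW w ` K) W"
      unfolding disjoint_family_on_def W_def using GW_inj by blast
    define F where "F x = (\<Sum>w\<in>W. f (GW w x0) * indicator (GW w ` K) x)" for x
    have [measurable]: "F \<in> borel_measurable \<mu>" unfolding F_def[abs_def] by measurable
    have ind: "integrable \<mu> (\<lambda>x. f (GW w x0) * indicator (GW w ` K) x)" for w
      by (rule integrable_const_bound[of _ "\<bar>f (GW w x0)\<bar>"]) (auto split: split_indicator)
    have iF: "integrable \<mu> F" unfolding F_def[abs_def] by (intro Bochner_Integration.integrable_sum ind)
    have "(\<integral>x. F x \<partial>\<mu>) = (\<Sum>w\<in>W. f (GW w x0) * measure \<mu> (GW w ` K))"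
      unfolding F_def using GW_in_K sp(1)
      by (subst Bochner_Integration.integral_sum[OF ind]) (auto intro!: sum.cong simp: Int_absorb2 image_subset_iff)
    also have "\<dots> = (\<Sum>w\<in>W. f (GW w x0)) / 3 ^ m"
      by (simp add: mc sum_divide_distrib W_def power_divide)
    finally have intF: "(\<integral>x. F x \<partial>\<mu>) = (\<Sum>w\<in>W. f (GW w x0)) / 3 ^ m" .
    \<comment> \<open>The disjoint cells already have total mass 1, so what lies between them is a
      null set.\<close>
    have "measure \<mu> (\<Union>w\<in>W. GW w ` K) = (\<Sum>w\<in>W. measure \<mu> (GW w ` K))"
      by (rule finite_measure_finite_Union[OF fW _ disj]) auto
    also have "\<dots> = 1" using card_words[of m] by (simp add: mc W_def power_divide)
    finally have "measure \<mu> (\<Union>w\<in>W. GW w ` K) = measure \<mu> (space \<mu>)" using ms by simp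
    then have "emeasure \<mu> (\<Union>w\<in>W. GW w ` K) = emeasure \<mu> (space \<mu>)" by (simp add: emeasure_eq_measure)
    then have AE: "AE x in \<mu>. x \<in> (\<Union>w\<in>W. GW w ` K)"
      using fW by (intro AE_I[where N = "space \<mu> - (\<Union>w\<in>W. GW w ` K)"])
        (auto simp: emeasure_eq_measure finite_measure_compl sets.finite_UN)
    have close: "\<bar>f x - F x\<bar> \<le> e / 2" if xU: "x \<in> (\<Union>w\<in>W. GW w ` K)" for x
    proof -
      obtain w y where w: "w \<in> W" "y \<in> K" "x = GW w y" using xU by blast
      have "F x = (\<Sum>v\<in>W. if v = w then f (GW w x0) else 0)"
        unfolding F_def
      proof (rule sum.cong[OF refl])
        fix v assume v: "v \<in> W"
        have "v = w" if "x \<in> GW v ` K"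
        proof -
          from that obtain z where z: "z \<in> K" "x = GW v z" by (rule imageE)
          have "length v = length w" using v w(1) by (simp add: W_def)
          moreover have "GW v z = GW w y" using z(2) w(3) by (rule subst)
          ultimately show ?thesis using GW_inj[OF z(1) w(2)] by blast
        qed
        moreover have "x \<in> GW w ` K" using w(2,3) by (simp only: imageI)
        ultimately have "x \<in> GW v ` K \<longleftrightarrow> v = w" by metis
        then show "f (GW v x0) * indicator (GW v ` K) x = (if v = w then f (GW w x0) else 0)"
          by (simp add: indicator_def)
      qed
      also have "\<dots> = f (GW w x0)" using w(1) fW by simp
      finally have Fx: "F x = f (GW w x0)" .
      have "dist (GW w y) (GW w x0) = s ^ m * dist y x0" using w(1) by (simp add: dist_GW W_def)
      also have "\<dots> \<le> s ^ m * C" using C[OF w(2) x0] s by (intro mult_left_mono) auto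
      also have "\<dots> < d" by (rule m0[OF m])
      finally have "dist (f (GW w y)) (f (GW w x0)) < e / 2"
        using d(2) GW_in_K[OF w(2)] GW_in_K[OF x0] by blast
      then show ?thesis using w(3) Fx by (simp add: dist_real_def)
    qed
    have intf: "integrable \<mu> f" by (rule integrable_continuous_on_K[OF compact_K pr f])
    have "\<bar>(\<integral>x. f x \<partial>\<mu>) - (\<integral>x. F x \<partial>\<mu>)\<bar> = \<bar>\<integral>x. f x - F x \<partial>\<mu>\<bar>" using intf iF by simp
    also have "\<dots> \<le> (\<integral>x. \<bar>f x - F x\<bar> \<partial>\<mu>)" by (rule integral_abs_bound)
    also have "\<dots> \<le> (\<integral>x. e / 2 \<partial>\<mu>)"
      by (rule integral_mono_AE) (use intf iF AE close in \<open>auto elim!: eventually_mono\<close>)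
    also have "\<dots> = e / 2" using ms by simp
    finally show ?thesis using e unfolding intF W_def by (simp add: abs_minus_commute)
  qed
  then show "\<exists>m0. \<forall>m\<ge>m0. norm ((\<Sum>w\<in>{w. length w = m}. f (GW w x0)) / 3 ^ m - (\<integral>x. f x \<partial>\<mu>)) < e"
    by blast
qed

lemma map_words_bij:
  assumes "\<pi> permutes (UNIV :: 3 set)"
  shows "bij_betw (map \<pi>) {w. length w = m} {w. length w = m}"
proof (rule bij_betw_byWitness[where f' = "map (inv \<pi>)"])
  show "\<forall>w\<in>{w. length w = m}. map (inv \<pi>) (map \<pi> w) = w"
    using assms by (simp add: permutes_inv_o(2))
  show "\<forall>w\<in>{w. length w = m}. map \<pi> (map (inv \<pi>) w) = w"
    using assms by (simp add: permutes_inv_o(1))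
qed auto

lemma symm_GW: "symm \<pi> (GW w x) = GW (map \<pi> w) (symm \<pi> x)"
  by (induction w) (auto simp: symm_G)

lemma continuous_symm_comp:
  assumes "\<pi> permutes UNIV" "continuous_on K (f :: real^2 \<Rightarrow> real)"
  shows "continuous_on K (\<lambda>x. f (symm \<pi> x))"
  by (rule continuous_on_compose2[OF assms(2) continuous_symm]) (use symm_in_K[OF assms(1)] in auto)

text \<open>Relabelling words by \<open>\<pi>\<close> turns the Riemann sums of the composed
  function into those of \<open>f\<close> with another base point, and the limit does not depend on
  that point.\<close>

lemma mu_f_symm:
  fixes f :: "real^2 \<Rightarrow> real"
  assumes \<mu>: "is_mu_f \<alpha> p K \<mu>" and f: "continuous_on K f" and \<pi>: "\<pi> permutes UNIV"
  shows "(\<integral>x. f (symm \<pi> x) \<partial>\<mu>) = (\<integral>x. f x \<partial>\<mu>)"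
proof (rule LIMSEQ_unique)
  show "(\<lambda>m. (\<Sum>w\<in>{w. length w = m}. f (symm \<pi> (GW w (p 1)))) / 3 ^ m) \<longlonglongrightarrow> (\<integral>x. f (symm \<pi> x) \<partial>\<mu>)"
    by (rule integral_mu_f[OF \<mu> continuous_symm_comp[OF \<pi> f] vertex_in_K])
  have "(\<Sum>w\<in>{w. length w = m}. f (symm \<pi> (GW w (p 1)))) = (\<Sum>w\<in>{w. length w = m}. f (GW w (symm \<pi> (p 1))))" for m
    unfolding symm_GW by (rule sum.reindex_bij_betw[OF map_words_bij[OF \<pi>]])
  then show "(\<lambda>m. (\<Sum>w\<in>{w. length w = m}. f (symm \<pi> (GW w (p 1)))) / 3 ^ m) \<longlonglongrightarrow> (\<integral>x. f x \<partial>\<mu>)"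
    using integral_mu_f[OF \<mu> f symm_in_K[OF \<pi> vertex_in_K]] by simp
qed

text \<open>At level \<open>m + 1\<close> only words starting with \<open>i\<close> contribute,
  which leaves a sum of level \<open>m\<close> and the factor 1/3.\<close>

lemma mu_f_Tr:
  assumes \<mu>: "is_mu_f \<alpha> p K \<mu>" and u: "continuous_on K u" "\<And>i. u (p i) = 0" and v: "continuous_on K v"
  shows "(\<integral>x. Tr i u x * v x \<partial>\<mu>) = (\<integral>x. u x * v (GG i x) \<partial>\<mu>) / 3"
proof (rule LIMSEQ_unique)
  have c1: "continuous_on K (\<lambda>x. Tr i u x * v x)"
    by (intro continuous_intros continuous_Tr u v)
  have c2: "continuous_on K (\<lambda>x. u x * v (GG i x))"
    by (intro continuous_intros u continuous_on_compose2[OF v continuous_G]) (auto intro: G_in_K)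
  show "(\<lambda>m. (\<Sum>w\<in>{w. length w = Suc m}. Tr i u (GW w (p 1)) * v (GW w (p 1))) / 3 ^ Suc m) \<longlonglongrightarrow> (\<integral>x. Tr i u x * v x \<partial>\<mu>)"
    using LIMSEQ_Suc[OF integral_mu_f[OF \<mu> c1 vertex_in_K]] by simp
  have "(\<Sum>w\<in>{w. length w = Suc m}. Tr i u (GW w (p 1)) * v (GW w (p 1)))
     = (\<Sum>w\<in>{w. length w = m}. u (GW w (p 1)) * v (GG i (GW w (p 1))))" for m
  proof -
    have "(\<Sum>w\<in>{w. length w = Suc m}. Tr i u (GW w (p 1)) * v (GW w (p 1)))
      = (\<Sum>j\<in>UNIV. if j = i then (\<Sum>w\<in>{w. length w = m}. u (GW w (p 1)) * v (GG i (GW w (p 1)))) else 0)"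
      unfolding sum_words_Suc by (intro sum.cong refl) (auto simp: Tr_G GW_in_K vertex_in_K)
    then show ?thesis by simp
  qed
  then show "(\<lambda>m. (\<Sum>w\<in>{w. length w = Suc m}. Tr i u (GW w (p 1)) * v (GW w (p 1))) / 3 ^ Suc m)
     \<longlonglongrightarrow> (\<integral>x. u x * v (GG i x) \<partial>\<mu>) / 3"
    using tendsto_divide[OF integral_mu_f[OF \<mu> c2 vertex_in_K] tendsto_const[of 3]]
    by (simp add: mult.commute)
qed

section \<open>The edge measure \<open>\<mu>l\<close> through integrals along edges\<close>

lemma GW_affine: "GW w ((1 - t) *\<^sub>R x + t *\<^sub>R y) = (1 - t) *\<^sub>R GW w x + t *\<^sub>R GW w y"
proof (induction w)
  case (Cons i w)
  have "GG i ((1 - t) *\<^sub>R a + t *\<^sub>R b) = (1 - t) *\<^sub>R GG i a + t *\<^sub>R GG i b" for a b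
    by (simp add: G_eq algebra_simps)
  then show ?case using Cons by simp
qed simp

lemma X_affine: "X w i t = (1 - t) *\<^sub>R X w i 0 + t *\<^sub>R X w i 1"
  by (simp add: xi_def GW_affine)

lemma X_ends_distinct: "X w i 0 \<noteq> X w i 1"
proof
  assume "X w i 0 = X w i 1"
  then have "dist (GW w (X [] i 0)) (GW w (X [] i 1)) = 0" by (simp add: X_conv[symmetric])
  then have "X [] i 0 = X [] i 1" using s by (simp add: dist_GW)
  then show False using edge_endpoints_distinct[of i] by (simp add: X_endpoints)
qed

lemma X_line_inj: "X w i t = X w i t' \<longleftrightarrow> t = t'"
proof
  assume "X w i t = X w i t'"
  then have "(t - t') *\<^sub>R (X w i 1 - X w i 0) = 0"
    by (subst (asm) (1 2) X_affine) (simp add: algebra_simps)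
  then show "t = t'" using X_ends_distinct[of w i] by simp
qed simp

lemma edgew_eq: "edgew \<alpha> p w i = X w i ` {0<..<1}"
  unfolding edgew_def edge_eq image_image by (subst X_conv[symmetric]) simp

lemma edgew_borel: "edgew \<alpha> p w i \<in> sets borel"
proof -
  have "edgew \<alpha> p w i = X w i ` {0..1} - X w i ` {0, 1}"
    unfolding edgew_eq by (subst image_set_diff[symmetric]) (auto simp: inj_on_def X_line_inj intro!: arg_cong[where f = "image _"])
  moreover have "closed (X w i ` {0..1})"
    by (intro compact_imp_closed compact_continuous_image continuous_X) simp
  ultimately show ?thesis by auto
qed

lemma edgew_subset_K: "edgew \<alpha> p w i \<subseteq> K"
  unfolding edgew_eq by (auto intro!: X_in_K)

text \<open>On one edge, \<open>\<mu>\<close> is a constant multiple of the image of Lebesgue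
  measure on (0,1) under \<open>X w i\<close>; the length of the edge cancels in the quotient of the
  \<open>edge_length\<close> terms.\<close>

lemma mu_l_edge:
  fixes f :: "real^2 \<Rightarrow> real"
  assumes \<mu>: "is_mu_l \<alpha> p K \<beta> \<mu>" and \<beta>: "0 < \<beta>" "\<beta> < 1/3" and f: "continuous_on K f"
  shows "(\<integral>x. indicator (edgew \<alpha> p w i) x * f x \<partial>\<mu>)
    = (1/3 - \<beta>) * \<beta> ^ length w * (\<integral>t. f (X w i t) \<partial>leb01)"
proof -
  define E where "E = edgew \<alpha> p w i"
  define c where "c = (1/3 - \<beta>) * \<beta> ^ length w"
  have c: "0 \<le> c" using \<beta> by (simp add: c_def)
  have pr: "borel_prob_on K \<mu>" using \<mu> by (simp add: is_mu_l_def)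
  have st: "sets \<mu> = sets (restrict_space borel K)" using pr by (simp add: borel_prob_on_def)
  note sp = finite_measure_borel_prob_on[OF pr]
  have Kb: "K \<in> sets borel" using closed_K by simp
  have sb: "B \<in> sets \<mu> \<longleftrightarrow> B \<in> sets borel \<and> B \<subseteq> K" for B
    unfolding st using Kb by (subst sets_restrict_space_iff) auto
  have Es: "E \<in> sets \<mu>" unfolding sb E_def using edgew_borel edgew_subset_K by blast
  have Xb: "X w i \<in> borel_measurable borel" by (intro borel_measurable_continuous_onI continuous_X)
  have Xm: "X w i \<in> measurable leb01 \<mu>"
  proof (rule measurableI)
    fix t assume "t \<in> space leb01"
    then show "X w i t \<in> space \<mu>" using sp(1) by (auto intro!: X_in_K)
  next
    fix B assume "B \<in> sets \<mu>"
    then have "X w i -` B \<in> sets borel" using measurable_sets[OF Xb, of B] sb by simp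
    then show "X w i -` B \<inter> space leb01 \<in> sets leb01"
      unfolding leb01_def by (auto simp: sets_restrict_space_iff space_restrict_space)
  qed
  have meas: "emeasure \<mu> (E \<inter> B) = ennreal c * emeasure leb01 (X w i -` B \<inter> space leb01)" if B: "B \<in> sets \<mu>" for B
  proof -
    have EB: "E \<inter> B \<in> sets borel" "E \<inter> B \<subseteq> E" using B Es sb by auto
    have "{t \<in> {0<..<1}. X w i t \<in> E} = {0<..<1}" unfolding E_def edgew_eq by auto
    then have le: "edge_length \<alpha> p w i E = dist (X w i 0) (X w i 1)"
      unfolding edge_length_def by simp
    have seq: "{t \<in> {0<..<1}. X w i t \<in> E \<inter> B} = X w i -` B \<inter> space leb01"
      unfolding E_def edgew_eq by auto
    have "emeasure \<mu> (E \<inter> B) = ennreal (c * (edge_length \<alpha> p w i (E \<inter> B) / edge_length \<alpha> p w i E))"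
      using \<mu> EB unfolding is_mu_l_def E_def c_def by blast
    also have "edge_length \<alpha> p w i (E \<inter> B) / edge_length \<alpha> p w i E = measure lborel (X w i -` B \<inter> space leb01)"
      unfolding le using X_ends_distinct[of w i] unfolding edge_length_def seq by simp
    also have "measure lborel (X w i -` B \<inter> space leb01) = measure leb01 (X w i -` B \<inter> space leb01)"
      unfolding leb01_def by (subst measure_restrict_space) (auto simp: space_restrict_space)
    finally show ?thesis using c by (simp add: ennreal_mult' leb01.emeasure_eq_measure)
  qed
  have "density \<mu> (\<lambda>x. ennreal (indicator E x)) = density (distr leb01 \<mu> (X w i)) (\<lambda>x. ennreal c)"
  proof (rule measure_eqI)
    fix B assume "B \<in> sets (density \<mu> (\<lambda>x. ennreal (indicator E x)))"
    then have B: "B \<in> sets \<mu>" by simp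
    have "emeasure (density \<mu> (\<lambda>x. ennreal (indicator E x))) B = (\<integral>\<^sup>+x. ennreal (indicator E x) * indicator B x \<partial>\<mu>)"
      using B Es by (intro emeasure_density) auto
    also have "\<dots> = (\<integral>\<^sup>+x. indicator (E \<inter> B) x \<partial>\<mu>)"
      by (intro nn_integral_cong) (auto split: split_indicator)
    also have "\<dots> = emeasure \<mu> (E \<inter> B)" using B Es by simp
    also have "\<dots> = ennreal c * emeasure (distr leb01 \<mu> (X w i)) B"
      using B Xm by (simp add: meas emeasure_distr)
    also have "\<dots> = emeasure (density (distr leb01 \<mu> (X w i)) (\<lambda>x. ennreal c)) B"
      using B by (subst emeasure_density) (auto simp: nn_integral_cmult_indicator)
    finally show "emeasure (density \<mu> (\<lambda>x. ennreal (indicator E x))) B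
      = emeasure (density (distr leb01 \<mu> (X w i)) (\<lambda>x. ennreal c)) B" .
  qed simp
  then have "(\<integral>x. f x \<partial>density \<mu> (\<lambda>x. ennreal (indicator E x)))
     = (\<integral>x. f x \<partial>density (distr leb01 \<mu> (X w i)) (\<lambda>x. ennreal c))" by simp
  moreover have fm: "f \<in> borel_measurable \<mu>" by (rule measurable_continuous_on_K[OF st f])
  moreover have "(\<integral>x. f x \<partial>density \<mu> (\<lambda>x. ennreal (indicator E x))) = (\<integral>x. indicator E x * f x \<partial>\<mu>)"
    using fm Es by (subst integral_real_density) auto
  moreover have "(\<integral>x. f x \<partial>density (distr leb01 \<mu> (X w i)) (\<lambda>x. ennreal c)) = (\<integral>x. c * f x \<partial>distr leb01 \<mu> (X w i))"
    using fm c by (subst integral_real_density) auto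
  moreover have "(\<integral>x. c * f x \<partial>distr leb01 \<mu> (X w i)) = c * (\<integral>t. f (X w i t) \<partial>leb01)"
    using fm Xm by (subst integral_distr) auto
  ultimately show ?thesis by (simp add: E_def c_def)
qed

text \<open>The edges are pairwise disjoint and carry all mass, so the sums over words shorter than
  \<open>m\<close> integrate truncations of \<open>f\<close>, dominated by its absolute
  value.\<close>

lemma integral_mu_l:
  fixes f :: "real^2 \<Rightarrow> real"
  assumes \<mu>: "is_mu_l \<alpha> p K \<beta> \<mu>" and \<beta>: "0 < \<beta>" "\<beta> < 1/3" and f: "continuous_on K f"
  shows "(\<lambda>m. \<Sum>k<m. (1/3 - \<beta>) * \<beta> ^ k * (\<Sum>w\<in>{w. length w = k}. \<Sum>i\<in>UNIV. \<integral>t. f (X w i t) \<partial>leb01))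
    \<longlonglongrightarrow> (\<integral>x. f x \<partial>\<mu>)"
proof -
  have pr: "borel_prob_on K \<mu>" using \<mu> by (simp add: is_mu_l_def)
  have st: "sets \<mu> = sets (restrict_space borel K)" using pr by (simp add: borel_prob_on_def)
  note sp = finite_measure_borel_prob_on[OF pr]
  interpret finite_measure \<mu> by (rule sp(2))
  have Kb: "K \<in> sets borel" using closed_K by simp
  have [measurable]: "edgew \<alpha> p w i \<in> sets \<mu>" for w i
    unfolding st using Kb edgew_borel edgew_subset_K by (subst sets_restrict_space_iff) auto
  have [measurable]: "f \<in> borel_measurable \<mu>" by (rule measurable_continuous_on_K[OF st f])
  have intf: "integrable \<mu> f" by (rule integrable_continuous_on_K[OF compact_K pr f])
  have inte: "integrable \<mu> (\<lambda>x. indicator (edgew \<alpha> p w i) x * f x)" for w i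
    by (rule Bochner_Integration.integrable_bound[OF intf]) (auto split: split_indicator)
  define F where "F m x = (\<Sum>k<m. \<Sum>w\<in>{w. length w = k}. \<Sum>i\<in>UNIV. indicator (edgew \<alpha> p w i) x * f x)" for m x
  have F_edge: "F m x = (if length w < m then f x else 0)" if x: "x \<in> edgew \<alpha> p w i" for m x w i
  proof -
    have ind: "indicator (edgew \<alpha> p v j) x = (if v = w \<and> j = i then 1 else 0 :: real)" for v j
    proof -
      have "v = w \<and> j = i" if xv: "x \<in> edgew \<alpha> p v j"
      proof -
        obtain t t' where "t \<in> {0<..<1}" "t' \<in> {0<..<1}" "X v j t = X w i t'"
          using xv x unfolding edgew_eq by fastforce
        then show ?thesis using X_inj by blast
      qed
      then have "x \<in> edgew \<alpha> p v j \<longleftrightarrow> v = w \<and> j = i" using x by metis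
      then show ?thesis by (simp add: indicator_def)
    qed
    have "(\<Sum>j\<in>UNIV. indicator (edgew \<alpha> p v j) x * f x) = (if v = w then f x else 0)" for v
    proof -
      have "(\<Sum>j\<in>UNIV. indicator (edgew \<alpha> p v j) x * f x) = (\<Sum>j\<in>UNIV. if j = i then (if v = w then f x else 0) else 0)"
        by (rule sum.cong) (simp_all add: ind)
      then show ?thesis by simp
    qed
    then have "F m x = (\<Sum>k<m. \<Sum>v\<in>{v. length v = k}. if v = w then f x else 0)"
      unfolding F_def by simp
    also have "\<dots> = (\<Sum>k<m. if k = length w then f x else 0)"
    proof (rule sum.cong[OF refl])
      fix k
      show "(\<Sum>v\<in>{v. length v = k}. if v = w then f x else 0) = (if k = length w then f x else 0)"
        by (subst sum.delta[OF finite_words]) auto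
    qed
    finally have "F m x = (\<Sum>k<m. if k = length w then f x else 0)" .
    then show ?thesis by simp
  qed
  have un: "(\<Union>w i. edgew \<alpha> p w i) = (\<Union>k. \<Union>w\<in>{w. length w = k}. \<Union>i\<in>UNIV. edgew \<alpha> p w i)" by auto
  have US: "(\<Union>w i. edgew \<alpha> p w i) \<in> sets \<mu>"
    unfolding un by (intro sets.countable_UN sets.finite_UN finite_words image_subsetI) auto
  have "emeasure \<mu> (\<Union>w i. edgew \<alpha> p w i) = 1"
    using \<mu> by (simp add: is_mu_l_def)
  then have "emeasure \<mu> (space \<mu> - (\<Union>w i. edgew \<alpha> p w i)) = 0"
    using sp(3) by (subst emeasure_compl[OF US]) auto
  then have AE: "AE x in \<mu>. x \<in> (\<Union>w i. edgew \<alpha> p w i)"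
    by (intro AE_I[where N = "space \<mu> - (\<Union>w i. edgew \<alpha> p w i)"] sets.Diff US sets.top)
      (auto simp del: UN_simps)
  have "(\<lambda>m. \<integral>x. F m x \<partial>\<mu>) \<longlonglongrightarrow> (\<integral>x. f x \<partial>\<mu>)"
  proof (rule integral_dominated_convergence)
    show "integrable \<mu> (\<lambda>x. \<bar>f x\<bar>)" using intf by auto
    show "F m \<in> borel_measurable \<mu>" for m unfolding F_def[abs_def] by measurable
    show "AE x in \<mu>. (\<lambda>m. F m x) \<longlonglongrightarrow> f x"
      using AE
    proof eventually_elim
      case (elim x)
      then obtain w i where x: "x \<in> edgew \<alpha> p w i" by blast
      show ?case
        by (rule tendsto_eventually)
          (use F_edge[OF x] in \<open>auto simp: eventually_sequentially intro!: exI[of _ "Suc (length w)"]\<close>)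
    qed
    show "AE x in \<mu>. norm (F m x) \<le> \<bar>f x\<bar>" for m
      using AE
    proof eventually_elim
      case (elim x)
      then obtain w i where x: "x \<in> edgew \<alpha> p w i" by blast
      then show ?case using F_edge[OF x, of m] by auto
    qed
  qed auto
  moreover have "(\<integral>x. F m x \<partial>\<mu>) = (\<Sum>k<m. (1/3 - \<beta>) * \<beta> ^ k * (\<Sum>w\<in>{w. length w = k}. \<Sum>i\<in>UNIV. \<integral>t. f (X w i t) \<partial>leb01))" for m
  proof -
    have "(\<integral>x. F m x \<partial>\<mu>) = (\<Sum>k<m. \<Sum>w\<in>{w. length w = k}. \<Sum>i\<in>UNIV. \<integral>x. indicator (edgew \<alpha> p w i) x * f x \<partial>\<mu>)"
      unfolding F_def by (simp only: Bochner_Integration.integral_sum Bochner_Integration.integrable_sum inte)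
    also have "\<dots> = (\<Sum>k<m. \<Sum>w\<in>{w. length w = k}. \<Sum>i\<in>UNIV. (1/3 - \<beta>) * \<beta> ^ k * (\<integral>t. f (X w i t) \<partial>leb01))"
      by (intro sum.cong refl) (auto simp: mu_l_edge[OF \<mu> \<beta> f])
    finally show ?thesis by (simp add: sum_distrib_left)
  qed
  ultimately show ?thesis by simp
qed

lemma symm_X:
  assumes "\<pi> permutes UNIV"
  shows "(\<forall>t. symm \<pi> (X w i t) = X (map \<pi> w) (\<pi> i) t) \<or> (\<forall>t. symm \<pi> (X w i t) = X (map \<pi> w) (\<pi> i) (1 - t))"
  using symm_X0[OF assms, of i] by (subst (1 3) X_conv, subst (1 2) X_conv[of "map \<pi> w"]) (auto simp: symm_GW)

text \<open>Edge masses depend only on the length of the word, and reversing an edge does not change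
  the integral along it.\<close>

lemma mu_l_symm:
  fixes f :: "real^2 \<Rightarrow> real"
  assumes \<mu>: "is_mu_l \<alpha> p K \<beta> \<mu>" and \<beta>: "0 < \<beta>" "\<beta> < 1/3" and f: "continuous_on K f" and \<pi>: "\<pi> permutes UNIV"
  shows "(\<integral>x. f (symm \<pi> x) \<partial>\<mu>) = (\<integral>x. f x \<partial>\<mu>)"
proof (rule LIMSEQ_unique)
  show "(\<lambda>m. \<Sum>k<m. (1/3 - \<beta>) * \<beta> ^ k * (\<Sum>w\<in>{w. length w = k}. \<Sum>i\<in>UNIV. \<integral>t. f (symm \<pi> (X w i t)) \<partial>leb01))
    \<longlonglongrightarrow> (\<integral>x. f (symm \<pi> x) \<partial>\<mu>)"
    by (rule integral_mu_l[OF \<mu> \<beta> continuous_symm_comp[OF \<pi> f]])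
  have "(\<Sum>w\<in>{w. length w = k}. \<Sum>i\<in>UNIV. \<integral>t. f (symm \<pi> (X w i t)) \<partial>leb01)
    = (\<Sum>w\<in>{w. length w = k}. \<Sum>i\<in>UNIV. \<integral>t. f (X w i t) \<partial>leb01)" for k
  proof -
    have "(\<integral>t. f (symm \<pi> (X w i t)) \<partial>leb01) = (\<integral>t. f (X (map \<pi> w) (\<pi> i) t) \<partial>leb01)" for w i
      using symm_X[OF \<pi>, of w i] integral_leb01_reverse[of "\<lambda>t. f (X (map \<pi> w) (\<pi> i) t)"] by auto
    then have "(\<Sum>w\<in>{w. length w = k}. \<Sum>i\<in>UNIV. \<integral>t. f (symm \<pi> (X w i t)) \<partial>leb01)
      = (\<Sum>w\<in>{w. length w = k}. \<Sum>i\<in>UNIV. \<integral>t. f (X (map \<pi> w) (\<pi> i) t) \<partial>leb01)" by simp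
    also have "\<dots> = (\<Sum>w\<in>{w. length w = k}. \<Sum>i\<in>UNIV. \<integral>t. f (X (map \<pi> w) i t) \<partial>leb01)"
      by (intro sum.cong refl sum.reindex_bij_betw permutes_imp_bij[OF \<pi>])
    also have "\<dots> = (\<Sum>w\<in>{w. length w = k}. \<Sum>i\<in>UNIV. \<integral>t. f (X w i t) \<partial>leb01)"
      by (rule sum.reindex_bij_betw[OF map_words_bij[OF \<pi>]])
    finally show ?thesis .
  qed
  then show "(\<lambda>m. \<Sum>k<m. (1/3 - \<beta>) * \<beta> ^ k * (\<Sum>w\<in>{w. length w = k}. \<Sum>i\<in>UNIV. \<integral>t. f (symm \<pi> (X w i t)) \<partial>leb01))
    \<longlonglongrightarrow> (\<integral>x. f x \<partial>\<mu>)"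
    using integral_mu_l[OF \<mu> \<beta> f] by simp
qed

text \<open>The edges of the empty word see the value zero; every edge inside cell \<open>i\<close>
  has one letter more than its preimage, which costs one factor \<open>\<beta>\<close>.\<close>

lemma mu_l_Tr:
  assumes \<mu>: "is_mu_l \<alpha> p K \<beta> \<mu>" and \<beta>: "0 < \<beta>" "\<beta> < 1/3"
    and u: "continuous_on K u" "\<And>i. u (p i) = 0" and v: "continuous_on K v"
  shows "(\<integral>x. Tr i u x * v x \<partial>\<mu>) = \<beta> * (\<integral>x. u x * v (GG i x) \<partial>\<mu>)"
proof (rule LIMSEQ_unique)
  define S where "S f k = (\<Sum>w\<in>{w. length w = k}. \<Sum>i\<in>UNIV. \<integral>t. f (X w i t) \<partial>leb01)" for f :: "real^2 \<Rightarrow> real" and k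
  have c1: "continuous_on K (\<lambda>x. Tr i u x * v x)"
    by (intro continuous_intros continuous_Tr u v)
  have c2: "continuous_on K (\<lambda>x. u x * v (GG i x))"
    by (intro continuous_intros u continuous_on_compose2[OF v continuous_G]) (auto intro: G_in_K)
  show "(\<lambda>m. \<Sum>k<Suc m. (1/3 - \<beta>) * \<beta> ^ k * S (\<lambda>x. Tr i u x * v x) k) \<longlonglongrightarrow> (\<integral>x. Tr i u x * v x \<partial>\<mu>)"
    using LIMSEQ_Suc[OF integral_mu_l[OF \<mu> \<beta> c1]] unfolding S_def .
  have S0: "S (\<lambda>x. Tr i u x * v x) 0 = 0"
  proof -
    have "(\<integral>t. Tr i u (X [] j t) * v (X [] j t) \<partial>leb01) = (\<integral>t. 0 \<partial>leb01)" for j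
      by (rule Bochner_Integration.integral_cong) (auto simp: Tr_X[of u, OF u(2)])
    then show ?thesis by (simp add: S_def)
  qed
  have SS: "S (\<lambda>x. Tr i u x * v x) (Suc k) = S (\<lambda>x. u x * v (GG i x)) k" for k
  proof -
    have "(\<integral>t. Tr i u (X (j # w) l t) * v (X (j # w) l t) \<partial>leb01)
      = (\<integral>t. (if j = i then u (X w l t) * v (GG i (X w l t)) else 0) \<partial>leb01)" for j w l
      by (rule Bochner_Integration.integral_cong) (auto simp: X_Cons Tr_G X_in_K)
    then have "S (\<lambda>x. Tr i u x * v x) (Suc k) = (\<Sum>j\<in>UNIV. if j = i then S (\<lambda>x. u x * v (GG i x)) k else 0)"
      unfolding S_def sum_words_Suc by (intro sum.cong refl) auto
    then show ?thesis by simp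
  qed
  have "(\<Sum>k<Suc m. (1/3 - \<beta>) * \<beta> ^ k * S (\<lambda>x. Tr i u x * v x) k)
    = \<beta> * (\<Sum>k<m. (1/3 - \<beta>) * \<beta> ^ k * S (\<lambda>x. u x * v (GG i x)) k)" for m
    unfolding sum.lessThan_Suc_shift S0 SS by (simp add: sum_distrib_left mult_ac)
  then show "(\<lambda>m. \<Sum>k<Suc m. (1/3 - \<beta>) * \<beta> ^ k * S (\<lambda>x. Tr i u x * v x) k) \<longlonglongrightarrow> \<beta> * (\<integral>x. u x * v (GG i x) \<partial>\<mu>)"
    using tendsto_mult[OF tendsto_const[of \<beta>] integral_mu_l[OF \<mu> \<beta> c2]] unfolding S_def by simp
qed

text \<open>Serves both measures at once: \<open>c\<close> is \<open>\<beta>\<close> for one and 1/3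
  for the other.\<close>

lemma integral_TW:
  assumes Tr: "\<And>i u v. continuous_on K u \<Longrightarrow> (\<And>i. u (p i) = 0) \<Longrightarrow> continuous_on K v \<Longrightarrow>
      (\<integral>x. Tr i u x * v x \<partial>\<mu>) = c * (\<integral>x. u x * v (GG i x) \<partial>\<mu>)"
    and u: "continuous_on K u" "\<And>i. u (p i) = 0" and v: "continuous_on K v"
  shows "(\<integral>x. TW w u x * v x \<partial>\<mu>) = c ^ length w * (\<integral>x. u x * v (GW w x) \<partial>\<mu>)"
  using v
proof (induction w arbitrary: v)
  case (Cons i w)
  have cv: "continuous_on K (\<lambda>x. v (GG i x))"
    by (rule continuous_on_compose2[OF Cons.prems continuous_G]) (auto intro: G_in_K)
  have "(\<integral>x. TW (i # w) u x * v x \<partial>\<mu>) = c * (\<integral>x. TW w u x * v (GG i x) \<partial>\<mu>)"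
    using TW_props[OF u, of w] Tr[of "TW w u" v i] Cons.prems by simp
  then show ?case using Cons.IH[OF cv] by simp
qed simp

lemma mu_l_TW:
  assumes "is_mu_l \<alpha> p K \<beta> \<mu>" "0 < \<beta>" "\<beta> < 1/3"
    and "continuous_on K u" "\<And>i. u (p i) = 0" "continuous_on K v"
  shows "(\<integral>x. TW w u x * v x \<partial>\<mu>) = \<beta> ^ length w * (\<integral>x. u x * v (GW w x) \<partial>\<mu>)"
  by (rule integral_TW) (use assms mu_l_Tr in auto)

lemma mu_f_TW:
  assumes "is_mu_f \<alpha> p K \<mu>" "continuous_on K u" "\<And>i. u (p i) = 0" "continuous_on K v"
  shows "(\<integral>x. TW w u x * v x \<partial>\<mu>) = (1/3) ^ length w * (\<integral>x. u x * v (GW w x) \<partial>\<mu>)"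
  by (rule integral_TW) (use assms mu_f_Tr in auto)

text \<open>\<open>measure_of\<close> returns the intended set function only if that is countably
  additive, so this is settled before integrals are computed.\<close>

lemma mu_eta_props:
  fixes g :: "real^2 \<Rightarrow> real"
  assumes l: "borel_prob_on K \<mu>l" and f: "borel_prob_on K \<mu>f" and \<eta>: "0 \<le> \<eta>" "\<eta> \<le> 1"
  shows "borel_prob_on K (mu_eta K \<eta> \<mu>l \<mu>f)"
    and "continuous_on K g \<Longrightarrow> (\<integral>x. g x \<partial>mu_eta K \<eta> \<mu>l \<mu>f) = \<eta> * (\<integral>x. g x \<partial>\<mu>l) + (1 - \<eta>) * (\<integral>x. g x \<partial>\<mu>f)"
proof -
  define M where "M = mu_eta K \<eta> \<mu>l \<mu>f"
  define \<Sigma> where "\<Sigma> = sets (restrict_space borel K)"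
  have spK: "space (restrict_space borel K) = K" by (simp add: space_restrict_space)
  have sl: "sets \<mu>l = \<Sigma>" "sets \<mu>f = \<Sigma>" using l f by (auto simp: borel_prob_on_def \<Sigma>_def)
  have sig: "sigma_algebra K \<Sigma>" unfolding \<Sigma>_def using sets.sigma_algebra_axioms[of "restrict_space borel K"] spK by simp
  have sub: "\<Sigma> \<subseteq> Pow K" unfolding \<Sigma>_def using sets.space_closed[of "restrict_space borel K"] spK by simp
  have sM: "sets M = \<Sigma>"
    unfolding M_def mu_eta_def \<Sigma>_def[symmetric] using sub sig by (simp add: sigma_algebra.sigma_sets_eq)
  have em: "emeasure M B = ennreal \<eta> * emeasure \<mu>l B + ennreal (1 - \<eta>) * emeasure \<mu>f B" if "B \<in> \<Sigma>" for B
  proof (rule emeasure_measure_of[where \<Omega> = K and A = \<Sigma> and M = M])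
    show "M = measure_of K \<Sigma> (\<lambda>B. ennreal \<eta> * emeasure \<mu>l B + ennreal (1 - \<eta>) * emeasure \<mu>f B)"
      by (simp add: M_def mu_eta_def \<Sigma>_def)
    show "countably_additive (sets M) (\<lambda>B. ennreal \<eta> * emeasure \<mu>l B + ennreal (1 - \<eta>) * emeasure \<mu>f B)"
    proof (rule countably_additiveI)
      fix A :: "nat \<Rightarrow> (real^2) set"
      assume A: "range A \<subseteq> sets M" "disjoint_family A"
      have "(\<Sum>i. ennreal \<eta> * emeasure \<mu>l (A i) + ennreal (1 - \<eta>) * emeasure \<mu>f (A i))
        = ennreal \<eta> * (\<Sum>i. emeasure \<mu>l (A i)) + ennreal (1 - \<eta>) * (\<Sum>i. emeasure \<mu>f (A i))"
        by (simp add: suminf_add[symmetric] ennreal_suminf_cmult)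
      then show "(\<Sum>i. ennreal \<eta> * emeasure \<mu>l (A i) + ennreal (1 - \<eta>) * emeasure \<mu>f (A i))
        = ennreal \<eta> * emeasure \<mu>l (\<Union>i. A i) + ennreal (1 - \<eta>) * emeasure \<mu>f (\<Union>i. A i)"
        using A sM sl by (simp add: suminf_emeasure)
    qed
    show "positive (sets M) (\<lambda>B. ennreal \<eta> * emeasure \<mu>l B + ennreal (1 - \<eta>) * emeasure \<mu>f B)"
      by (simp add: positive_def)
  qed (use sub sM that in auto)
  have KS: "K \<in> \<Sigma>" using sigma_algebra.sigma_sets_eq[OF sig] sigma_sets_top by metis
  have "emeasure M K = 1"
    using em[OF KS] l f \<eta> by (simp add: borel_prob_on_def flip: ennreal_plus)
  then show prM: "borel_prob_on K (mu_eta K \<eta> \<mu>l \<mu>f)"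
    using sM by (simp add: borel_prob_on_def M_def \<Sigma>_def)
  assume g: "continuous_on K g"
  have "compact (g ` K)" by (rule compact_continuous_image[OF g compact_K])
  then obtain C where "\<forall>y\<in>g ` K. norm y \<le> C" using compact_imp_bounded bounded_iff by metis
  \<comment> \<open>Adding the bound \<open>C\<close> makes the function nonnegative, so the formula
    is taken from nonnegative integrals and the constant removed at the end.\<close>
  then have C: "0 \<le> g x + C" if "x \<in> K" for x using that by fastforce
  have gC: "continuous_on K (\<lambda>x. g x + C)" by (intro continuous_intros g)
  have eq: "(\<integral>\<^sup>+x. ennreal (g x + C) \<partial>N) = ennreal ((\<integral>x. g x \<partial>N) + C)"
    and ge: "0 \<le> (\<integral>x. g x \<partial>N) + C" if N: "borel_prob_on K N" for N
  proof -
    note sp = finite_measure_borel_prob_on[OF N]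
    interpret finite_measure N by (rule sp(2))
    have i: "integrable N g" "integrable N (\<lambda>x. g x + C)"
      by (rule integrable_continuous_on_K[OF compact_K N]; fact)+
    have "(\<integral>x. g x + C \<partial>N) = (\<integral>x. g x \<partial>N) + C"
      using i sp(3) by (simp add: measure_def)
    moreover have "(\<integral>\<^sup>+x. ennreal (g x + C) \<partial>N) = ennreal (\<integral>x. g x + C \<partial>N)"
      by (rule nn_integral_eq_integral[OF i(2)]) (use C sp(1) in auto)
    moreover have "0 \<le> (\<integral>x. g x + C \<partial>N)"
      by (rule Bochner_Integration.integral_nonneg) (use C sp(1) in auto)
    ultimately show "(\<integral>\<^sup>+x. ennreal (g x + C) \<partial>N) = ennreal ((\<integral>x. g x \<partial>N) + C)" "0 \<le> (\<integral>x. g x \<partial>N) + C"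
      by simp_all
  qed
  have "(\<lambda>x. ennreal (g x + C)) \<in> borel_measurable M"
    using measurable_continuous_on_K[OF _ gC, of M] sM by (simp add: \<Sigma>_def)
  then have "(\<integral>\<^sup>+x. ennreal (g x + C) \<partial>M)
     = ennreal \<eta> * (\<integral>\<^sup>+x. ennreal (g x + C) \<partial>\<mu>l) + ennreal (1 - \<eta>) * (\<integral>\<^sup>+x. ennreal (g x + C) \<partial>\<mu>f)"
    by (intro nn_integral_mixture) (use sM sl em in auto)
  then have "ennreal ((\<integral>x. g x \<partial>M) + C) = ennreal (\<eta> * ((\<integral>x. g x \<partial>\<mu>l) + C) + (1 - \<eta>) * ((\<integral>x. g x \<partial>\<mu>f) + C))"
    using eq[OF l] eq[OF f] eq[OF prM] ge[OF l] ge[OF f] \<eta>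
    by (simp add: M_def ennreal_mult ennreal_plus)
  then have "(\<integral>x. g x \<partial>M) + C = \<eta> * ((\<integral>x. g x \<partial>\<mu>l) + C) + (1 - \<eta>) * ((\<integral>x. g x \<partial>\<mu>f) + C)"
    using ge[OF l] ge[OF f] ge[OF prM] \<eta> by (subst (asm) ennreal_inj) (auto simp: M_def)
  then show "(\<integral>x. g x \<partial>mu_eta K \<eta> \<mu>l \<mu>f) = \<eta> * (\<integral>x. g x \<partial>\<mu>l) + (1 - \<eta>) * (\<integral>x. g x \<partial>\<mu>f)"
    by (simp add: M_def algebra_simps)
qed

end

subsection \<open>Oscillation and equicontinuity\<close>

context gasket
begin

text \<open>All summands of the recursion are nonnegative, so each stays below \<open>c\<close>
  after its division by \<open>r 1\<close> or \<open>\<rho> 1\<close>; this is the source of the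
  decay from cell to cell.\<close>

lemma BN_subcell_le:
  assumes m: "matching_pairs r \<rho>" and c: "\<And>m N. BN m r \<rho> N u u \<le> c"
  shows "BN m (sh r) (sh \<rho>) N (\<lambda>x. u (GG i x)) (\<lambda>x. u (GG i x)) \<le> r 1 * c"
    and "SB N (\<lambda>t. u (X [] i t)) (\<lambda>t. u (X [] i t)) \<le> \<rho> 1 * c"
proof -
  note mt = matching_1[OF m] matching_sh[OF m]
  define A where "A = (\<Sum>i\<in>UNIV. BN m (sh r) (sh \<rho>) N (\<lambda>x. u (GG i x)) (\<lambda>x. u (GG i x)))"
  define B where "B = (\<Sum>i\<in>UNIV. SB N (\<lambda>t. u (X [] i t)) (\<lambda>t. u (X [] i t)))"
  have a: "BN m (sh r) (sh \<rho>) N (\<lambda>x. u (GG i x)) (\<lambda>x. u (GG i x)) \<le> A"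
    unfolding A_def
    by (rule member_le_sum[of i UNIV "\<lambda>i. BN m (sh r) (sh \<rho>) N (\<lambda>x. u (GG i x)) (\<lambda>x. u (GG i x))"])
      (auto intro: BN_nonneg[OF mt(4)])
  have b: "SB N (\<lambda>t. u (X [] i t)) (\<lambda>t. u (X [] i t)) \<le> B"
    unfolding B_def
    by (rule member_le_sum[of i UNIV "\<lambda>i. SB N (\<lambda>t. u (X [] i t)) (\<lambda>t. u (X [] i t))"])
      (auto intro: SB_nonneg)
  have pos: "0 \<le> A" "0 \<le> B"
    unfolding A_def B_def by (auto intro!: sum_nonneg BN_nonneg[OF mt(4)] SB_nonneg)
  have "A / r 1 + B / \<rho> 1 \<le> c" using c[of "Suc m" N] by (simp add: A_def B_def)
  moreover have "0 \<le> A / r 1" "0 \<le> B / \<rho> 1" using pos mt by simp_all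
  ultimately have "A / r 1 \<le> c" "B / \<rho> 1 \<le> c" by linarith+
  then have "A \<le> r 1 * c" "B \<le> \<rho> 1 * c" using mt by (simp_all add: pos_divide_le_eq mult.commute)
  then show "BN m (sh r) (sh \<rho>) N (\<lambda>x. u (GG i x)) (\<lambda>x. u (GG i x)) \<le> r 1 * c"
    "SB N (\<lambda>t. u (X [] i t)) (\<lambda>t. u (X [] i t)) \<le> \<rho> 1 * c"
    using a b by linarith+
qed

text \<open>The matching condition gives \<open>r 1 < 3 / 5\<close>; the slightly larger 16/25 has
  the rational root 4/5.\<close>

lemma matching_bounds:
  assumes "matching_pairs r \<rho>"
  shows "r 1 \<le> 16 / 25" "r 1 \<le> 1" "\<rho> 1 \<le> 1"
  using matching_1[OF assms] by linarith+

lemma vertex_diff_le: "(u (p j) - u (p k))\<^sup>2 \<le> q0 u u"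
proof -
  have "0 \<le> (u (p 1) - u (p 2))\<^sup>2" "0 \<le> (u (p 2) - u (p 3))\<^sup>2" "0 \<le> (u (p 3) - u (p 1))\<^sup>2" by auto
  then show ?thesis
    using exhaust_3[of j] exhaust_3[of k] unfolding q0_eq_Q0 Q0_def
    by (auto simp: power2_commute)
qed

lemma corner_diff_le:
  assumes m: "matching_pairs r \<rho>" and c: "\<And>m N. BN m r \<rho> N u u \<le> c"
  shows "\<bar>u (GG i (p j)) - u (GG i (p k))\<bar> \<le> sqrt c"
proof -
  have c0: "0 \<le> c" using c[of 0 0] BN_nonneg[OF m, of 0 0 u] by linarith
  have "(u (GG i (p j)) - u (GG i (p k)))\<^sup>2 \<le> r 1 * c"
    using BN_subcell_le(1)[OF m c, where m = 0] vertex_diff_le[of "\<lambda>x. u (GG i x)" j k] order_trans by fastforce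
  also have "\<dots> \<le> c" using matching_bounds[OF m] matching_1[OF m] c0 by (simp add: mult_left_le_one_le)
  finally show ?thesis by (simp add: real_le_rsqrt)
qed

lemma edge_Holder:
  assumes m: "matching_pairs r \<rho>" and c: "\<And>m N. BN m r \<rho> N u u \<le> c" and u: "continuous_on K u"
    and t: "t \<in> {0..1}" "t' \<in> {0..1}"
  shows "(u (X [] i t) - u (X [] i t'))\<^sup>2 \<le> c * \<bar>t - t'\<bar>"
proof -
  have c0: "0 \<le> c" using c[of 0 0] BN_nonneg[OF m, of 0 0 u] by linarith
  have "SB N (\<lambda>t. u (X [] i t)) (\<lambda>t. u (X [] i t)) \<le> c" for N
  proof -
    have "\<rho> 1 * c \<le> c" using matching_bounds[OF m] matching_1[OF m] c0 by (simp add: mult_left_le_one_le)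
    then show ?thesis using BN_subcell_le(2)[OF m c, where N = N and i = i] by linarith
  qed
  from SB_Holder[OF continuous_on_X[OF u] this t(2,1)] show ?thesis .
qed

lemma edge_diff_le:
  assumes m: "matching_pairs r \<rho>" and c: "\<And>m N. BN m r \<rho> N u u \<le> c" and u: "continuous_on K u"
    and t: "t \<in> {0..1}" "t' \<in> {0..1}"
  shows "\<bar>u (X [] i t) - u (X [] i t')\<bar> \<le> sqrt c"
proof -
  have c0: "0 \<le> c" using c[of 0 0] BN_nonneg[OF m, of 0 0 u] by linarith
  have "(u (X [] i t) - u (X [] i t'))\<^sup>2 \<le> c * \<bar>t - t'\<bar>" by (rule edge_Holder[OF m c u t])
  also have "\<dots> \<le> c" using t c0 by (intro mult_left_le) auto
  finally show ?thesis by (simp add: real_le_rsqrt)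
qed

lemma gap_diff_le:
  assumes m: "matching_pairs r \<rho>" and c: "\<And>m N. BN m r \<rho> N u u \<le> c" and u: "continuous_on K u"
    and "i \<noteq> j"
  shows "\<bar>u (GG i (p j)) - u (GG j (p i))\<bar> \<le> sqrt c"
proof -
  have wrap: "(4::3) = 1" "(5::3) = 2" by auto
  have "\<bar>u (X [] k 0) - u (X [] k 1)\<bar> \<le> sqrt c" for k by (rule edge_diff_le[OF m c u]) auto
  from this[of 1] this[of 2] this[of 3] show ?thesis
    using exhaust_3[of i] exhaust_3[of j] assms(4)
    by (auto simp: X_endpoints wrap abs_minus_commute)
qed

text \<open>One connecting edge and one side of cell 1 lead from the corner
  \<open>GG i (p 1)\<close> to \<open>p 1\<close>, each costing at most
  \<open>sqrt c\<close>.\<close>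

lemma cell_base_diff_le:
  assumes m: "matching_pairs r \<rho>" and c: "\<And>m N. BN m r \<rho> N u u \<le> c" and u: "continuous_on K u"
  shows "\<bar>u (GG i (p 1)) - u (p 1)\<bar> \<le> 2 * sqrt c"
proof (cases "i = 1")
  case True
  have "0 \<le> c" using c[of 0 0] BN_nonneg[OF m, of 0 0 u] by linarith
  then show ?thesis using True by (simp add: G_fix)
next
  case False
  have "\<bar>u (GG i (p 1)) - u (GG 1 (p i))\<bar> \<le> sqrt c" by (rule gap_diff_le[OF m c u False])
  moreover have "\<bar>u (GG 1 (p i)) - u (GG 1 (p 1))\<bar> \<le> sqrt c" by (rule corner_diff_le[OF m c])
  ultimately show ?thesis by (simp add: G_fix)
qed

text \<open>Cells of depth \<open>n\<close> are assumed to oscillate by at most \<open>e\<close>.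
  Passing up one level multiplies the energy term by at most 4/5 and adds \<open>2 * sqrt c\<close>;
  the constant 20 is stable under this because \<open>4 / 5 * 20 + 2 \<le> 20\<close>, so depth does
  not accumulate.\<close>

lemma oscillation_step:
  assumes "matching_pairs r \<rho>" "\<And>m N. BN m r \<rho> N u u \<le> c" "continuous_on K u"
    and "\<And>w x. length w = n \<Longrightarrow> x \<in> K \<Longrightarrow> \<bar>u (GW w x) - u (GW w (p 1))\<bar> \<le> e"
    and "x \<in> K"
  shows "\<bar>u x - u (p 1)\<bar> \<le> e + 20 * sqrt c"
  using assms
proof (induction n arbitrary: r \<rho> u c x)
  case 0
  have "0 \<le> c" using 0(2)[of 0 0] BN_nonneg[OF 0(1), of 0 0 u] by linarith
  then have "0 \<le> 20 * sqrt c" by simp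
  moreover have "\<bar>u x - u (p 1)\<bar> \<le> e" using 0(4)[of "[]" x] 0(5) by simp
  ultimately show ?case by linarith
next
  case (Suc n)
  note m = Suc.prems(1) and c = Suc.prems(2) and u = Suc.prems(3)
  have c0: "0 \<le> c" using c[of 0 0] BN_nonneg[OF m, of 0 0 u] by linarith
  \<comment> \<open>Any word of the right length shows that \<open>e\<close> is nonnegative.\<close>
  then have e0: "0 \<le> e" using Suc.prems(4)[of "replicate (Suc n) 1" "p 1"] by (simp add: vertex_in_K)
  show ?case using Suc.prems(5)
  proof (cases rule: K_cases)
    case (cell i y)
    have "\<bar>u (GG i y) - u (GG i (p 1))\<bar> \<le> e + 20 * sqrt (r 1 * c)"
    proof (rule Suc.IH[OF matching_sh[OF m] BN_subcell_le(1)[OF m c]])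
      show "continuous_on K (\<lambda>x. u (GG i x))"
        by (rule continuous_on_compose2[OF u continuous_G]) (auto intro: G_in_K)
      show "\<bar>u (GG i (GW w x)) - u (GG i (GW w (p 1)))\<bar> \<le> e" if "length w = n" "x \<in> K" for w x
        using Suc.prems(4)[of "i # w" x] that by simp
    qed (rule cell(1))
    also have "sqrt (r 1 * c) \<le> sqrt (16 / 25 * c)"
      using matching_bounds[OF m] c0 by (intro real_sqrt_le_mono mult_right_mono)
    also have "sqrt (16 / 25 * c) = 4 / 5 * sqrt c"
      by (simp add: real_sqrt_mult real_sqrt_divide)
    finally have "\<bar>u (GG i y) - u (GG i (p 1))\<bar> \<le> e + 16 * sqrt c" by simp
    then show ?thesis using cell_base_diff_le[OF m c u, of i] c0 unfolding cell(2)
      by (smt (verit) real_sqrt_ge_zero)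
  next
    case (edge i t)
    have "\<bar>u (X [] i t) - u (X [] i 0)\<bar> \<le> sqrt c"
      using edge by (intro edge_diff_le[OF m c u]) auto
    moreover have "\<bar>u (GG (i + 1) (p (i + 2))) - u (GG (i + 1) (p 1))\<bar> \<le> sqrt c" by (rule corner_diff_le[OF m c])
    moreover have "\<bar>u (GG (i + 1) (p 1)) - u (p 1)\<bar> \<le> 2 * sqrt c" by (rule cell_base_diff_le[OF m c u])
    ultimately show ?thesis unfolding edge(2) X_endpoints using e0 real_sqrt_ge_zero[OF c0] by linarith
  qed
qed

lemma small_cells:
  assumes f: "continuous_on K (f :: real^2 \<Rightarrow> real)" and e: "0 < e"
  shows "\<exists>n. \<forall>w x y. length w = n \<longrightarrow> x \<in> K \<longrightarrow> y \<in> K \<longrightarrow> \<bar>f (GW w x) - f (GW w y)\<bar> \<le> e"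
proof -
  have "uniformly_continuous_on K f" by (rule compact_uniformly_continuous[OF f compact_K])
  then obtain d where d: "d > 0" "\<And>x y. x \<in> K \<Longrightarrow> y \<in> K \<Longrightarrow> dist y x < d \<Longrightarrow> dist (f y) (f x) < e"
    unfolding uniformly_continuous_on_def using e by metis
  obtain C where C: "\<And>x y. x \<in> K \<Longrightarrow> y \<in> K \<Longrightarrow> dist x y \<le> C"
    using compact_imp_bounded[OF compact_K] unfolding bounded_two_points by blast
  have "(\<lambda>m. s ^ m * C) \<longlonglongrightarrow> 0 * C"
    by (intro tendsto_intros LIMSEQ_realpow_zero) (use s in auto)
  then have "\<forall>\<^sub>F m in sequentially. s ^ m * C < d" using d(1) by (intro order_tendstoD(2)) auto
  then obtain n where n: "s ^ n * C < d" by (auto simp: eventually_sequentially)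
  have "\<bar>f (GW w x) - f (GW w y)\<bar> \<le> e" if w: "length w = n" and xy: "x \<in> K" "y \<in> K" for w x y
  proof -
    have "dist (GW w x) (GW w y) \<le> s ^ n * C"
      using C[OF xy] s w by (simp add: dist_GW mult_left_mono)
    then have "dist (f (GW w x)) (f (GW w y)) < e"
      using n by (intro d(2) GW_in_K xy) simp
    then show ?thesis by (simp add: dist_real_def)
  qed
  then show ?thesis by blast
qed

text \<open>Uniform continuity makes \<open>e\<close> arbitrarily small at a suitable depth, while
  the energy term is independent of the depth.\<close>

lemma oscillation_le:
  assumes m: "matching_pairs r \<rho>" and c: "\<And>m N. BN m r \<rho> N u u \<le> c" and u: "continuous_on K u" and x: "x \<in> K"
  shows "\<bar>u x - u (p 1)\<bar> \<le> 20 * sqrt c"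
proof (rule field_le_epsilon)
  fix e :: real assume "0 < e"
  then obtain n where "\<And>w x y. length w = n \<Longrightarrow> x \<in> K \<Longrightarrow> y \<in> K \<Longrightarrow> \<bar>u (GW w x) - u (GW w y)\<bar> \<le> e"
    using small_cells[OF u] by metis
  then have "\<bar>u x - u (p 1)\<bar> \<le> e + 20 * sqrt c"
    by (intro oscillation_step[OF m c u _ x, where n = n]) (auto simp: vertex_in_K)
  then show "\<bar>u x - u (p 1)\<bar> \<le> 20 * sqrt c + e" by simp
qed

text \<open>A local oscillation bound, uniform over all functions with energy bound
  \<open>c\<close>. It ranges over all sequences of pairs because descending into a cell shifts the
  sequence, and the improvement step applies the bound there.\<close>

definition equi :: "real \<Rightarrow> bool" where
  "equi \<omega> \<longleftrightarrow> (\<forall>r \<rho>. matching_pairs r \<rho> \<longrightarrow> (\<forall>x\<in>K. \<exists>d>0. \<forall>u c. continuous_on K u \<longrightarrow>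
     (\<forall>m N. BN m r \<rho> N u u \<le> c) \<longrightarrow> (\<forall>y\<in>K. dist x y < d \<longrightarrow> \<bar>u x - u y\<bar> \<le> \<omega> * sqrt c)))"

text \<open>Twice the oscillation constant 20, comparing both points with
  \<open>p 1\<close>.\<close>

lemma equi_start: "equi 40"
  unfolding equi_def
proof (intro allI impI ballI exI[of _ 1] conjI)
  fix r \<rho> u c x y
  assume m: "matching_pairs r \<rho>" and c: "\<forall>m N. BN m r \<rho> N u u \<le> c" and u: "continuous_on K u"
    and xy: "x \<in> K" "y \<in> K"
  show "\<bar>u x - u y\<bar> \<le> 40 * sqrt c"
    using oscillation_le[OF m c[rule_format] u xy(1)] oscillation_le[OF m c[rule_format] u xy(2)] by linarith
qed simp

lemma dist_X: "dist (X w i t) (X w i t') = \<bar>t - t'\<bar> * dist (X w i 0) (X w i 1)"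
proof -
  have "X w i t - X w i t' = (t' - t) *\<^sub>R (X w i 0 - X w i 1)"
    by (subst X_affine, subst (2) X_affine) (simp add: algebra_simps)
  then show ?thesis by (simp add: dist_norm abs_minus_commute)
qed

lemma far_from_closed:
  fixes S :: "(real^2) set"
  assumes "closed S" "x \<notin> S"
  shows "\<exists>d>0. \<forall>y\<in>S. \<not> dist x y < d"
proof -
  have "open (- S)" "x \<in> - S" using assms by auto
  then obtain d where "d > 0" "\<And>y. dist y x < d \<Longrightarrow> y \<in> - S" unfolding open_dist by metis
  then show ?thesis by (metis ComplD dist_commute)
qed

text \<open>In a cell containing \<open>x\<close> the assumption applies with the energy bound
  \<open>r 1 * c\<close>, whose root gives the factor 4/5; along an edge the Hoelder bound wins at
  small distance; pieces missing \<open>x\<close> are at positive distance. The smallest of the six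
  radii works.\<close>

lemma equi_step:
  assumes eq: "equi \<omega>" and \<omega>: "0 < \<omega>"
  shows "equi (4 / 5 * \<omega>)"
  unfolding equi_def
proof (intro allI impI ballI)
  fix r \<rho> x assume m: "matching_pairs r \<rho>" and x: "x \<in> K"
  define good where "good P d \<longleftrightarrow> d > 0 \<and> (\<forall>u c. continuous_on K u \<longrightarrow>
     (\<forall>m N. BN m r \<rho> N u u \<le> c) \<longrightarrow> (\<forall>y\<in>P. dist x y < d \<longrightarrow> \<bar>u x - u y\<bar> \<le> 4 / 5 * \<omega> * sqrt c))" for P d
  have cell: "\<exists>d. good (GG i ` K) d" for i
  proof (cases "x \<in> GG i ` K")
    case False
    have "closed (GG i ` K)"
      by (intro compact_imp_closed compact_continuous_image continuous_G compact_K)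
    from far_from_closed[OF this False] show ?thesis unfolding good_def by blast
  next
    case True
    then obtain x' where x': "x' \<in> K" "x = GG i x'" by blast
    obtain d where d: "d > 0" "\<And>u c y. continuous_on K u \<Longrightarrow> (\<And>m N. BN m (sh r) (sh \<rho>) N u u \<le> c) \<Longrightarrow>
        y \<in> K \<Longrightarrow> dist x' y < d \<Longrightarrow> \<bar>u x' - u y\<bar> \<le> \<omega> * sqrt c"
      using eq matching_sh[OF m] x'(1) unfolding equi_def by meson
    have "\<bar>u x - u y\<bar> \<le> 4 / 5 * \<omega> * sqrt c"
      if u: "continuous_on K u" and c: "\<forall>m N. BN m r \<rho> N u u \<le> c" and y: "y \<in> GG i ` K" and dy: "dist x y < s * d" for u c y
    proof -
      have c0: "0 \<le> c" using c[rule_format, of 0 0] BN_nonneg[OF m, of 0 0 u] by linarith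
      obtain y' where y': "y' \<in> K" "y = GG i y'" using y by blast
      have "dist x' y' < d" using dy s by (simp add: x' y' dist_G)
      then have "\<bar>u (GG i x') - u (GG i y')\<bar> \<le> \<omega> * sqrt (r 1 * c)"
        by (intro d(2)[of "\<lambda>x. u (GG i x)"] BN_subcell_le(1)[OF m c[rule_format]] y'(1)
            continuous_on_compose2[OF u continuous_G]) (auto intro: G_in_K)
      also have "\<dots> \<le> \<omega> * sqrt (16 / 25 * c)"
        using matching_bounds[OF m] c0 \<omega> by (intro mult_left_mono real_sqrt_le_mono mult_right_mono) auto
      also have "sqrt (16 / 25 * c) = 4 / 5 * sqrt c"
        by (simp add: real_sqrt_mult real_sqrt_divide)
      finally show ?thesis by (simp add: x' y' mult_ac)
    qed
    then have "good (GG i ` K) (s * d)" unfolding good_def using d(1) s by auto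
    then show ?thesis by blast
  qed
  have edge: "\<exists>d. good (X [] i ` {0..1}) d" for i
  proof (cases "x \<in> X [] i ` {0..1}")
    case False
    have "closed (X [] i ` {0..1})"
      by (intro compact_imp_closed compact_continuous_image continuous_X) simp
    from far_from_closed[OF this False] show ?thesis unfolding good_def by blast
  next
    case True
    then obtain t where t: "t \<in> {0..1}" "x = X [] i t" by blast
    define L where "L = dist (X [] i 0) (X [] i 1)"
    have L: "L > 0" using X_ends_distinct by (simp add: L_def)
    \<comment> \<open>The radius is \<open>L\<close> times the parameter distance at which the
      Hoelder bound of exponent 1/2 reaches \<open>4 / 5 * \<omega> * sqrt c\<close>.\<close>
    have "\<bar>u x - u y\<bar> \<le> 4 / 5 * \<omega> * sqrt c"
      if u: "continuous_on K u" and c: "\<forall>m N. BN m r \<rho> N u u \<le> c" and y: "y \<in> X [] i ` {0..1}"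
        and dy: "dist x y < L * (4 / 5 * \<omega>)\<^sup>2" for u c y
    proof -
      have c0: "0 \<le> c" using c[rule_format, of 0 0] BN_nonneg[OF m, of 0 0 u] by linarith
      obtain t' where t': "t' \<in> {0..1}" "y = X [] i t'" using y by blast
      have "\<bar>t - t'\<bar> * L < L * (4 / 5 * \<omega>)\<^sup>2" using dy unfolding t(2) t'(2) L_def dist_X[of _ _ t t'] .
      then have tt: "\<bar>t - t'\<bar> \<le> (4 / 5 * \<omega>)\<^sup>2" using L by (simp add: mult.commute)
      have "(u x - u y)\<^sup>2 \<le> c * \<bar>t - t'\<bar>"
        unfolding t(2) t'(2) by (rule edge_Holder[OF m c[rule_format] u t(1) t'(1)])
      also have "\<dots> \<le> c * (4 / 5 * \<omega>)\<^sup>2" using tt c0 by (rule mult_left_mono)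
      also have "\<dots> = (4 / 5 * \<omega> * sqrt c)\<^sup>2" using c0 by (simp only: power_mult_distrib real_sqrt_pow2) (simp add: mult.commute)
      finally have "\<bar>u x - u y\<bar> \<le> \<bar>4 / 5 * \<omega> * sqrt c\<bar>" by (simp only: abs_le_square_iff)
      also have "\<dots> = 4 / 5 * \<omega> * sqrt c" using \<omega> c0 by simp
      finally show ?thesis .
    qed
    then have "good (X [] i ` {0..1}) (L * (4 / 5 * \<omega>)\<^sup>2)" unfolding good_def using L \<omega> by auto
    then show ?thesis by blast
  qed
  obtain d1 where d1: "\<And>i. good (GG i ` K) (d1 i)" using cell by metis
  obtain d2 where d2: "\<And>i. good (X [] i ` {0..1}) (d2 i)" using edge by metis
  define d where "d = Min (range d1 \<union> range d2)"
  have fin: "finite (range d1 \<union> range d2)" by simp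
  have d0: "d > 0" unfolding d_def using d1 d2 by (subst Min_gr_iff[OF fin]) (auto simp: good_def)
  have dl: "d \<le> d1 i" "d \<le> d2 i" for i unfolding d_def by (auto intro!: Min_le[OF fin])
  have "\<bar>u x - u y\<bar> \<le> 4 / 5 * \<omega> * sqrt c"
    if u: "continuous_on K u" "\<forall>m N. BN m r \<rho> N u u \<le> c" and y: "y \<in> K" "dist x y < d" for u c y
  proof -
    have "y \<in> (\<Union>i. GG i ` K) \<union> (\<Union>i. X [] i ` {0..1})" using y(1) K_cover by simp
    then consider i where "y \<in> GG i ` K" | i where "y \<in> X [] i ` {0..1}" by blast
    then show ?thesis
    proof cases
      case 1
      then show ?thesis using d1[of i] dl(1)[of i] u y(2) unfolding good_def by (meson less_le_trans)
    next
      case 2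
      then show ?thesis using d2[of i] dl(2)[of i] u y(2) unfolding good_def by (meson less_le_trans)
    qed
  qed
  then show "\<exists>d>0. \<forall>u c. continuous_on K u \<longrightarrow> (\<forall>m N. BN m r \<rho> N u u \<le> c) \<longrightarrow>
      (\<forall>y\<in>K. dist x y < d \<longrightarrow> \<bar>u x - u y\<bar> \<le> 4 / 5 * \<omega> * sqrt c)"
    using d0 by blast
qed

text \<open>Iterating the improvement yields the constants \<open>(4 / 5) ^ n * 40\<close>, which
  eventually beat any prescribed oscillation.\<close>

lemma equicontinuous:
  assumes m: "matching_pairs r \<rho>" and x: "x \<in> K" and e: "0 < e" and c: "0 < c"
  shows "\<exists>d>0. \<forall>u. continuous_on K u \<longrightarrow> (\<forall>m N. BN m r \<rho> N u u \<le> c) \<longrightarrow>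
    (\<forall>y\<in>K. dist x y < d \<longrightarrow> \<bar>u x - u y\<bar> < e)"
proof -
  have it: "equi ((4 / 5) ^ n * 40)" for n
  proof (induction n)
    case (Suc n)
    show ?case using equi_step[OF Suc] by (simp add: mult.assoc)
  qed (simp add: equi_start)
  have "(\<lambda>n. (4 / 5) ^ n * 40 * sqrt c) \<longlonglongrightarrow> 0 * 40 * sqrt c"
    by (intro tendsto_intros LIMSEQ_realpow_zero) auto
  then have "\<forall>\<^sub>F n in sequentially. (4 / 5) ^ n * 40 * sqrt c < e" using e by (intro order_tendstoD(2)) auto
  then obtain n where n: "(4 / 5) ^ n * 40 * sqrt c < e" by (auto simp: eventually_sequentially)
  obtain d where "d > 0" "\<And>u y. continuous_on K u \<Longrightarrow> \<forall>m N. BN m r \<rho> N u u \<le> c \<Longrightarrow> y \<in> K \<Longrightarrow>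
     dist x y < d \<Longrightarrow> \<bar>u x - u y\<bar> \<le> (4 / 5) ^ n * 40 * sqrt c"
    using it[of n] m x unfolding equi_def by meson
  then show ?thesis using n by (meson le_less_trans)
qed

text \<open>Only finitely many point values enter \<open>BN\<close>, and they enter
  polynomially.\<close>

lemma BN_tendsto:
  assumes "\<And>x. x \<in> K \<Longrightarrow> (\<lambda>k. f k x) \<longlonglongrightarrow> g x"
  shows "(\<lambda>k. BN m r \<rho> N (f k) (f k)) \<longlonglongrightarrow> BN m r \<rho> N g g"
  using assms
proof (induction m arbitrary: r \<rho> f g)
  case 0
  show ?case unfolding BN.simps q0_def
    by (intro tendsto_intros 0 vertex_in_K) simp
next
  case (Suc m)
  have "(\<lambda>k. SB N (\<lambda>t. f k (X [] i t)) (\<lambda>t. f k (X [] i t))) \<longlonglongrightarrow> SB N (\<lambda>t. g (X [] i t)) (\<lambda>t. g (X [] i t))" for i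
    unfolding SB_def
  proof (rule tendsto_sum)
    fix j :: nat assume "j \<in> {..<2 ^ N}"
    then have j: "j < 2 ^ N" by simp
    have "real (Suc j) \<le> 2 ^ N" using j by (metis Suc_leI of_nat_le_iff of_nat_numeral of_nat_power)
    then have "real (Suc j) / 2 ^ N \<in> {0..1}" "real j / 2 ^ N \<in> {0..1}"
      using j by (auto simp: field_simps)
    then have "(\<lambda>k. dinc N (\<lambda>t. f k (X [] i t)) j) \<longlonglongrightarrow> dinc N (\<lambda>t. g (X [] i t)) j"
      unfolding dinc_def by (intro tendsto_diff Suc.prems X_in_K)
    then show "(\<lambda>k. 2 ^ N * (dinc N (\<lambda>t. f k (X [] i t)) j * dinc N (\<lambda>t. f k (X [] i t)) j))
      \<longlonglongrightarrow> 2 ^ N * (dinc N (\<lambda>t. g (X [] i t)) j * dinc N (\<lambda>t. g (X [] i t)) j)"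
      by (intro tendsto_intros)
  qed
  moreover have "(\<lambda>k. BN m (sh r) (sh \<rho>) N (\<lambda>x. f k (GG i x)) (\<lambda>x. f k (GG i x)))
     \<longlonglongrightarrow> BN m (sh r) (sh \<rho>) N (\<lambda>x. g (GG i x)) (\<lambda>x. g (GG i x))" for i
    by (rule Suc.IH) (intro Suc.prems G_in_K)
  ultimately show ?case unfolding BN.simps divide_inverse
    by (intro tendsto_add tendsto_mult tendsto_sum tendsto_const)
qed

subsection \<open>Antisymmetric functions\<close>

text \<open>The sign representation of the symmetric group on three letters: rotations act
  trivially, reflections by -1.\<close>

definition alternating :: "(real^2 \<Rightarrow> real) \<Rightarrow> bool" where
  "alternating u \<longleftrightarrow> (\<forall>\<pi>. \<pi> permutes UNIV \<longrightarrow> (\<forall>x\<in>K. u (symm \<pi> x) = of_int (sign \<pi>) * u x))"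

lemma alternatingD: "alternating u \<Longrightarrow> \<pi> permutes UNIV \<Longrightarrow> x \<in> K \<Longrightarrow> u (symm \<pi> x) = of_int (sign \<pi>) * u x"
  by (auto simp: alternating_def)

lemma perm3: "\<pi> permutes (UNIV :: 3 set) \<Longrightarrow> permutation \<pi>"
  by (rule permutes_imp_permutation[of UNIV]) auto

lemma finite_perms: "finite {\<pi> :: 3 \<Rightarrow> 3. \<pi> permutes UNIV}"
  by (rule finite_permutations) simp

lemma alternating_vertex:
  assumes "alternating u"
  shows "u (p i) = 0"
proof -
  define \<tau> where "\<tau> = Transposition.transpose (i + 1) (i + 2)"
  have \<tau>: "\<tau> permutes UNIV" unfolding \<tau>_def by (rule permutes_swap_id) auto
  have "\<tau> i = i" by (simp add: \<tau>_def transpose_def)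
  then have "u (p i) = of_int (sign \<tau>) * u (p i)"
    using alternatingD[OF assms \<tau> vertex_in_K[of i]] by (simp add: symm_vertex)
  also have "sign \<tau> = -1" by (simp add: \<tau>_def sign_swap_id)
  finally show ?thesis by simp
qed

text \<open>Group average projecting onto the sign component; 6 is the order of the group.\<close>

definition antisymmetrize :: "(real^2 \<Rightarrow> real) \<Rightarrow> real^2 \<Rightarrow> real" where
  "antisymmetrize v x = (\<Sum>\<pi>\<in>{\<pi>. \<pi> permutes UNIV}. of_int (sign \<pi>) / 6 * v (symm \<pi> x))"

lemma alternating_antisymmetrize: "alternating (antisymmetrize v)"
  unfolding alternating_def
proof (intro allI impI ballI)
  fix \<tau> x assume \<tau>: "\<tau> permutes (UNIV :: 3 set)" and "x \<in> K"
  have "antisymmetrize v (symm \<tau> x) = (\<Sum>\<pi>\<in>{\<pi>. \<pi> permutes UNIV}. of_int (sign \<pi>) / 6 * v (symm (\<pi> \<circ> \<tau>) x))"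
    using \<tau> by (simp add: antisymmetrize_def symm_comp)
  also have "\<dots> = (\<Sum>\<pi>\<in>{\<pi>. \<pi> permutes UNIV}. of_int (sign \<tau>) * (of_int (sign \<pi>) / 6 * v (symm \<pi> x)))"
  proof (rule sum.reindex_bij_witness[of _ "\<lambda>\<pi>. \<pi> \<circ> inv \<tau>" "\<lambda>\<pi>. \<pi> \<circ> \<tau>"])
    fix \<pi> assume "\<pi> \<in> {\<pi>. \<pi> permutes (UNIV :: 3 set)}"
    then have \<pi>: "\<pi> permutes UNIV" by simp
    show "\<pi> \<circ> \<tau> \<circ> inv \<tau> = \<pi>" "\<pi> \<circ> inv \<tau> \<circ> \<tau> = \<pi>"
      using \<tau> by (simp_all add: comp_assoc permutes_inv_o)
    show "\<pi> \<circ> \<tau> \<in> {\<pi>. \<pi> permutes UNIV}" "\<pi> \<circ> inv \<tau> \<in> {\<pi>. \<pi> permutes UNIV}"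
      using \<pi> \<tau> by (auto intro: permutes_compose permutes_inv)
    have "sign (\<pi> \<circ> \<tau>) = sign \<pi> * sign \<tau>" by (rule sign_compose[OF perm3[OF \<pi>] perm3[OF \<tau>]])
    then show "of_int (sign \<tau>) * (of_int (sign (\<pi> \<circ> \<tau>)) / 6 * v (symm (\<pi> \<circ> \<tau>) x))
      = of_int (sign \<pi>) / 6 * v (symm (\<pi> \<circ> \<tau>) x)"
      by (simp add: mult_ac sign_def)
  qed
  also have "\<dots> = of_int (sign \<tau>) * antisymmetrize v x" by (simp add: antisymmetrize_def sum_distrib_left)
  finally show "antisymmetrize v (symm \<tau> x) = of_int (sign \<tau>) * antisymmetrize v x" .
qed

lemma DOM_antisymmetrize: "matching_pairs r \<rho> \<Longrightarrow> v \<in> DOM r \<rho> \<Longrightarrow> antisymmetrize v \<in> DOM r \<rho>"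
  unfolding antisymmetrize_def[abs_def] by (intro DOM_sum finite_perms DOM_symm) auto

lemma card_perms: "card {\<pi> :: 3 \<Rightarrow> 3. \<pi> permutes UNIV} = 6"
  using card_permutations[of "UNIV :: 3 set" 3] by (simp add: fact_numeral)

lemma sum_sign_sq: "(\<Sum>\<pi>\<in>{\<pi> :: 3 \<Rightarrow> 3. \<pi> permutes UNIV}. of_int (sign \<pi>) / 6 * (of_int (sign \<pi>) * c)) = (c :: real)"
proof -
  have "of_int (sign \<pi>) / 6 * (of_int (sign \<pi>) * c) = c / 6" for \<pi> :: "3 \<Rightarrow> 3"
    by (simp add: sign_def)
  then have "(\<Sum>\<pi>\<in>{\<pi> :: 3 \<Rightarrow> 3. \<pi> permutes UNIV}. of_int (sign \<pi>) / 6 * (of_int (sign \<pi>) * c))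
    = (\<Sum>\<pi>\<in>{\<pi> :: 3 \<Rightarrow> 3. \<pi> permutes UNIV}. c / 6)" by (rule sum.cong[OF refl])
  then show ?thesis by (simp add: card_perms)
qed

text \<open>Invariance moves each symmetry from \<open>v\<close> to \<open>u\<close>, where it acts
  by a sign that cancels the weight of the summand. Hence an equation tested with alternating
  functions extends to all \<open>v\<close>.\<close>

lemma BN_antisymmetrize:
  assumes u: "alternating u"
  shows "BN m r \<rho> N u (antisymmetrize v) = BN m r \<rho> N u v"
proof -
  have "BN m r \<rho> N u (\<lambda>x. v (symm \<pi> x)) = of_int (sign \<pi>) * BN m r \<rho> N u v" if \<pi>: "\<pi> permutes UNIV" for \<pi>
  proof -
    have "BN m r \<rho> N u (\<lambda>x. v (symm \<pi> x)) = BN m r \<rho> N (\<lambda>x. u (symm (inv \<pi>) (symm \<pi> x))) (\<lambda>x. v (symm \<pi> x))"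
      using \<pi> by (simp add: symm_inv)
    also have "\<dots> = BN m r \<rho> N (\<lambda>x. u (symm (inv \<pi>) x)) v" by (rule BN_symm[OF \<pi>])
    also have "\<dots> = BN m r \<rho> N (\<lambda>x. of_int (sign (inv \<pi>)) * u x) v"
      by (rule BN_cong) (simp_all add: alternatingD[OF u permutes_inv[OF \<pi>]])
    finally show ?thesis by (simp add: BN_cmult sign_inverse[OF perm3[OF \<pi>]])
  qed
  moreover have "BN m r \<rho> N u (antisymmetrize v) = (\<Sum>\<pi>\<in>{\<pi>. \<pi> permutes UNIV}. of_int (sign \<pi>) / 6 * BN m r \<rho> N u (\<lambda>x. v (symm \<pi> x)))"
    unfolding antisymmetrize_def[abs_def] by (subst BN_commute, subst BN_sum[OF finite_perms]) (simp add: BN_commute)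
  ultimately show ?thesis using sum_sign_sq by simp
qed

lemma integral_antisymmetrize:
  assumes sy: "\<And>(f :: real^2 \<Rightarrow> real) \<pi>. continuous_on K f \<Longrightarrow> \<pi> permutes UNIV \<Longrightarrow> (\<integral>x. f (symm \<pi> x) \<partial>\<mu>) = (\<integral>x. f x \<partial>\<mu>)"
    and pr: "borel_prob_on K \<mu>" and u: "alternating u" "continuous_on K u" and v: "continuous_on K v"
  shows "(\<integral>x. u x * antisymmetrize v x \<partial>\<mu>) = (\<integral>x. u x * v x \<partial>\<mu>)"
proof -
  have sp: "space \<mu> = K" by (rule finite_measure_borel_prob_on[OF pr])
  have one: "(\<integral>x. u x * v (symm \<pi> x) \<partial>\<mu>) = of_int (sign \<pi>) * (\<integral>x. u x * v x \<partial>\<mu>)" if \<pi>: "\<pi> permutes UNIV" for \<pi>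
  proof -
    have cu: "continuous_on K (\<lambda>x. u (symm (inv \<pi>) x) * v x)"
      by (intro continuous_intros continuous_symm_comp permutes_inv \<pi> u v)
    have "(\<integral>x. u x * v (symm \<pi> x) \<partial>\<mu>) = (\<integral>x. u (symm (inv \<pi>) (symm \<pi> x)) * v (symm \<pi> x) \<partial>\<mu>)"
      using \<pi> by (simp add: symm_inv)
    also have "\<dots> = (\<integral>x. u (symm (inv \<pi>) x) * v x \<partial>\<mu>)" by (rule sy[OF cu \<pi>])
    also have "\<dots> = (\<integral>x. of_int (sign (inv \<pi>)) * (u x * v x) \<partial>\<mu>)"
      using sp by (intro Bochner_Integration.integral_cong) (simp_all add: alternatingD[OF u(1) permutes_inv[OF \<pi>]])
    finally show ?thesis by (simp add: sign_inverse[OF perm3[OF \<pi>]])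
  qed
  have "(\<integral>x. u x * antisymmetrize v x \<partial>\<mu>) = (\<integral>x. (\<Sum>\<pi>\<in>{\<pi>. \<pi> permutes UNIV}. of_int (sign \<pi>) / 6 * (u x * v (symm \<pi> x))) \<partial>\<mu>)"
    by (simp add: antisymmetrize_def sum_distrib_left mult_ac)
  also have "\<dots> = (\<Sum>\<pi>\<in>{\<pi>. \<pi> permutes UNIV}. (\<integral>x. of_int (sign \<pi>) / 6 * (u x * v (symm \<pi> x)) \<partial>\<mu>))"
    by (rule Bochner_Integration.integral_sum)
      (auto intro!: integrable_continuous_on_K[OF compact_K pr] continuous_intros u continuous_symm_comp v)
  also have "\<dots> = (\<integral>x. u x * v x \<partial>\<mu>)" using sum_sign_sq by (simp add: one)
  finally show ?thesis .
qed

end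

subsection \<open>A nonzero antisymmetric function of finite energy\<close>

text \<open>Lipschitz continuity on [0,1]: stable under the products and cutoffs occurring in
  \<open>u0\<close>, and sufficient for bounded dyadic energy.\<close>

definition lip01 :: "(real \<Rightarrow> real) \<Rightarrow> bool" where
  "lip01 f \<longleftrightarrow> (\<exists>L\<ge>0. \<forall>a\<in>{0..1}. \<forall>b\<in>{0..1}. \<bar>f a - f b\<bar> \<le> L * \<bar>a - b\<bar>)"

lemma lip01_const: "lip01 (\<lambda>t. c)"
  unfolding lip01_def by (intro exI[of _ 0]) auto

lemma lip01_id: "lip01 (\<lambda>t. t)"
  unfolding lip01_def by (intro exI[of _ 1]) auto

lemma lip01_diff:
  assumes "lip01 f" "lip01 g"
  shows "lip01 (\<lambda>t. f t - g t)"
proof -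
  obtain L M where L: "L \<ge> 0" "\<And>a b. a \<in> {0..1} \<Longrightarrow> b \<in> {0..1} \<Longrightarrow> \<bar>f a - f b\<bar> \<le> L * \<bar>a - b\<bar>"
    and M: "M \<ge> 0" "\<And>a b. a \<in> {0..1} \<Longrightarrow> b \<in> {0..1} \<Longrightarrow> \<bar>g a - g b\<bar> \<le> M * \<bar>a - b\<bar>"
    using assms unfolding lip01_def by metis
  have "\<bar>(f a - g a) - (f b - g b)\<bar> \<le> (L + M) * \<bar>a - b\<bar>" if "a \<in> {0..1}" "b \<in> {0..1}" for a b
    using L(2)[OF that] M(2)[OF that] unfolding distrib_right by linarith
  then show ?thesis unfolding lip01_def using L(1) M(1) by (intro exI[of _ "L + M"]) auto
qed

lemma lip01_max:
  assumes "lip01 f"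
  shows "lip01 (\<lambda>t. max 0 (f t))"
proof -
  obtain L where L: "L \<ge> 0" "\<And>a b. a \<in> {0..1} \<Longrightarrow> b \<in> {0..1} \<Longrightarrow> \<bar>f a - f b\<bar> \<le> L * \<bar>a - b\<bar>"
    using assms unfolding lip01_def by metis
  have "\<bar>max 0 (f a) - max 0 (f b)\<bar> \<le> L * \<bar>a - b\<bar>" if "a \<in> {0..1}" "b \<in> {0..1}" for a b
    using L(2)[OF that] by linarith
  then show ?thesis unfolding lip01_def using L(1) by blast
qed

lemma lip01_mult:
  assumes "lip01 f" "lip01 g"
  shows "lip01 (\<lambda>t. f t * g t)"
proof -
  obtain L M where L: "L \<ge> 0" "\<And>a b. a \<in> {0..1} \<Longrightarrow> b \<in> {0..1} \<Longrightarrow> \<bar>f a - f b\<bar> \<le> L * \<bar>a - b\<bar>"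
    and M: "M \<ge> 0" "\<And>a b. a \<in> {0..1} \<Longrightarrow> b \<in> {0..1} \<Longrightarrow> \<bar>g a - g b\<bar> \<le> M * \<bar>a - b\<bar>"
    using assms unfolding lip01_def by metis
  define A B where "A = \<bar>f 0\<bar> + L" and "B = \<bar>g 0\<bar> + M"
  have A0: "0 \<le> A" using L(1) by (simp add: A_def)
  have fA: "\<bar>f a\<bar> \<le> A" and gB: "\<bar>g a\<bar> \<le> B" if "a \<in> {0..1}" for a
  proof -
    have "L * \<bar>a - 0\<bar> \<le> L" "M * \<bar>a - 0\<bar> \<le> M" using that L(1) M(1) by (auto intro!: mult_left_le)
    then show "\<bar>f a\<bar> \<le> A" "\<bar>g a\<bar> \<le> B"
      using L(2)[OF that, of 0] M(2)[OF that, of 0] unfolding A_def B_def by auto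
  qed
  have "\<bar>f a * g a - f b * g b\<bar> \<le> (A * M + L * B) * \<bar>a - b\<bar>" if ab: "a \<in> {0..1}" "b \<in> {0..1}" for a b
  proof -
    have "f a * g a - f b * g b = f a * (g a - g b) + (f a - f b) * g b" by (simp add: algebra_simps)
    then have "\<bar>f a * g a - f b * g b\<bar> \<le> \<bar>f a\<bar> * \<bar>g a - g b\<bar> + \<bar>f a - f b\<bar> * \<bar>g b\<bar>"
      using abs_triangle_ineq[of "f a * (g a - g b)" "(f a - f b) * g b"] by (simp add: abs_mult)
    also have "\<dots> \<le> A * (M * \<bar>a - b\<bar>) + (L * \<bar>a - b\<bar>) * B"
      by (intro add_mono mult_mono fA[OF ab(1)] gB[OF ab(2)] L(2)[OF ab] M(2)[OF ab]
          mult_nonneg_nonneg L(1) abs_ge_zero A0)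
    finally show ?thesis by (simp add: algebra_simps)
  qed
  moreover have "0 \<le> A * M + L * B" using L(1) M(1) by (simp add: A_def B_def)
  ultimately show ?thesis unfolding lip01_def by blast
qed

lemma lip01_SB:
  assumes "lip01 f"
  shows "\<exists>c. \<forall>N. SB N f f \<le> c"
proof -
  obtain L where L: "L \<ge> 0" "\<And>a b. a \<in> {0..1} \<Longrightarrow> b \<in> {0..1} \<Longrightarrow> \<bar>f a - f b\<bar> \<le> L * \<bar>a - b\<bar>"
    using assms unfolding lip01_def by metis
  have "SB N f f \<le> L\<^sup>2" for N
  proof -
    have "2 ^ N * (dinc N f i * dinc N f i) \<le> L\<^sup>2 / 2 ^ N" if i: "i < 2 ^ N" for i
    proof -
      have "real (Suc i) \<le> 2 ^ N" using i by (metis Suc_leI of_nat_le_iff of_nat_numeral of_nat_power)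
      then have ab: "real (Suc i) / 2 ^ N \<in> {0..1}" "real i / 2 ^ N \<in> {0..1}"
        using i by (auto simp: field_simps)
      have "\<bar>dinc N f i\<bar> \<le> L * \<bar>real (Suc i) / 2 ^ N - real i / 2 ^ N\<bar>"
        unfolding dinc_def by (rule L(2)[OF ab])
      also have "real (Suc i) / 2 ^ N - real i / 2 ^ N = 1 / 2 ^ N" by (simp add: field_simps)
      finally have "\<bar>dinc N f i\<bar> \<le> \<bar>L / 2 ^ N\<bar>" using L(1) by simp
      then have "(dinc N f i)\<^sup>2 \<le> (L / 2 ^ N)\<^sup>2" by (simp only: abs_le_square_iff)
      then have "2 ^ N * (dinc N f i)\<^sup>2 \<le> 2 ^ N * (L / 2 ^ N)\<^sup>2" by (intro mult_left_mono) auto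
      then show ?thesis by (simp add: power2_eq_square)
    qed
    then have "SB N f f \<le> (\<Sum>i<(2::nat) ^ N. L\<^sup>2 / 2 ^ N)" unfolding SB_def by (intro sum_mono) auto
    then show ?thesis by simp
  qed
  then show ?thesis by blast
qed

text \<open>The Vandermonde product of three numbers up to sign, an alternating polynomial of least
  degree.\<close>

definition vdm :: "(3 \<Rightarrow> real) \<Rightarrow> real" where
  "vdm b = (b 1 - b 2) * (b 2 - b 3) * (b 3 - b 1)"

context gasket
begin

text \<open>Permutations are generated by transpositions, and each of these flips the sign.\<close>

lemma vdm_perm:
  assumes "\<pi> permutes (UNIV :: 3 set)"
  shows "\<forall>b. vdm (b \<circ> \<pi>) = of_int (sign \<pi>) * vdm b"
  using assms finite_class.finite_UNIV
proof (induction rule: permutes_induct)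
  case (swap i j \<pi>)
  have t: "vdm (b \<circ> Transposition.transpose i j) = - vdm b" for b
    using exhaust_3[of i] exhaust_3[of j] \<open>i \<noteq> j\<close>
    by (auto simp: vdm_def transpose_def algebra_simps)
  have "sign (Transposition.transpose i j \<circ> \<pi>) = - sign \<pi>"
    using swap by (subst sign_compose) (auto simp: perm3 sign_swap_id permutes_swap_id)
  moreover have "vdm (b \<circ> (Transposition.transpose i j \<circ> \<pi>)) = - of_int (sign \<pi>) * vdm b" for b
    using swap.IH[rule_format, of "b \<circ> Transposition.transpose i j"] t[of b] by (simp add: comp_assoc)
  ultimately show ?case by (simp only: of_int_minus simp_thms)
qed auto

text \<open>The Vandermonde factor provides antisymmetry, the cutoff the support: on cell
  \<open>i\<close> the coordinate \<open>bc i\<close> is at least \<open>1 - s\<close>, so a factor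
  of the product vanishes. Within \<open>K\<close> only the three edges of the empty word remain,
  and \<open>\<mu>l\<close> charges these.\<close>

definition u0 :: "real^2 \<Rightarrow> real" where
  "u0 x = vdm (\<lambda>i. bc i x) * (\<Prod>i\<in>UNIV. max 0 (1 - s - bc i x))"

lemma u0_cell: "x \<in> K \<Longrightarrow> u0 (GG i x) = 0"
proof -
  assume "x \<in> K"
  then have "max 0 (1 - s - bc i (GG i x)) = 0" using bc_cell[of x i] by simp
  then have "(\<Prod>j\<in>UNIV. max 0 (1 - s - bc j (GG i x))) = 0" by (intro prod_zero) auto
  then show ?thesis by (simp add: u0_def)
qed

lemma u0_vertex: "u0 (p i) = 0"
  using u0_cell[OF vertex_in_K, of i i] by (simp add: G_fix)

lemma alternating_u0: "alternating u0"
  unfolding alternating_def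
proof (intro allI impI ballI)
  fix \<pi> x assume \<pi>: "\<pi> permutes (UNIV :: 3 set)"
  have b: "bc i (symm \<pi> x) = bc (inv \<pi> i) x" for i
    using bc_symm[OF \<pi>, of "inv \<pi> i" x] \<pi> by (simp add: permutes_inverses)
  have "vdm (\<lambda>i. bc i (symm \<pi> x)) = of_int (sign \<pi>) * vdm (\<lambda>i. bc i x)"
    using vdm_perm[OF permutes_inv[OF \<pi>], rule_format, of "\<lambda>i. bc i x"]
    by (simp add: b o_def sign_inverse[OF perm3[OF \<pi>]])
  moreover have "(\<Prod>i\<in>UNIV. max 0 (1 - s - bc i (symm \<pi> x))) = (\<Prod>i\<in>UNIV. max 0 (1 - s - bc i x))"
    unfolding b by (rule prod.reindex_bij_betw[OF permutes_imp_bij[OF permutes_inv[OF \<pi>]]])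
  ultimately show "u0 (symm \<pi> x) = of_int (sign \<pi>) * u0 x" by (simp add: u0_def)
qed

lemma continuous_u0: "continuous_on A u0"
  unfolding u0_def[abs_def] vdm_def by (intro continuous_intros)

lemma lip01_bc: "lip01 (\<lambda>t. bc j (X [] i t))"
proof -
  have "bc j (X [] i t) = bc j (X [] i 0) - t * (bc j (X [] i 0) - bc j (X [] i 1))" for t
    by (subst X_affine) (simp only: bc_affine, simp add: algebra_simps)
  then have "(\<lambda>t. bc j (X [] i t)) = (\<lambda>t. bc j (X [] i 0) - t * (bc j (X [] i 0) - bc j (X [] i 1)))"
    by (rule ext)
  moreover have "lip01 (\<lambda>t. bc j (X [] i 0) - t * (bc j (X [] i 0) - bc j (X [] i 1)))"
    by (intro lip01_diff lip01_mult lip01_const lip01_id)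
  ultimately show ?thesis by simp
qed

lemma lip01_u0: "lip01 (\<lambda>t. u0 (X [] i t))"
  unfolding u0_def vdm_def UNIV_3
  by (simp, intro lip01_mult lip01_diff lip01_max lip01_bc lip01_const)

text \<open>Vertices and cells contribute zero, so the energy is bounded by three Lipschitz edge
  terms.\<close>

lemma u0_DOM:
  assumes m: "matching_pairs r \<rho>"
  shows "u0 \<in> DOM r \<rho>"
proof -
  obtain c where c: "\<And>N i. SB N (\<lambda>t. u0 (X [] i t)) (\<lambda>t. u0 (X [] i t)) \<le> c i"
    using lip01_SB[OF lip01_u0] by metis
  have c0: "0 \<le> c i" for i using c[of 0 i] SB_nonneg order_trans by blast
  have "BN m r \<rho> N u0 u0 \<le> (\<Sum>i\<in>UNIV. c i) / \<rho> 1" for m N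
  proof (cases m)
    case 0
    then show ?thesis using c0 matching_1[OF m]
      by (auto simp: q0_def u0_vertex intro!: divide_nonneg_pos sum_nonneg)
  next
    case (Suc k)
    have "BN k (sh r) (sh \<rho>) N (\<lambda>x. u0 (GG i x)) (\<lambda>x. u0 (GG i x)) = 0" for i
    proof -
      have "BN k (sh r) (sh \<rho>) N (\<lambda>x. u0 (GG i x)) (\<lambda>x. u0 (GG i x))
        = BN k (sh r) (sh \<rho>) N (\<lambda>x. 0) (\<lambda>x. u0 (GG i x))"
        by (rule BN_cong) (simp_all add: u0_cell)
      then show ?thesis by (simp add: BN_zero)
    qed
    then show ?thesis using c matching_1[OF m] by (auto simp: Suc intro!: divide_right_mono sum_mono)
  qed
  then show ?thesis by (auto simp: DOM_def bndd_def continuous_u0)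
qed

text \<open>Along edge 1 the first coordinate is zero and the others are positive; these coincide at
  the midpoint only, and all three stay below the cutoff.\<close>

lemma u0_edge_nonzero:
  assumes "t \<in> {0<..<1}" "t \<noteq> 1 / 2"
  shows "u0 (X [] 1 t) \<noteq> 0"
proof -
  have wrap: "(1::3) + 1 = 2" "(1::3) + 2 = 3" by auto
  have b: "bc 1 (X [] 1 t) = 0" "bc 2 (X [] 1 t) = (1 - t) * (1 - s) + t * s" "bc 3 (X [] 1 t) = (1 - t) * s + t * (1 - s)"
    using bc_X[of 1 t] unfolding wrap .
  have pos: "0 < (1 - t) * (1 - s) + t * s" "0 < (1 - t) * s + t * (1 - s)"
    using assms s by (auto intro!: add_pos_pos mult_pos_pos)
  have d: "(1 - t) * (1 - s) + t * s - ((1 - t) * s + t * (1 - s)) = (1 - 2 * t) * (1 - 2 * s)"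
    "1 - s - ((1 - t) * (1 - s) + t * s) = t * (1 - 2 * s)"
    "1 - s - ((1 - t) * s + t * (1 - s)) = (1 - t) * (1 - 2 * s)"
    by (simp_all add: algebra_simps)
  have nz: "(1 - 2 * t) * (1 - 2 * s) \<noteq> 0" using assms s by simp
  have "0 < t * (1 - 2 * s)" "0 < (1 - t) * (1 - 2 * s)" using assms s by simp_all
  then have mx: "0 < max 0 (1 - s - bc i (X [] 1 t))" for i
  proof -
    assume h: "0 < t * (1 - 2 * s)" "0 < (1 - t) * (1 - 2 * s)"
    have "0 < 1 - s - bc 1 (X [] 1 t)" unfolding b using s by simp
    moreover have "0 < 1 - s - bc 2 (X [] 1 t)" unfolding b d using h by simp
    moreover have "0 < 1 - s - bc 3 (X [] 1 t)" unfolding b d using h by simp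
    ultimately have "0 < 1 - s - bc i (X [] 1 t)" using exhaust_3[of i] by metis
    then show ?thesis by simp
  qed
  have "0 < (\<Prod>i\<in>UNIV. max 0 (1 - s - bc i (X [] 1 t)))" by (rule prod_pos) (rule mx)
  moreover have "vdm (\<lambda>i. bc i (X [] 1 t)) \<noteq> 0"
    unfolding vdm_def b d(1) using pos nz by (simp only: mult_eq_0_iff) auto
  ultimately show ?thesis unfolding u0_def by (metis less_irrefl mult_eq_0_iff)
qed

text \<open>One edge suffices: its mass is \<open>1/3 - \<beta>\<close>, and \<open>u0\<close> can
  vanish on it only at the midpoint.\<close>

lemma u0_mu_l_pos:
  assumes \<mu>: "is_mu_l \<alpha> p K \<beta> \<mu>" and \<beta>: "0 < \<beta>" "\<beta> < 1/3"
  shows "0 < (\<integral>x. (u0 x)\<^sup>2 \<partial>\<mu>)"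
proof -
  have pr: "borel_prob_on K \<mu>" using \<mu> by (simp add: is_mu_l_def)
  have c2: "continuous_on K (\<lambda>x. (u0 x)\<^sup>2)" by (intro continuous_intros continuous_u0)
  have int: "integrable \<mu> (\<lambda>x. (u0 x)\<^sup>2)" by (rule integrable_continuous_on_K[OF compact_K pr c2])
  have cX: "continuous_on {0..1} (\<lambda>t. (u0 (X [] 1 t))\<^sup>2)" by (rule continuous_on_X[OF c2])
  obtain C where C: "\<And>t. t \<in> {0..1} \<Longrightarrow> \<bar>(u0 (X [] 1 t))\<^sup>2\<bar> \<le> C" using continuous_bounded_01[OF cX] by blast
  have i01: "integrable leb01 (\<lambda>t. (u0 (X [] 1 t))\<^sup>2)"
    by (rule leb01.integrable_const_bound[of _ C])
      (use C in \<open>auto intro!: AE_I2 borel_measurable_leb01_continuous continuous_on_subset[OF cX]\<close>)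
  have pos: "0 < (\<integral>t. (u0 (X [] 1 t))\<^sup>2 \<partial>leb01)"
  proof (rule ccontr)
    assume "\<not> ?thesis"
    moreover have "0 \<le> (\<integral>t. (u0 (X [] 1 t))\<^sup>2 \<partial>leb01)" by simp
    ultimately have "(\<integral>t. (u0 (X [] 1 t))\<^sup>2 \<partial>leb01) = 0" by linarith
    then have "AE t in leb01. (u0 (X [] 1 t))\<^sup>2 = 0"
      by (subst (asm) integral_nonneg_eq_0_iff_AE[OF i01]) auto
    moreover have "AE t in leb01. t \<noteq> 1 / 2"
      unfolding leb01_def using AE_lborel_singleton[of "1/2"] by (subst AE_restrict_space_iff) auto
    moreover have "AE t in leb01. t \<in> {0<..<1}" by (rule AE_I2) simp
    ultimately have "AE t in leb01. (1::real) = 0"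
      by eventually_elim (use u0_edge_nonzero in auto)
    then have "(\<integral>t. (1::real) \<partial>leb01) = (\<integral>t. 0 \<partial>leb01)" by (intro integral_cong_AE) auto
    then show False by (simp add: leb01_def measure_restrict_space)
  qed
  have "0 < (1/3 - \<beta>) * \<beta> ^ 0 * (\<integral>t. (u0 (X [] 1 t))\<^sup>2 \<partial>leb01)" using pos \<beta> by simp
  also have "\<dots> = (\<integral>x. indicator (edgew \<alpha> p [] 1) x * (u0 x)\<^sup>2 \<partial>\<mu>)"
    using mu_l_edge[OF \<mu> \<beta> c2, of "[]" 1] by simp
  also have "\<dots> \<le> (\<integral>x. (u0 x)\<^sup>2 \<partial>\<mu>)"
    by (rule integral_mono') (use int in \<open>auto split: split_indicator\<close>)
  finally show ?thesis .
qed

subsection \<open>The minimizer\<close>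

lemma linear_coeff_zero:
  fixes a b :: real
  assumes "\<And>t. 0 \<le> 2 * t * a + t\<^sup>2 * b"
  shows "a = 0"
proof (rule ccontr)
  assume a: "a \<noteq> 0"
  \<comment> \<open>This \<open>t\<close> has the sign opposite to \<open>a\<close> and is small
    enough for the linear term to dominate the quadratic one.\<close>
  define t where "t = - a / (\<bar>b\<bar> + 1)"
  have ta: "t * (\<bar>b\<bar> + 1) = - a" by (simp add: t_def)
  have "t\<^sup>2 * b \<le> t\<^sup>2 * (\<bar>b\<bar> + 1)" by (intro mult_left_mono) auto
  also have "\<dots> = - t * a" using ta by (simp add: power2_eq_square mult.assoc)
  finally have "0 \<le> t * a" using assms[of t] by (simp add: mult.assoc)
  also have "t * a = - (a * a) / (\<bar>b\<bar> + 1)" by (simp add: t_def)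
  finally have "0 \<le> - (a * a) / (\<bar>b\<bar> + 1)" .
  moreover have "- (a * a) / (\<bar>b\<bar> + 1) < 0"
  proof (rule divide_neg_pos)
    show "- (a * a) < 0" using a not_sum_squares_lt_zero[of a 0] by (simp add: less_le)
    show "0 < \<bar>b\<bar> + 1" by simp
  qed
  ultimately show False by linarith
qed

text \<open>The weights \<open>c1\<close> and \<open>c2\<close> are kept general to absorb the
  factors that the measures acquire in a cell; \<open>c1 > 0\<close> makes \<open>u0\<close>, once
  normalized, an admissible competitor.\<close>

theorem antisymmetric_minimizer:
  assumes m: "matching_pairs r \<rho>" and \<mu>l: "is_mu_l \<alpha> p K \<beta> \<mu>l" and \<mu>f: "is_mu_f \<alpha> p K \<mu>f"
    and \<beta>: "0 < \<beta>" "\<beta> < 1/3" and c: "0 < c1" "0 \<le> c2"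
  obtains u \<kappa> where "u \<in> DOM r \<rho>" "alternating u"
    "c1 * (\<integral>x. u x * u x \<partial>\<mu>l) + c2 * (\<integral>x. u x * u x \<partial>\<mu>f) = 1"
    "\<And>v. v \<in> DOM r \<rho> \<Longrightarrow> EB r \<rho> u v = \<kappa> * (c1 * (\<integral>x. u x * v x \<partial>\<mu>l) + c2 * (\<integral>x. u x * v x \<partial>\<mu>f))"
proof -
  have prL: "borel_prob_on K \<mu>l" and prF: "borel_prob_on K \<mu>f"
    using \<mu>l \<mu>f by (auto simp: is_mu_l_def is_mu_f_def)
  define I where "I f = c1 * (\<integral>x. f x \<partial>\<mu>l) + c2 * (\<integral>x. f x \<partial>\<mu>f)" for f :: "real^2 \<Rightarrow> real"
  note intl = integrable_continuous_on_K[OF compact_K prL] and intf = integrable_continuous_on_K[OF compact_K prF]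
  have I_add: "I (\<lambda>x. f x + g x) = I f + I g" if "continuous_on K f" "continuous_on K g" for f g
    using intl[OF that(1)] intl[OF that(2)] intf[OF that(1)] intf[OF that(2)]
    by (simp add: I_def algebra_simps)
  have I_cmult: "I (\<lambda>x. a * f x) = a * I f" for a f by (simp add: I_def algebra_simps)
  have I_nonneg: "0 \<le> I f" if "\<And>x. 0 \<le> f x" for f
    unfolding I_def using c that by (intro add_nonneg_nonneg mult_nonneg_nonneg Bochner_Integration.integral_nonneg) auto
  define H where "H = {u \<in> DOM r \<rho>. alternating u}"
  have Hc: "continuous_on K u" "bndd r \<rho> u" "alternating u" "u \<in> DOM r \<rho>" if "u \<in> H" for u
    using that by (auto simp: H_def DOM_def)
  have H_add: "(\<lambda>x. u x + t * v x) \<in> H" if "u \<in> H" "v \<in> H" for u v t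
  proof -
    have "alternating (\<lambda>x. u x + t * v x)" using Hc(3)[OF that(1)] Hc(3)[OF that(2)]
      by (simp add: alternating_def algebra_simps)
    then show ?thesis using DOM_add[OF m Hc(4)[OF that(1)] DOM_cmult[OF Hc(4)[OF that(2)]]] by (simp add: H_def)
  qed
  have H_cmult: "(\<lambda>x. t * u x) \<in> H" if "u \<in> H" for u t
    using Hc(3)[OF that] DOM_cmult[OF Hc(4)[OF that], of t] by (simp add: H_def alternating_def algebra_simps)
  define J where "J u = I (\<lambda>x. u x * u x)" for u
  have J_cmult: "J (\<lambda>x. a * u x) = a\<^sup>2 * J u" for a u
    unfolding J_def using I_cmult[of "a\<^sup>2" "\<lambda>x. u x * u x"] by (simp add: power2_eq_square mult_ac)
  have normalize: "EN r \<rho> (\<lambda>x. 1 / sqrt (J u) * u x) = EN r \<rho> u / J u \<and> J (\<lambda>x. 1 / sqrt (J u) * u x) = 1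
     \<and> (\<lambda>x. 1 / sqrt (J u) * u x) \<in> H" if "u \<in> H" "0 < J u" for u
    using EN_cmult[OF m Hc(4)[OF that(1)], of "1 / sqrt (J u)"] J_cmult[of "1 / sqrt (J u)" u]
      H_cmult[OF that(1), of "1 / sqrt (J u)"] that(2) by (simp add: power_divide)
  define E where "E = EN r \<rho> ` {u \<in> H. J u = 1}"
  have u0H: "u0 \<in> H" by (simp add: H_def u0_DOM[OF m] alternating_u0)
  have "0 < c1 * (\<integral>x. u0 x * u0 x \<partial>\<mu>l)" using u0_mu_l_pos[OF \<mu>l \<beta>] c by (simp add: power2_eq_square)
  moreover have "0 \<le> c2 * (\<integral>x. u0 x * u0 x \<partial>\<mu>f)" using c by simp
  ultimately have u0J: "0 < J u0" unfolding J_def I_def by linarith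
  have Ene: "E \<noteq> {}" unfolding E_def using normalize[OF u0H u0J] by blast
  have E0: "0 \<le> y" if "y \<in> E" for y using that EN_nonneg[OF m Hc(2)] by (auto simp: E_def)
  then have Ebdd: "bdd_below E" by (auto simp: bdd_below_def)
  define \<kappa> where "\<kappa> = Inf E"
  have \<kappa>0: "0 \<le> \<kappa>" unfolding \<kappa>_def using E0 Ene by (intro cInf_greatest) auto
  \<comment> \<open>Homogeneity reduces the Rayleigh bound to normalized functions; where
    \<open>J v = 0\<close> it says only that energies are nonnegative.\<close>
  have ray: "\<kappa> * J v \<le> EN r \<rho> v" if v: "v \<in> H" for v
  proof (cases "J v = 0")
    case True
    then show ?thesis using EN_nonneg[OF m Hc(2)[OF v]] by simp
  next
    case False
    have "0 \<le> J v" unfolding J_def by (rule I_nonneg) simp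
    then have pos: "0 < J v" using False by simp
    have "EN r \<rho> v / J v \<in> E" unfolding E_def using normalize[OF v pos] by force
    then have "\<kappa> \<le> EN r \<rho> v / J v" unfolding \<kappa>_def using Ebdd by (rule cInf_lower)
    then show ?thesis using pos by (simp add: field_simps)
  qed
  have "\<exists>u. u \<in> H \<and> J u = 1 \<and> EN r \<rho> u < \<kappa> + 1 / (real n + 1)" for n
  proof -
    have "\<kappa> < \<kappa> + 1 / (real n + 1)" by simp
    then obtain y where "y \<in> E" "y < \<kappa> + 1 / (real n + 1)"
      using cInf_lessD[OF Ene] unfolding \<kappa>_def by blast
    then show ?thesis by (auto simp: E_def)
  qed
  then obtain f where f: "\<And>n. f n \<in> H" "\<And>n. J (f n) = 1" "\<And>n. EN r \<rho> (f n) < \<kappa> + 1 / (real n + 1)"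
    by metis
  \<comment> \<open>One energy bound for the whole minimizing sequence, to be used both for
    boundedness and for equicontinuity.\<close>
  have fb: "BN k r \<rho> N (f n) (f n) \<le> \<kappa> + 1" for k N n
  proof -
    have "BN k r \<rho> N (f n) (f n) \<le> EN r \<rho> (f n)" by (rule BN_le_EN[OF m Hc(2)[OF f(1)]])
    also have "\<dots> \<le> \<kappa> + 1 / (real n + 1)" using f(3)[of n] by simp
    also have "1 / (real n + 1) \<le> 1" by simp
    finally show ?thesis by simp
  qed
  \<comment> \<open>The oscillation bound is an absolute one, since alternating functions vanish at
    \<open>p 1\<close>.\<close>
  have bound: "norm (f n x) \<le> 20 * sqrt (\<kappa> + 1)" if "x \<in> K" for n x
    using oscillation_le[OF m fb Hc(1)[OF f(1)] that, of n] alternating_vertex[OF Hc(3)[OF f(1)], of n 1] by simp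
  have equi: "\<exists>d. 0 < d \<and> (\<forall>n y. y \<in> K \<and> norm (x - y) < d \<longrightarrow> norm (f n x - f n y) < e)"
    if xe: "x \<in> K" "0 < e" for x e
  proof -
    obtain d where "d > 0" "\<And>u y. continuous_on K u \<Longrightarrow> (\<forall>m N. BN m r \<rho> N u u \<le> \<kappa> + 1) \<Longrightarrow> y \<in> K \<Longrightarrow>
        dist x y < d \<Longrightarrow> \<bar>u x - u y\<bar> < e"
      using equicontinuous[OF m xe, of "\<kappa> + 1"] \<kappa>0 by (metis add_nonneg_pos zero_less_one)
    then show ?thesis using fb Hc(1)[OF f(1)] by (intro exI[of _ d]) (auto simp: dist_norm)
  qed
  obtain g k where g: "continuous_on K g" and k: "strict_mono (k :: nat \<Rightarrow> nat)"
    and unif: "\<And>e. 0 < e \<Longrightarrow> \<exists>N. \<forall>n x. n \<ge> N \<and> x \<in> K \<longrightarrow> norm (f (k n) x - g x) < e"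
    using Arzela_Ascoli[OF compact_K bound equi] by blast
  have lim: "(\<lambda>n. f (k n) x) \<longlonglongrightarrow> g x" if "x \<in> K" for x
    by (rule LIMSEQ_I) (use unif that in blast)
  \<comment> \<open>Lower semicontinuity: each discrete form passes to the limit separately, and all
    of them keep the bound \<open>\<kappa>\<close>.\<close>
  have BNg: "BN i r \<rho> N g g \<le> \<kappa>" for i N
  proof (rule LIMSEQ_le)
    show "(\<lambda>n. BN i r \<rho> N (f (k n)) (f (k n))) \<longlonglongrightarrow> BN i r \<rho> N g g"
      by (rule BN_tendsto[OF lim])
    have "(\<lambda>n. \<kappa> + 1 / (real n + 1)) \<longlonglongrightarrow> \<kappa> + 0"
      by (intro tendsto_add tendsto_const) real_asymp
    then show "(\<lambda>n. \<kappa> + 1 / (real n + 1)) \<longlonglongrightarrow> \<kappa>" by simp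
    have "BN i r \<rho> N (f (k n)) (f (k n)) \<le> \<kappa> + 1 / (real n + 1)" for n
    proof -
      have "BN i r \<rho> N (f (k n)) (f (k n)) \<le> EN r \<rho> (f (k n))" by (rule BN_le_EN[OF m Hc(2)[OF f(1)]])
      also have "\<dots> \<le> \<kappa> + 1 / (real (k n) + 1)" using f(3)[of "k n"] by simp
      also have "1 / (real (k n) + 1) \<le> 1 / (real n + 1)"
        using seq_suble[OF k, of n] by (intro divide_left_mono) auto
      finally show ?thesis by simp
    qed
    then show "\<exists>N0. \<forall>n\<ge>N0. BN i r \<rho> N (f (k n)) (f (k n)) \<le> \<kappa> + 1 / (real n + 1)" by blast
  qed
  have antig: "alternating g"
    unfolding alternating_def
  proof (intro allI impI ballI)
    fix \<pi> x assume \<pi>: "\<pi> permutes (UNIV :: 3 set)" and x: "x \<in> K"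
    have l1: "(\<lambda>n. f (k n) (symm \<pi> x)) \<longlonglongrightarrow> g (symm \<pi> x)" by (rule lim[OF symm_in_K[OF \<pi> x]])
    have "(\<lambda>n. of_int (sign \<pi>) * f (k n) x) \<longlonglongrightarrow> of_int (sign \<pi>) * g x"
      by (intro tendsto_intros lim x)
    then have "(\<lambda>n. f (k n) (symm \<pi> x)) \<longlonglongrightarrow> of_int (sign \<pi>) * g x"
      by (simp add: alternatingD[OF Hc(3)[OF f(1)] \<pi> x])
    with l1 show "g (symm \<pi> x) = of_int (sign \<pi>) * g x" by (rule LIMSEQ_unique)
  qed
  have gH: "g \<in> H" using g antig BNg by (auto simp: H_def DOM_def bndd_def)
  have ENg: "EN r \<rho> g \<le> \<kappa>" by (rule EN_le[OF BNg])
  \<comment> \<open>The uniform bound dominates the squares, so the normalization survives and the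
    limit \<open>g\<close> is not zero.\<close>
  have conv: "(\<lambda>n. \<integral>x. f (k n) x * f (k n) x \<partial>\<mu>) \<longlonglongrightarrow> (\<integral>x. g x * g x \<partial>\<mu>)" if pr: "borel_prob_on K \<mu>" for \<mu>
  proof (rule integral_dominated_convergence)
    note sp = finite_measure_borel_prob_on[OF pr]
    interpret finite_measure \<mu> by (rule sp(2))
    have st: "sets \<mu> = sets (restrict_space borel K)" using pr by (simp add: borel_prob_on_def)
    show "integrable \<mu> (\<lambda>x. 20 * sqrt (\<kappa> + 1) * (20 * sqrt (\<kappa> + 1)))" by simp
    show "(\<lambda>x. g x * g x) \<in> borel_measurable \<mu>" "(\<lambda>x. f (k n) x * f (k n) x) \<in> borel_measurable \<mu>" for n
      by (rule measurable_continuous_on_K[OF st], intro continuous_intros g Hc(1) f(1))+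
    show "AE x in \<mu>. (\<lambda>n. f (k n) x * f (k n) x) \<longlonglongrightarrow> g x * g x"
      by (rule AE_I2) (intro tendsto_mult lim, simp_all add: sp(1))
    show "AE x in \<mu>. norm (f (k n) x * f (k n) x) \<le> 20 * sqrt (\<kappa> + 1) * (20 * sqrt (\<kappa> + 1))" for n
      by (rule AE_I2, unfold norm_mult, rule mult_mono) (use bound sp(1) \<kappa>0 in auto)
  qed
  have "(\<lambda>n. J (f (k n))) \<longlonglongrightarrow> J g"
    unfolding J_def I_def by (intro tendsto_add tendsto_mult tendsto_const conv prL prF)
  then have Jg: "J g = 1" by (simp add: f(2) LIMSEQ_const_iff)
  have ENg': "EN r \<rho> g = \<kappa>" using ENg ray[OF gH] Jg by simp
  \<comment> \<open>The defect of the Rayleigh inequality along \<open>g x + t * v x\<close> is a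
    nonnegative quadratic in \<open>t\<close> without constant term.\<close>
  have varH: "EB r \<rho> g v = \<kappa> * I (\<lambda>x. g x * v x)" if v: "v \<in> H" for v
  proof -
    have "0 \<le> 2 * t * (EB r \<rho> g v - \<kappa> * I (\<lambda>x. g x * v x)) + t\<^sup>2 * (EN r \<rho> v - \<kappa> * J v)" for t
    proof -
      have cg: "continuous_on K (\<lambda>x. g x * g x)" "continuous_on K (\<lambda>x. 2 * t * (g x * v x))" "continuous_on K (\<lambda>x. t\<^sup>2 * (v x * v x))"
        by (intro continuous_intros g Hc(1)[OF v])+
      have "J (\<lambda>x. g x + t * v x) = I (\<lambda>x. (g x * g x + 2 * t * (g x * v x)) + t\<^sup>2 * (v x * v x))"
        unfolding J_def by (rule arg_cong[where f = I]) (auto simp: power2_eq_square algebra_simps)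
      also have "\<dots> = J g + 2 * t * I (\<lambda>x. g x * v x) + t\<^sup>2 * J v"
        using I_add[OF continuous_on_add[OF cg(1,2)] cg(3)] I_add[OF cg(1,2)] I_cmult[of "2 * t" "\<lambda>x. g x * v x"] I_cmult[of "t\<^sup>2" "\<lambda>x. v x * v x"]
        unfolding J_def by linarith
      finally have "J (\<lambda>x. g x + t * v x) = J g + 2 * t * I (\<lambda>x. g x * v x) + t\<^sup>2 * J v" .
      then show ?thesis
        using ray[OF H_add[OF gH v, of t]] EN_linear_comb[OF m Hc(4)[OF gH] Hc(4)[OF v], of t] ENg' Jg
        by (simp add: algebra_simps)
    qed
    then have "EB r \<rho> g v - \<kappa> * I (\<lambda>x. g x * v x) = 0" by (rule linear_coeff_zero)
    then show ?thesis by simp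
  qed
  \<comment> \<open>An arbitrary \<open>v\<close> is replaced by its antisymmetrization, which
    changes neither side.\<close>
  have var: "EB r \<rho> g v = \<kappa> * I (\<lambda>x. g x * v x)" if v: "v \<in> DOM r \<rho>" for v
  proof -
    have PH: "antisymmetrize v \<in> H" using DOM_antisymmetrize[OF m v] alternating_antisymmetrize by (simp add: H_def)
    have cv: "continuous_on K v" using v by (simp add: DOM_def)
    have "EB r \<rho> g v = EB r \<rho> g (antisymmetrize v)"
      using BN_tendsto_EB[OF m Hc(4)[OF gH] v] BN_tendsto_EB[OF m Hc(4)[OF gH] Hc(4)[OF PH]]
      unfolding BN_antisymmetrize[OF antig] by (rule LIMSEQ_unique)
    also have "\<dots> = \<kappa> * I (\<lambda>x. g x * antisymmetrize v x)" by (rule varH[OF PH])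
    also have "I (\<lambda>x. g x * antisymmetrize v x) = I (\<lambda>x. g x * v x)"
      unfolding I_def
      using integral_antisymmetrize[OF mu_l_symm[OF \<mu>l \<beta>] prL antig g cv] integral_antisymmetrize[OF mu_f_symm[OF \<mu>f] prF antig g cv] by simp
    finally show ?thesis .
  qed
  show thesis
    by (rule that[of g \<kappa>, OF Hc(4)[OF gH] antig]) (use Jg var in \<open>simp_all add: J_def I_def\<close>)
qed

end

subsection \<open>Localized eigenfunctions\<close>

theorem lemma6p3:
  fixes \<alpha> \<beta> \<eta> :: real and p :: "3 \<Rightarrow> real^2" and K :: "(real^2) set"
    and r \<rho> :: "nat \<Rightarrow> real" and \<mu>f \<mu>l :: "(real^2) measure" and n :: nat and w :: "3 list"
  assumes "0 < \<alpha>" "\<alpha> < 1" "equilateral p" "is_stretched_gasket \<alpha> p K"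
    and "matching_pairs r \<rho>"
    and "0 < \<beta>" "\<beta> < 1 / 3" "0 < \<eta>" "\<eta> \<le> 1"
    and "is_mu_f \<alpha> p K \<mu>f" "is_mu_l \<alpha> p K \<beta> \<mu>l"
    and "1 \<le> n" "length w = n"
  shows "\<exists>u ev. is_eigenfunction \<alpha> p K r \<rho> (mu_eta K \<eta> \<mu>l \<mu>f) ev u \<and>
           supp_on K u \<subseteq> Gw \<alpha> p w ` K \<and>
           enat (3 ^ n) \<le> eigen_multiplicity \<alpha> p K r \<rho> (mu_eta K \<eta> \<mu>l \<mu>f) ev"
proof -
  interpret gasket \<alpha> p K by unfold_locales fact+
  note m = \<open>matching_pairs r \<rho>\<close> and \<beta> = \<open>0 < \<beta>\<close> \<open>\<beta> < 1/3\<close> and \<mu>f = \<open>is_mu_f \<alpha> p K \<mu>f\<close> and \<mu>l = \<open>is_mu_l \<alpha> p K \<beta> \<mu>l\<close>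
  have prL: "borel_prob_on K \<mu>l" and prF: "borel_prob_on K \<mu>f"
    using \<mu>l \<mu>f by (auto simp: is_mu_l_def is_mu_f_def)
  \<comment> \<open>The factors that \<open>\<mu>l\<close> and \<open>\<mu>f\<close> acquire in a
    cell of level \<open>n\<close>, combined with the mixing weights.\<close>
  define c1 c2 where "c1 = \<eta> * \<beta> ^ n" and "c2 = (1 - \<eta>) * (1/3) ^ n"
  have c: "0 < c1" "0 \<le> c2" using assms by (auto simp: c1_def c2_def)
  obtain u \<kappa> where u: "u \<in> DOM (shn n r) (shn n \<rho>)" and anti: "alternating u"
    and norm: "c1 * (\<integral>x. u x * u x \<partial>\<mu>l) + c2 * (\<integral>x. u x * u x \<partial>\<mu>f) = 1"
    and var: "\<And>v. v \<in> DOM (shn n r) (shn n \<rho>) \<Longrightarrow> EB (shn n r) (shn n \<rho>) u v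
       = \<kappa> * (c1 * (\<integral>x. u x * v x \<partial>\<mu>l) + c2 * (\<integral>x. u x * v x \<partial>\<mu>f))"
    using antisymmetric_minimizer[OF matching_shn[OF m, of n] \<mu>l \<mu>f \<beta> c] by blast
  have uc: "continuous_on K u" using u by (simp add: DOM_def)
  note u0 = alternating_vertex[OF anti]
  define M where "M = mu_eta K \<eta> \<mu>l \<mu>f"
  have prM: "borel_prob_on K M" and intM: "\<And>g. continuous_on K g \<Longrightarrow>
      (\<integral>x. g x \<partial>M) = \<eta> * (\<integral>x. g x \<partial>\<mu>l) + (1 - \<eta>) * (\<integral>x. g x \<partial>\<mu>f)"
    unfolding M_def using mu_eta_props[OF prL prF] assms by auto
  note spM = finite_measure_borel_prob_on[OF prM]
  have stM: "sets M = sets (restrict_space borel K)" using prM by (simp add: borel_prob_on_def)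
  define IM where "IM = interior_measure p K M"
  have Ks: "K - range p \<in> sets M"
  proof -
    have "closed (range p)" by (intro finite_imp_closed) simp
    then show ?thesis unfolding stM using closed_K by (subst sets_restrict_space_iff) auto
  qed
  have spI: "space IM = K - range p"
    unfolding IM_def interior_measure_def by (simp add: space_restrict_space spM(1) Int_absorb2)
  have finI: "finite_measure IM"
    unfolding IM_def interior_measure_def by (rule finite_measure_restrict_space[OF spM(2) Ks])
  have measI: "f \<in> borel_measurable IM" if "continuous_on K f" for f :: "real^2 \<Rightarrow> real"
    unfolding IM_def interior_measure_def
    by (intro measurable_restrict_space1 measurable_continuous_on_K[OF stM that])
  \<comment> \<open>Removing the vertices does not affect integrands that vanish there, and all
    integrands below contain a transplant of \<open>u\<close>.\<close>
  have intI: "(\<integral>x. f x \<partial>IM) = (\<integral>x. f x \<partial>M)" if "\<And>i. f (p i) = 0" for f :: "real^2 \<Rightarrow> real"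
  proof -
    have "(\<integral>x. f x \<partial>IM) = (\<integral>x. indicator (K - range p) x *\<^sub>R f x \<partial>M)"
      unfolding IM_def interior_measure_def using Ks sets.sets_into_space[OF Ks]
      by (intro integral_restrict_space) (simp add: Int_absorb2)
    also have "\<dots> = (\<integral>x. f x \<partial>M)"
      using that spM(1) by (intro Bochner_Integration.integral_cong) (auto simp: indicator_def)
    finally show ?thesis .
  qed
  \<comment> \<open>\<open>\<kappa>\<close> belongs to the rescaled problem on the whole gasket.
    Returning to the cell divides the form by \<open>delta r n\<close>, while the scaling of the
    measures is already contained in \<open>c1\<close> and \<open>c2\<close>.\<close>
  define ev where "ev = \<kappa> / delta r n"
  have TWc: "continuous_on K (TW v u)" and TW0: "TW v u (p i) = 0" for v i
    using TW_props[OF uc u0] by auto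
  have pairing: "(\<integral>x. TW v u x * g x \<partial>M) = c1 * (\<integral>x. u x * g (GW v x) \<partial>\<mu>l) + c2 * (\<integral>x. u x * g (GW v x) \<partial>\<mu>f)"
    if v: "length v = n" and g: "continuous_on K g" for v g
  proof -
    have "(\<integral>x. TW v u x * g x \<partial>M) = \<eta> * (\<integral>x. TW v u x * g x \<partial>\<mu>l) + (1 - \<eta>) * (\<integral>x. TW v u x * g x \<partial>\<mu>f)"
      by (intro intM continuous_intros TWc g)
    also have "(\<integral>x. TW v u x * g x \<partial>\<mu>l) = \<beta> ^ length v * (\<integral>x. u x * g (GW v x) \<partial>\<mu>l)"
      by (rule mu_l_TW[OF \<mu>l \<beta> uc u0 g])
    also have "(\<integral>x. TW v u x * g x \<partial>\<mu>f) = (1/3) ^ length v * (\<integral>x. u x * g (GW v x) \<partial>\<mu>f)"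
      by (rule mu_f_TW[OF \<mu>f uc u0 g])
    finally show ?thesis unfolding v c1_def c2_def by (simp only: mult.assoc)
  qed
  \<comment> \<open>As \<open>u\<close> was normalized with the weights \<open>c1\<close> and
    \<open>c2\<close>, each transplant has norm 1 with respect to \<open>M\<close>.\<close>
  have sq: "(\<integral>x. TW v u x * TW v u x \<partial>M) = 1" if v: "length v = n" for v
  proof -
    have "(\<integral>x. u x * TW v u (GW v x) \<partial>\<mu>) = (\<integral>x. u x * u x \<partial>\<mu>)" if "space \<mu> = K" for \<mu>
      using that by (intro Bochner_Integration.integral_cong) (auto simp: TW_GW)
    then show ?thesis
      using pairing[OF v TWc] norm finite_measure_borel_prob_on(1)[OF prL] finite_measure_borel_prob_on(1)[OF prF] by simp
  qed
  \<comment> \<open>The transplants live in disjoint cells, so their products vanish pointwise on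
    \<open>K\<close> and not just in the mean.\<close>
  have orth: "TW v u x * TW v' u x = 0" if "length v = n" "length v' = n" "v \<noteq> v'" "x \<in> K" for v v' x
  proof (cases "x \<in> GW v ` K")
    case True
    then obtain y where "y \<in> K" "x = GW v y" by blast
    then show ?thesis using TW_GW_other[of y v' v u] that by simp
  next
    case False
    moreover have "v \<noteq> []" using that(1) assms(12) by auto
    ultimately show ?thesis using TW_outside[of v x u] by simp
  qed
  have eig: "TW v u \<in> eigenspace \<alpha> p K r \<rho> M ev" if v: "length v = n" for v
    unfolding eigenspace_def neg_laplacian_def mem_Collect_eq IM_def[symmetric]
  proof (intro conjI ballI)
    have D: "TW v u \<in> DOM r \<rho>" using DOM_TW[OF m, of u v] u u0 v by simp
    then show "TW v u \<in> dom_energy0 \<alpha> p K r \<rho>"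
      by (auto simp: dom_energy0_def dom_energy_eq(1)[OF m] TW0)
    have "compact (TW v u ` K)" by (rule compact_continuous_image[OF TWc compact_K])
    then obtain C where C: "\<forall>y\<in>TW v u ` K. norm y \<le> C" using compact_imp_bounded bounded_iff by metis
    then have "in_L2 IM (TW v u)"
      by (intro in_L2_bounded[OF finI measI[OF TWc], where C = C]) (auto simp: spI)
    then show "in_L2 IM (\<lambda>x. ev * TW v u x)" by (rule in_L2_cmult)
    fix g assume "g \<in> dom_energy0 \<alpha> p K r \<rho>"
    then have g: "g \<in> DOM r \<rho>" "\<And>i. g (p i) = 0" by (auto simp: dom_energy0_def dom_energy_eq(1)[OF m])
    have gc: "continuous_on K g" using g(1) by (simp add: DOM_def)
    have "energy_form \<alpha> p r \<rho> (TW v u) g = EB r \<rho> (TW v u) g" by (rule energy_form_eq[OF m D g(1)])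
    also have "\<dots> = EB (shn n r) (shn n \<rho>) u (\<lambda>x. g (GW v x)) / delta r n"
      using EB_TW[OF m, of u v g] u u0 g(1) v by simp
    \<comment> \<open>The restriction of \<open>g\<close> to the cell need not vanish at its
      corners; the equation for \<open>u\<close> applies because it holds against all of
      \<open>DOM\<close>.\<close>
    also have "\<dots> = ev * (c1 * (\<integral>x. u x * g (GW v x) \<partial>\<mu>l) + c2 * (\<integral>x. u x * g (GW v x) \<partial>\<mu>f))"
      using var[of "\<lambda>x. g (GW v x)"] DOM_GW[OF m g(1), of v] v by (simp add: ev_def)
    also have "\<dots> = ev * (\<integral>x. TW v u x * g x \<partial>M)" by (simp add: pairing[OF v gc])
    also have "\<dots> = (\<integral>x. ev * TW v u x * g x \<partial>IM)"
      using intI[of "\<lambda>x. ev * TW v u x * g x"] g(2) by (auto simp: mult.assoc)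
    finally show "energy_form \<alpha> p r \<rho> (TW v u) g = (\<integral>x. ev * TW v u x * g x \<partial>IM)" .
  qed
  have nz: "\<not> (AE x in IM. TW v u x = 0)" if v: "length v = n" for v
  proof
    assume "AE x in IM. TW v u x = 0"
    then have "(\<integral>x. TW v u x * TW v u x \<partial>IM) = (\<integral>x. 0 \<partial>IM)"
      by (intro integral_cong_AE) (auto intro!: measI continuous_intros TWc)
    then show False using intI[of "\<lambda>x. TW v u x * TW v u x"] TW0 sq[OF v] by simp
  qed
  define B where "B = (\<lambda>v. TW v u) ` {v. length v = n}"
  have inj: "inj_on (\<lambda>v. TW v u) {v. length v = n}"
  proof (rule inj_onI, rule ccontr)
    fix v v' assume v: "v \<in> {v. length v = n}" "v' \<in> {v. length v = n}" "TW v u = TW v' u" "v \<noteq> v'"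
    then have "(\<integral>x. TW v u x * TW v u x \<partial>M) = (\<integral>x. 0 \<partial>M)"
      using orth[of v v'] spM(1) by (intro Bochner_Integration.integral_cong) auto
    then show False using sq v by simp
  qed
  have finB: "finite B" unfolding B_def by (intro finite_imageI finite_words)
  have cardB: "card B = 3 ^ n" unfolding B_def card_image[OF inj] by (rule card_words)
  have indep: "L2_independent IM B"
    unfolding L2_independent_def
  proof (intro allI impI ballI)
    fix a b assume ae: "AE x in IM. (\<Sum>b\<in>B. a b * b x) = 0" and b: "b \<in> B"
    obtain v where v: "length v = n" "b = TW v u" using b by (auto simp: B_def)
    \<comment> \<open>Multiplying the combination by one basis function isolates its coefficient,
      since all mixed products vanish.\<close>
    have pt: "(\<Sum>b'\<in>B. a b' * b' x) * b x = a b * (b x * b x)" if x: "x \<in> K" for x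
    proof -
      have "(\<Sum>b'\<in>B. a b' * b' x) * b x = (\<Sum>b'\<in>B. if b' = b then a b * (b x * b x) else 0)"
        unfolding sum_distrib_right
      proof (rule sum.cong[OF refl])
        fix b' assume "b' \<in> B"
        then obtain v' where "length v' = n" "b' = TW v' u" by (auto simp: B_def)
        then show "a b' * b' x * b x = (if b' = b then a b * (b x * b x) else 0)"
          using orth[of v' v x] v x by (auto simp: mult.assoc)
      qed
      then show ?thesis using b finB by simp
    qed
    have "AE x in IM. a b * (b x * b x) = 0"
      using ae AE_space[of IM]
    proof eventually_elim
      case (elim x)
      then show ?case using pt[of x] spI by simp
    qed
    then have "(\<integral>x. a b * (b x * b x) \<partial>IM) = (\<integral>x. 0 \<partial>IM)"
      by (intro integral_cong_AE) (auto intro!: measI continuous_intros TWc simp: v(2))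
    then have "a b * (\<integral>x. TW v u x * TW v u x \<partial>M) = 0"
      using intI[of "\<lambda>x. a b * (b x * b x)"] TW0 by (auto simp: v(2))
    then show "a b = 0" using sq[OF v(1)] by simp
  qed
  have mult: "enat (3 ^ n) \<le> eigen_multiplicity \<alpha> p K r \<rho> M ev"
    unfolding eigen_multiplicity_def
    by (rule SUP_upper2[of B]) (use finB indep eig cardB in \<open>auto simp: IM_def B_def\<close>)
  have supp: "supp_on K (TW w u) \<subseteq> GW w ` K"
    unfolding supp_on_def
  proof (rule closure_minimal)
    have "w \<noteq> []" using assms(12,13) by auto
    then show "{x \<in> K. TW w u x \<noteq> 0} \<subseteq> GW w ` K" using TW_outside[of w _ u] by blast
    show "closed (GW w ` K)"
      by (intro compact_imp_closed compact_continuous_image continuous_GW compact_K)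
  qed
  have "is_eigenfunction \<alpha> p K r \<rho> M ev (TW w u)"
    unfolding is_eigenfunction_def IM_def[symmetric] using eig nz assms(13) by blast
  with supp mult show ?thesis unfolding M_def by blast
qed

end
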